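(* Let $P_n(x)=a_n\prod_{k=1}^n(x-\alpha_{k,n})$, $n\in\mathcal{N}$, where $\mathcal{N}\subset\mathbb{N}$ is infinite, be a sequence of polynomials such that each $P_n$ has integer coefficients, exact degree $n$ (so $a_n\ne0$), and simple zeros all lying in $\mathbb{R}_+=[0,\infty)$. Let $E\subset\mathbb{R}_+$ be a compact set of logarithmic capacity $1$. If $$\lim_{\mathcal{N}\ni n\to\infty}\left(M_E(P_n)\right)^{1/n}=1,$$ then $$\liminf_{\mathcal{N}\ni n\to\infty}S_m(\alpha_{1,n},\ldots,\alpha_{n,n})\ge 2^m\quad\text{for every } m\in\mathbb{N}.$$ Equality holds in the last inequality, for every $m\in\mathbb{N}$, when $\alpha_{1,n},\ldots,\alpha_{n,n}$ are the roots of the polynomials $t_n(x)=2\cos\left(n\arccos((x-2)/2)\right)$.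
   Context: The symmetric means are $S_m(x_1,\ldots,x_n):=\binom{n}{m}^{-1}\sum_{j_1<j_2<\ldots<j_m}x_{j_1}x_{j_2}\cdots x_{j_m}$ (for $n\ge m$). For a compact set $E\subset\mathbb{C}$ of logarithmic capacity $1$, let $\Omega_E$ be the unbounded connected component of $\overline{\mathbb{C}}\setminus E$ and $g_E(z,\infty)$ the Green function of $\Omega_E$ with pole at $\infty$. The generalized Mahler measure of $P_n(z)=a_n\prod_{k=1}^n(z-\alpha_{k,n})$, $a_n\neq0$, is $M_E(P_n):=|a_n|\exp\left(\sum_{\alpha_{k,n}\in\Omega_E}g_E(\alpha_{k,n},\infty)\right)$, where an empty sum is zero. The polynomials $t_n$ are the Chebyshev polynomials of the segment $[0,4]$: $t_n$ is the polynomial in $x$ given for $x\in[0,4]$ by the displayed formula. *)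

theory Defs
  imports
    "HOL-Probability.Probability"
    "HOL-Computational_Algebra.Polynomial"
    "HOL-Library.Landau_Symbols"
begin

text \<open>
  Potential theory follows Ransford, \<^emph>\<open>Potential Theory in the Complex Plane\<close>,
  except that the energy is taken with the kernel \<open>log (1/|z - w|)\<close>.
\<close>

text \<open>
  The kernel is \<open>\<infinity>\<close> on the diagonal, which has to be said explicitly because \<open>ln 0 = 0\<close>
  for the library logarithm. As \<^const>\<open>ennreal\<close> maps negative numbers to \<open>0\<close>, the two
  integrals are those of the positive and of the negative part of the kernel; the second one is
  finite whenever \<open>\<mu>\<close> has bounded support.
\<close>

definition log_energy :: "complex measure \<Rightarrow> ereal" where
  "log_energy \<mu> =
     enn2ereal (\<integral>\<^sup>+z. \<integral>\<^sup>+w. (if z = w then \<infinity> else ennreal (- ln (dist z w))) \<partial>\<mu> \<partial>\<mu>)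
   - enn2ereal (\<integral>\<^sup>+z. \<integral>\<^sup>+w. ennreal (ln (dist z w)) \<partial>\<mu> \<partial>\<mu>)"

definition prob_measures_on :: "complex set \<Rightarrow> complex measure set" where
  "prob_measures_on S =
     {\<mu>. prob_space \<mu> \<and> sets \<mu> = sets borel \<and> (\<exists>K. compact K \<and> K \<subseteq> S \<and> emeasure \<mu> (- K) = 0)}"

definition log_capacity :: "complex set \<Rightarrow> ennreal" where
  "log_capacity S =
     (SUP \<mu>\<in>prob_measures_on S.
        if log_energy \<mu> = \<infinity> then 0 else ennreal (exp (- real_of_ereal (log_energy \<mu>))))"

text \<open>Twice continuously differentiable with vanishing Laplacian.\<close>

definition harmonic_on :: "(complex \<Rightarrow> real) \<Rightarrow> complex set \<Rightarrow> bool" (infixl "harmonic'_on" 50) where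
  "h harmonic_on U \<longleftrightarrow> open U \<and>
     (\<exists>hx hy hxx hxy hyx hyy.
        continuous_on U hxx \<and> continuous_on U hxy \<and> continuous_on U hyx \<and> continuous_on U hyy \<and>
        (\<forall>z\<in>U. (h has_derivative (\<lambda>v. hx z * Re v + hy z * Im v)) (at z) \<and>
               (hx has_derivative (\<lambda>v. hxx z * Re v + hxy z * Im v)) (at z) \<and>
               (hy has_derivative (\<lambda>v. hyx z * Re v + hyy z * Im v)) (at z) \<and>
               hxx z + hyy z = 0))"

text \<open>
  For compact \<open>E\<close>, the finite part of the unbounded component of the complement of \<open>E\<close> is
  \<^term>\<open>outside E\<close>. The clauses say that \<open>g\<close> is harmonic there, is bounded away from \<open>\<infinity>\<close>, has a
  logarithmic pole at \<open>\<infinity>\<close>, and has boundary value \<open>0\<close> at all boundary points outside a Borel set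
  of capacity zero.
\<close>

definition is_green_function :: "complex set \<Rightarrow> (complex \<Rightarrow> real) \<Rightarrow> bool" where
  "is_green_function E g \<longleftrightarrow>
     g harmonic_on outside E \<and>
     (\<forall>R. bounded (g ` (outside E \<inter> ball 0 R))) \<and>
     (\<lambda>z. g z - ln (norm z)) \<in> O[at_infinity](\<lambda>_. 1) \<and>
     (\<exists>N\<in>sets borel. log_capacity N = 0 \<and>
        (\<forall>\<zeta>\<in>frontier (outside E) - N. (g \<longlongrightarrow> 0) (at \<zeta> within outside E)))"

text \<open>
  For compact \<open>E\<close> of positive capacity the Green function exists and is unique on
  \<^term>\<open>outside E\<close>; the values elsewhere are never used.
\<close>

definition green_function :: "complex set \<Rightarrow> complex \<Rightarrow> real" where
  "green_function E = (SOME g. is_green_function E g)"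

definition mahler_measure :: "complex set \<Rightarrow> complex poly \<Rightarrow> real" where
  "mahler_measure E p =
     norm (lead_coeff p) *
     exp (\<Sum>\<alpha>\<in>#filter_mset (\<lambda>\<alpha>. \<alpha> \<in> outside E) (proots p). green_function E \<alpha>)"

text \<open>The variables are \<open>x 1, \<dots>, x n\<close>; meaningful for \<open>m \<le> n\<close>.\<close>

definition symmetric_mean :: "nat \<Rightarrow> nat \<Rightarrow> (nat \<Rightarrow> real) \<Rightarrow> real" where
  "symmetric_mean m n x =
     (\<Sum>J | J \<subseteq> {1..n} \<and> card J = m. \<Prod>j\<in>J. x j) / real (n choose m)"

definition cheb04 :: "nat \<Rightarrow> real poly" where
  "cheb04 n = (THE p. \<forall>x\<in>{0..4}. poly p x = 2 * cos (real n * arccos ((x - 2) / 2)))"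

lemma cheb04_exists:
  "\<exists>p. degree p \<le> n \<and> (\<forall>x\<in>{0..4}. poly p x = 2 * cos (real n * arccos ((x - 2) / 2)))"
proof (induction n rule: less_induct)
  case (less n)
  consider "n = 0" | "n = 1" | m where "n = Suc (Suc m)"
    by (metis One_nat_def not0_implies_Suc)
  then show ?case
  proof cases
    case 1
    then show ?thesis by (intro exI[of _ "[:2:]"]) auto
  next
    case 2
    then show ?thesis by (intro exI[of _ "[:-2, 1:]"]) (auto simp: cos_arccos)
  next
    case 3
    from less[of m] 3 obtain p where p: "degree p \<le> m"
      "\<And>x. x \<in> {0..4} \<Longrightarrow> poly p x = 2 * cos (real m * arccos ((x - 2) / 2))" by auto
    from less[of "Suc m"] 3 obtain q where q: "degree q \<le> Suc m"
      "\<And>x. x \<in> {0..4} \<Longrightarrow> poly q x = 2 * cos (real (Suc m) * arccos ((x - 2) / 2))" by auto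
    let ?r = "[:-2, 1:] * q - p"
    have "degree ([:-2, 1:] * q) \<le> Suc (Suc m)"
      using degree_mult_le[of "[:-2, 1:]" q] q(1) by auto
    then have "degree ?r \<le> n"
      using p(1) 3 by (intro degree_diff_le) auto
    moreover have "poly ?r x = 2 * cos (real n * arccos ((x - 2) / 2))" if x: "x \<in> {0..4}" for x
    proof -
      define \<theta> where "\<theta> = arccos ((x - 2) / 2)"
      have c: "cos \<theta> = (x - 2) / 2"
        using x by (auto simp: \<theta>_def cos_arccos)
      have a1: "real n * \<theta> = real (Suc m) * \<theta> + \<theta>" and a2: "real m * \<theta> = real (Suc m) * \<theta> - \<theta>"
        using 3 by (auto simp: algebra_simps)
      have "cos (real n * \<theta>) + cos (real m * \<theta>) = 2 * cos (real (Suc m) * \<theta>) * cos \<theta>"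
        unfolding a1 a2 cos_add cos_diff by simp
      then show ?thesis
        using p(2)[OF x] q(2)[OF x] c unfolding \<theta>_def[symmetric]
        by (simp add: algebra_simps)
    qed
    ultimately show ?thesis by blast
  qed
qed

lemma poly_eqI_Icc04:
  fixes p q :: "real poly"
  assumes "\<And>x. x \<in> {0..4} \<Longrightarrow> poly p x = poly q x"
  shows "p = q"
proof (rule ccontr)
  assume "p \<noteq> q"
  then have "finite {x. poly (p - q) x = 0}"
    by (intro poly_roots_finite) simp
  moreover have "{0..4} \<subseteq> {x. poly (p - q) x = 0}"
    using assms by auto
  ultimately have "finite {0..4::real}"
    by (rule rev_finite_subset)
  then show False
    by (simp add: infinite_Icc)
qed

lemma cheb04_unique:
  assumes "\<And>x. x \<in> {0..4} \<Longrightarrow> poly p x = 2 * cos (real n * arccos ((x - 2) / 2))"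
  shows "cheb04 n = p"
  unfolding cheb04_def
proof (rule the_equality)
  show "\<forall>x\<in>{0..4}. poly p x = 2 * cos (real n * arccos ((x - 2) / 2))"
    using assms by simp
  fix q assume "\<forall>x\<in>{0..4}. poly q x = 2 * cos (real n * arccos ((x - 2) / 2))"
  then show "q = p"
    using assms by (intro poly_eqI_Icc04) simp
qed

lemma
  shows poly_cheb04: "x \<in> {0..4} \<Longrightarrow> poly (cheb04 n) x = 2 * cos (real n * arccos ((x - 2) / 2))"
    and degree_cheb04_le: "degree (cheb04 n) \<le> n"
proof -
  obtain p where p: "degree p \<le> n"
    "\<forall>x\<in>{0..4}. poly p x = 2 * cos (real n * arccos ((x - 2) / 2))"
    using cheb04_exists by blast
  from p(2) have eq: "cheb04 n = p"
    by (intro cheb04_unique) blast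
  show "degree (cheb04 n) \<le> n"
    unfolding eq by (rule p(1))
  show "poly (cheb04 n) x = 2 * cos (real n * arccos ((x - 2) / 2))" if "x \<in> {0..4}"
    unfolding eq using p(2) that by blast
qed

lemma proots_cheb04:
  "proots (cheb04 n) =
     image_mset (\<lambda>k. 2 + 2 * cos ((2 * real k - 1) * pi / (2 * real n))) (mset_set {1..n})"
  (is "_ = image_mset ?r _")
proof (cases "n = 0")
  case True
  have "cheb04 0 = [:2:]"
    by (rule cheb04_unique) simp
  then show ?thesis using True by simp
next
  case False
  have nz: "cheb04 n \<noteq> 0"
  proof
    assume "cheb04 n = 0"
    then show False using poly_cheb04[of 4 n] by simp
  qed
  have range: "0 \<le> (2 * real k - 1) * pi / (2 * real n)" "(2 * real k - 1) * pi / (2 * real n) \<le> pi"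
    if "k \<in> {1..n}" for k
  proof -
    have "(2 * real k - 1) * pi \<le> (2 * real n) * pi"
      using that by (intro mult_right_mono) auto
    then show "(2 * real k - 1) * pi / (2 * real n) \<le> pi"
      using False by (simp add: pos_divide_le_eq mult.commute)
    show "0 \<le> (2 * real k - 1) * pi / (2 * real n)"
      using that by (intro divide_nonneg_nonneg mult_nonneg_nonneg) auto
  qed
  have inj: "inj_on ?r {1..n}"
  proof (rule inj_onI)
    fix i j assume ij: "i \<in> {1..n}" "j \<in> {1..n}" "?r i = ?r j"
    have "(2 * real i - 1) * pi / (2 * real n) = (2 * real j - 1) * pi / (2 * real n)"
      by (rule cos_inj_pi) (use ij range in simp_all)
    then show "i = j" using False by simp
  qed
  have "poly (cheb04 n) (?r k) = 0" if k: "k \<in> {1..n}" for k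
  proof -
    let ?t = "(2 * real k - 1) * pi / (2 * real n)"
    have "arccos (cos ?t) = ?t"
      using range[OF k] by (rule arccos_cos)
    moreover have "?r k \<in> {0..4}"
      using cos_ge_minus_one[of ?t] cos_le_one[of ?t]
      unfolding atLeastAtMost_iff by linarith
    ultimately have "poly (cheb04 n) (?r k) = 2 * cos (real n * ?t)"
      by (simp add: poly_cheb04)
    also have "real n * ?t = real k * pi - pi / 2"
      using False by (simp add: field_simps)
    also have "cos \<dots> = 0"
      by (simp add: cos_diff)
    finally show ?thesis by simp
  qed
  then have ord: "order (?r k) (cheb04 n) \<ge> 1" if "k \<in> {1..n}" for k
    using that nz order_root[of "cheb04 n" "?r k"] by (simp add: Suc_le_eq)
  have "mset_set (?r ` {1..n}) \<subseteq># proots (cheb04 n)"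
  proof (rule mset_subset_eqI)
    fix x show "count (mset_set (?r ` {1..n})) x \<le> count (proots (cheb04 n)) x"
    proof (cases "x \<in> ?r ` {1..n}")
      case True
      then obtain k where k: "k \<in> {1..n}" "x = ?r k" by blast
      have "count (mset_set (?r ` {1..n})) x = 1"
        using True by (intro count_mset_set(1)) auto
      then show ?thesis
        using ord[OF k(1)] nz k(2) by simp
    next
      case False
      then show ?thesis by (simp only: count_mset_set(3) le0 not_False_eq_True)
    qed
  qed
  moreover have "size (proots (cheb04 n)) \<le> size (mset_set (?r ` {1..n}))"
    using size_proots_le[of "cheb04 n"] degree_cheb04_le[of n] card_image[OF inj] by simp
  ultimately have "proots (cheb04 n) = mset_set (?r ` {1..n})"
    by (metis mset_subset_size linorder_not_le subset_mset.nless_le)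
  then show ?thesis
    using inj by (simp add: image_mset_mset_set)
qed

end

theory Submission
  imports
    "Jordan_Normal_Form.Determinant"
    "HOL-Complex_Analysis.Complex_Analysis"
    "HOL-Computational_Algebra.Fundamental_Theorem_Algebra"
    "HOL-Real_Asymp.Real_Asymp"
    Defs
begin

text \<open>
  The Green function is positive off \<open>E\<close>, so \<open>M\<^sub>E(P\<^sub>n)\<^bsup>1/n\<^esup> \<rightarrow> 1\<close> forces \<open>\<bar>a\<^sub>n\<bar>\<^bsup>1/n\<^esup> \<rightarrow> 1\<close>
  and makes every weak limit \<open>\<tau>\<close> of the zero-counting measures live on \<open>E\<close>. Since the discriminants
  are nonzero integers, \<open>\<tau>\<close> has logarithmic energy at most \<open>0\<close>, which is the minimum for capacity \<open>1\<close>;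
  so the potential \<open>\<integral> ln \<bar>z - t\<bar> d\<tau>(t)\<close> is nonnegative everywhere. The monic Laguerre polynomials
  \<open>q\<^sub>n\<close>, rescaled by \<open>n\<close>, satisfy \<open>ln \<bar>q\<^sub>n(s)\<bar> / n \<le> s/2 - 1 + o(1)\<close> on the half-line; integrating this
  against \<open>\<tau>\<close> gives \<open>\<integral> s d\<tau>(s) \<ge> 2\<close>. Finally \<open>S\<^sub>m\<close> is monotone, and for bounded arguments it is
  asymptotic to the \<open>m\<close>-th power of the mean.
\<close>

section \<open>Symmetric means\<close>

text \<open>Two obstacles shape the argument: the zeros may be unbounded and \<open>E\<close> may be
  irregular. Against the first, the Green function is added to the logarithmic kernel: it grows like
  the logarithm and its sum over the zeros is o(n), so the energies stay bounded below and the
  counting measures are tight. Against the second, positivity of the Green function is proved with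
  barriers, since its boundary value 0 is known only outside a set of capacity zero. As the function
  is picked by \<open>SOME\<close>, its existence comes first, from an energy-minimizing measure.
  The real line helps throughout: the complement of \<open>E\<close> is connected, weak limits have
  pointwise convergent representatives, and the potential bound crosses gaps of the support because
  the logarithm is concave. The Laguerre polynomials are chosen because their zeros, divided by n,
  tend to the Marchenko-Pastur law on [0,4], whose logarithmic potential there is s/2 - 1; for the
  arcsine law of [0,4], which has mean 2, the resulting inequality is sharp.\<close>

lemma sum_prod_subsets_step:
  fixes x :: "'a \<Rightarrow> 'b::comm_ring_1"
  assumes "finite A"
  shows "of_nat (Suc m) * (\<Sum>J | J \<subseteq> A \<and> card J = Suc m. \<Prod>j\<in>J. x j) =
    (\<Sum>J | J \<subseteq> A \<and> card J = m. (\<Prod>j\<in>J. x j) * (\<Sum>j\<in>A - J. x j))"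
proof -
  have fin: "finite {J. J \<subseteq> A \<and> card J = k}" for k
    using assms by (auto intro: rev_finite_subset[of "Pow A"])
  have "(\<Sum>J | J \<subseteq> A \<and> card J = m. (\<Prod>j\<in>J. x j) * (\<Sum>j\<in>A - J. x j)) =
     (\<Sum>J | J \<subseteq> A \<and> card J = m. \<Sum>j\<in>A - J. (\<Prod>i\<in>J. x i) * x j)"
    by (simp add: sum_distrib_left)
  also have "\<dots> = (\<Sum>(J, j)\<in>(SIGMA J:{J. J \<subseteq> A \<and> card J = m}. A - J). (\<Prod>i\<in>J. x i) * x j)"
    using assms fin by (subst sum.Sigma) auto
  \<comment> \<open>An (m+1)-set with a marked element is the same as an m-set with an element
    outside it; the factor \<open>Suc m\<close> counts the possible marks.\<close>
  also have "\<dots> = (\<Sum>(J, j)\<in>(SIGMA J:{J. J \<subseteq> A \<and> card J = Suc m}. J). \<Prod>i\<in>J. x i)"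
  proof (rule sum.reindex_bij_witness[where i = "\<lambda>(J, j). (J - {j}, j)" and j = "\<lambda>(J, j). (insert j J, j)"])
    fix a assume "a \<in> (SIGMA J:{J. J \<subseteq> A \<and> card J = m}. A - J)"
    then obtain J j where a: "a = (J, j)" "J \<subseteq> A" "card J = m" "j \<in> A" "j \<notin> J" by auto
    moreover have "finite J" using a(2) assms by (rule finite_subset)
    ultimately show "(case a of (J, j) \<Rightarrow> (insert j J, j)) \<in> (SIGMA J:{J. J \<subseteq> A \<and> card J = Suc m}. J)"
      "(case (case a of (J, j) \<Rightarrow> (insert j J, j)) of (J, j) \<Rightarrow> (J - {j}, j)) = a"
      "(case (case a of (J, j) \<Rightarrow> (insert j J, j)) of (J, j) \<Rightarrow> \<Prod>i\<in>J. x i) = (case a of (J, j) \<Rightarrow> (\<Prod>i\<in>J. x i) * x j)"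
      by (auto simp: mult.commute)
  next
    fix b assume "b \<in> (SIGMA J:{J. J \<subseteq> A \<and> card J = Suc m}. J)"
    then obtain J j where b: "b = (J, j)" "J \<subseteq> A" "card J = Suc m" "j \<in> J" by auto
    moreover have "finite J" using b(2) assms by (rule finite_subset)
    ultimately show "(case b of (J, j) \<Rightarrow> (J - {j}, j)) \<in> (SIGMA J:{J. J \<subseteq> A \<and> card J = m}. A - J)"
      "(case (case b of (J, j) \<Rightarrow> (J - {j}, j)) of (J, j) \<Rightarrow> (insert j J, j)) = b"
      by auto
  qed
  also have "\<dots> = (\<Sum>J | J \<subseteq> A \<and> card J = Suc m. \<Sum>j\<in>J. \<Prod>i\<in>J. x i)"
    using assms fin by (subst sum.Sigma) (auto intro: finite_subset)
  also have "\<dots> = of_nat (Suc m) * (\<Sum>J | J \<subseteq> A \<and> card J = Suc m. \<Prod>j\<in>J. x j)"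
    by (simp add: sum_distrib_left del: of_nat_Suc)
  finally show ?thesis by simp
qed

lemma fact_sum_prod_subsets_le:
  fixes x :: "'a \<Rightarrow> real"
  assumes "finite A" and "\<And>j. j \<in> A \<Longrightarrow> 0 \<le> x j"
  shows "fact m * (\<Sum>J | J \<subseteq> A \<and> card J = m. \<Prod>j\<in>J. x j) \<le> (\<Sum>j\<in>A. x j) ^ m"
proof (induction m)
  case 0
  have "{J. J \<subseteq> A \<and> card J = 0} = {{}}"
    using assms(1) by (auto dest: finite_subset)
  then show ?case by simp
next
  case (Suc m)
  have "(\<Sum>J | J \<subseteq> A \<and> card J = m. (\<Prod>j\<in>J. x j) * (\<Sum>j\<in>A - J. x j)) \<le>
        (\<Sum>J | J \<subseteq> A \<and> card J = m. (\<Prod>j\<in>J. x j) * (\<Sum>j\<in>A. x j))"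
    using assms by (intro sum_mono mult_left_mono sum_mono2 prod_nonneg) auto
  then have "fact m * (real (Suc m) * (\<Sum>J | J \<subseteq> A \<and> card J = Suc m. \<Prod>j\<in>J. x j)) \<le>
      fact m * (\<Sum>J | J \<subseteq> A \<and> card J = m. \<Prod>j\<in>J. x j) * (\<Sum>j\<in>A. x j)"
    unfolding sum_prod_subsets_step[OF assms(1)] by (simp add: sum_distrib_right)
  also have "\<dots> \<le> (\<Sum>j\<in>A. x j) ^ m * (\<Sum>j\<in>A. x j)"
    using assms by (intro mult_right_mono Suc sum_nonneg) auto
  finally show ?case by (simp add: mult_ac)
qed

text \<open>Omitting the m entries of J from the full sum costs at most \<open>m * R\<close>, so
  each induction step gains at least the factor sum minus \<open>m * R\<close>. The last hypothesis
  keeps these factors nonnegative.\<close>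

lemma fact_sum_prod_subsets_ge:
  fixes x :: "'a \<Rightarrow> real"
  assumes "finite A" and "\<And>j. j \<in> A \<Longrightarrow> 0 \<le> x j \<and> x j \<le> R" and "0 \<le> R"
    and "real m * R \<le> (\<Sum>j\<in>A. x j)"
  shows "(\<Prod>i<m. (\<Sum>j\<in>A. x j) - real i * R) \<le> fact m * (\<Sum>J | J \<subseteq> A \<and> card J = m. \<Prod>j\<in>J. x j)"
  using assms(4)
proof (induction m)
  case 0
  have "{J. J \<subseteq> A \<and> card J = 0} = {{}}"
    using assms(1) by (auto dest: finite_subset)
  then show ?case by simp
next
  case (Suc m)
  let ?p = "\<Sum>j\<in>A. x j"
  have m: "real m * R \<le> ?p" using Suc.prems assms(3) by (simp add: algebra_simps)
  have "(\<Sum>J | J \<subseteq> A \<and> card J = m. (\<Prod>j\<in>J. x j) * (?p - real m * R)) \<le>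
        (\<Sum>J | J \<subseteq> A \<and> card J = m. (\<Prod>j\<in>J. x j) * (\<Sum>j\<in>A - J. x j))"
  proof (intro sum_mono mult_left_mono)
    fix J assume J: "J \<in> {J. J \<subseteq> A \<and> card J = m}"
    have "(\<Sum>j\<in>J. x j) \<le> real (card J) * R"
      using J assms by (intro sum_bounded_above) auto
    moreover have "(\<Sum>j\<in>A - J. x j) = ?p - (\<Sum>j\<in>J. x j)"
      using J assms by (intro sum_diff) auto
    ultimately show "?p - real m * R \<le> (\<Sum>j\<in>A - J. x j)" using J by simp
    show "0 \<le> (\<Prod>j\<in>J. x j)" using J assms by (intro prod_nonneg) auto
  qed
  then have le: "fact m * (\<Sum>J | J \<subseteq> A \<and> card J = m. \<Prod>j\<in>J. x j) * (?p - real m * R) \<le>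
      fact m * (real (Suc m) * (\<Sum>J | J \<subseteq> A \<and> card J = Suc m. \<Prod>j\<in>J. x j))"
    unfolding sum_prod_subsets_step[OF assms(1)] by (simp add: sum_distrib_right)
  have "(\<Prod>i<Suc m. ?p - real i * R) \<le> fact m * (\<Sum>J | J \<subseteq> A \<and> card J = m. \<Prod>j\<in>J. x j) * (?p - real m * R)"
    using Suc.IH[OF m] m by (simp add: mult_right_mono)
  also note le
  finally show ?case by (simp add: mult_ac)
qed

lemma fact_mult_binomial_eq_prod:
  "fact m * real (n choose m) = (\<Prod>i<m. real n - real i)"
  by (simp add: binomial_gbinomial gbinomial_prod_rev atLeast0LessThan)

lemma symmetric_mean_mono:
  assumes "\<And>j. j \<in> {1..n} \<Longrightarrow> 0 \<le> x j \<and> x j \<le> y j"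
  shows "symmetric_mean m n x \<le> symmetric_mean m n y"
  unfolding symmetric_mean_def using assms
  by (intro divide_right_mono sum_mono prod_mono) auto

text \<open>The corrections \<open>i * R / n\<close> vanish as n grows, so the bound tends to
  \<open>c ^ m\<close>: for bounded entries repeated and distinct indices differ only in lower
  order.\<close>

lemma symmetric_mean_ge:
  assumes "m \<le> n" "0 < n" and "\<And>j. j \<in> {1..n} \<Longrightarrow> 0 \<le> x j \<and> x j \<le> R" and "0 \<le> R" "0 \<le> c"
    and "c \<le> (\<Sum>j=1..n. x j) / real n" and "real m * R \<le> c * real n"
  shows "(\<Prod>i<m. c - real i * R / real n) \<le> symmetric_mean m n x"
proof -
  let ?p = "\<Sum>j=1..n. x j"
  let ?e = "\<Sum>J | J \<subseteq> {1..n} \<and> card J = m. \<Prod>j\<in>J. x j"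
  have p: "c * real n \<le> ?p" using assms(2,6) by (simp add: field_simps)
  have pos: "0 < fact m * real (n choose m)" using assms(1) by simp
  have nn: "real i * R \<le> c * real n" if "i < m" for i
  proof -
    have "real i * R \<le> real m * R" using that assms(4) by (intro mult_right_mono) auto
    then show ?thesis using assms(7) by linarith
  qed
  have e: "(\<Prod>i<m. ?p - real i * R) \<le> fact m * ?e"
    using assms p by (intro fact_sum_prod_subsets_ge) auto
  have "(\<Prod>i<m. c * real n - real i * R) \<le> (\<Prod>i<m. ?p - real i * R)"
    using p nn by (intro prod_mono) auto
  moreover have "(\<Prod>i<m. c * real n - real i * R) = (\<Prod>i<m. c - real i * R / real n) * real n ^ m"
  proof -
    have "c * real n - real i * R = (c - real i * R / real n) * real n" for i
      using assms(2) by (simp add: field_simps)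
    then show ?thesis by (simp add: prod.distrib)
  qed
  ultimately have "(\<Prod>i<m. c - real i * R / real n) * real n ^ m \<le> fact m * ?e"
    using e by linarith
  moreover have "fact m * real (n choose m) \<le> real n ^ m"
    using binomial_fact_pow[of n m] by (metis mult.commute of_nat_fact of_nat_le_iff of_nat_mult of_nat_power)
  moreover have "0 \<le> (\<Prod>i<m. c - real i * R / real n)"
    using nn assms(2) by (intro prod_nonneg) (auto simp: field_simps)
  ultimately have "(\<Prod>i<m. c - real i * R / real n) * (fact m * real (n choose m)) \<le> fact m * ?e"
    by (meson mult_left_mono order_trans)
  then have "fact m * ((\<Prod>i<m. c - real i * R / real n) * real (n choose m)) \<le> fact m * ?e"
    by (simp add: mult_ac)
  then have "(\<Prod>i<m. c - real i * R / real n) * real (n choose m) \<le> ?e"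
    by simp
  then show ?thesis
    unfolding symmetric_mean_def using assms(1) by (simp add: pos_le_divide_eq)
qed

lemma symmetric_mean_le:
  assumes "m < n" and "\<And>j. j \<in> {1..n} \<Longrightarrow> 0 \<le> x j"
  shows "symmetric_mean m n x \<le> (\<Prod>i<m. (\<Sum>j=1..n. x j) / (real n - real i))"
proof -
  let ?p = "\<Sum>j=1..n. x j"
  let ?e = "\<Sum>J | J \<subseteq> {1..n} \<and> card J = m. \<Prod>j\<in>J. x j"
  have pos: "0 < (\<Prod>i<m. real n - real i)" using assms(1) by (intro prod_pos) auto
  have "symmetric_mean m n x = fact m * ?e / (fact m * real (n choose m))"
    unfolding symmetric_mean_def by simp
  also have "\<dots> \<le> ?p ^ m / (\<Prod>i<m. real n - real i)"
    unfolding fact_mult_binomial_eq_prod using assms pos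
    by (intro divide_right_mono fact_sum_prod_subsets_le) auto
  also have "\<dots> = (\<Prod>i<m. ?p / (real n - real i))"
    by (simp add: prod_dividef)
  finally show ?thesis .
qed

lemma Liminf_symmetric_mean_ge:
  fixes \<alpha> :: "nat \<Rightarrow> nat \<Rightarrow> real"
  assumes F: "F \<le> sequentially" and "0 \<le> R" "0 < b"
    and nonneg: "\<forall>\<^sub>F n in F. \<forall>k\<in>{1..n}. 0 \<le> \<alpha> k n"
    and mean: "\<And>c. c < b \<Longrightarrow> \<forall>\<^sub>F n in F. c \<le> (\<Sum>k=1..n. min (\<alpha> k n) R) / real n"
  shows "ereal (b ^ m) \<le> Liminf F (\<lambda>n. ereal (symmetric_mean m n (\<lambda>k. \<alpha> k n)))"
  unfolding le_Liminf_iff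
proof (intro allI impI)
  fix y :: ereal assume y: "y < ereal (b ^ m)"
  \<comment> \<open>A strict bound below \<open>b ^ m\<close> leaves room to lower b to some c,
    which is all that \<open>mean\<close> offers.\<close>
  have "((\<lambda>c. ereal (c ^ m)) \<longlongrightarrow> ereal (b ^ m)) (at_left b)"
    by (intro tendsto_intros)
  then have "\<forall>\<^sub>F c in at_left b. y < ereal (c ^ m)"
    using y by (rule order_tendstoD)
  moreover have "\<forall>\<^sub>F c in at_left b. 0 < c \<and> c < b"
    using eventually_at_left_real[OF \<open>0 < b\<close>] by (auto elim: eventually_mono)
  ultimately have "\<exists>c. y < ereal (c ^ m) \<and> 0 < c \<and> c < b"
    using eventually_happens[of _ "at_left b"] by (auto dest: eventually_conj)
  then obtain c where c: "y < ereal (c ^ m)" "0 < c" "c < b" by blast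
  have "(\<lambda>n. ereal (\<Prod>i<m. c - real i * R / real n)) \<longlonglongrightarrow> ereal (\<Prod>i<m. c - 0)"
    by (intro tendsto_intros real_tendsto_divide_at_top[OF tendsto_const] filterlim_real_sequentially)
  then have "\<forall>\<^sub>F n in sequentially. y < ereal (\<Prod>i<m. c - real i * R / real n)"
    using c(1) by (intro order_tendstoD(1)) auto
  moreover have "\<forall>\<^sub>F n in sequentially. real m * R / c \<le> real n"
    by (rule eventually_nat_real) (rule eventually_ge_at_top)
  moreover have "\<forall>\<^sub>F n in sequentially. m < n" by (rule eventually_gt_at_top)
  ultimately have "\<forall>\<^sub>F n in F. y < ereal (\<Prod>i<m. c - real i * R / real n) \<and> real m * R / c \<le> real n \<and> m < n"
    using F unfolding le_filter_def by (intro eventually_conj) auto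
  with nonneg mean[OF c(3)] show "\<forall>\<^sub>F n in F. y < ereal (symmetric_mean m n (\<lambda>k. \<alpha> k n))"
  proof eventually_elim
    case (elim n)
    have "(\<Prod>i<m. c - real i * R / real n) \<le> symmetric_mean m n (\<lambda>k. min (\<alpha> k n) R)"
      using elim c assms(2) by (intro symmetric_mean_ge) (auto simp: field_simps)
    also have "\<dots> \<le> symmetric_mean m n (\<lambda>k. \<alpha> k n)"
      using elim assms(2) by (intro symmetric_mean_mono) auto
    finally show ?case using elim by (metis ereal_less_eq(3) less_le_trans)
  qed
qed

lemma Limsup_symmetric_mean_le:
  fixes \<alpha> :: "nat \<Rightarrow> nat \<Rightarrow> real"
  assumes F: "F \<le> sequentially"
    and nonneg: "\<forall>\<^sub>F n in F. \<forall>k\<in>{1..n}. 0 \<le> \<alpha> k n"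
    and mean: "\<forall>\<^sub>F n in F. (\<Sum>k=1..n. \<alpha> k n) = b * real n"
  shows "Limsup F (\<lambda>n. ereal (symmetric_mean m n (\<lambda>k. \<alpha> k n))) \<le> ereal (b ^ m)"
proof -
  have "((\<lambda>n. \<Prod>i<m. b * real n / (real n - real i)) \<longlongrightarrow> (\<Prod>i<m. b)) sequentially"
    by (intro tendsto_prod) real_asymp
  then have lim: "((\<lambda>n. ereal (\<Prod>i<m. b * real n / (real n - real i))) \<longlongrightarrow> ereal (b ^ m)) F"
    using F by (auto intro: tendsto_mono)
  show ?thesis
  proof (cases "F = bot")
    case True
    then show ?thesis by (simp add: Limsup_bot)
  next
    case False
    have "\<forall>\<^sub>F n in F. m < n" using F eventually_gt_at_top[of m] by (auto intro: filter_leD)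
    with nonneg mean have "\<forall>\<^sub>F n in F. ereal (symmetric_mean m n (\<lambda>k. \<alpha> k n)) \<le>
      ereal (\<Prod>i<m. b * real n / (real n - real i))"
    proof eventually_elim
      case (elim n)
      then show ?case using symmetric_mean_le[of m n "\<lambda>k. \<alpha> k n"] by simp
    qed
    then have "Limsup F (\<lambda>n. ereal (symmetric_mean m n (\<lambda>k. \<alpha> k n))) \<le>
      Limsup F (\<lambda>n. ereal (\<Prod>i<m. b * real n / (real n - real i)))"
      by (rule Limsup_mono)
    also have "\<dots> = ereal (b ^ m)" using lim_imp_Limsup[OF _ lim] False by simp
    finally show ?thesis .
  qed
qed

lemma Liminf_symmetric_mean_cheb04:
  assumes F: "F \<le> sequentially" "F \<noteq> bot" and "\<forall>\<^sub>F n in F. 1 \<le> n"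
    and roots: "\<forall>\<^sub>F n in F. proots (cheb04 n) = image_mset (\<lambda>k. \<alpha> k n) (mset_set {1..n})"
  shows "Liminf F (\<lambda>n. ereal (symmetric_mean m n (\<lambda>k. \<alpha> k n))) = ereal (2 ^ m)"
proof -
  let ?\<theta> = "\<lambda>n k. (2 * real k - 1) * pi / (2 * real n)"
  \<comment> \<open>The reflection of k to n + 1 - k sends each angle to its supplement, so the
    cosines cancel and the roots have mean exactly 2.\<close>
  have sum_cos: "(\<Sum>k=1..n. cos (?\<theta> n k)) = 0" if "1 \<le> n" for n :: nat
  proof -
    have "(\<Sum>k=1..n. cos (?\<theta> n k)) = (\<Sum>k=1..n. cos (?\<theta> n (n + 1 - k)))"
      by (rule sum.reindex_bij_witness[where i = "\<lambda>k. n + 1 - k" and j = "\<lambda>k. n + 1 - k"]) auto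
    also have "\<dots> = (\<Sum>k=1..n. - cos (?\<theta> n k))"
    proof (intro sum.cong refl)
      fix k assume k: "k \<in> {1..n}"
      have "?\<theta> n (n + 1 - k) = pi - ?\<theta> n k"
        using k that by (simp add: of_nat_diff field_simps)
      then show "cos (?\<theta> n (n + 1 - k)) = - cos (?\<theta> n k)" by simp
    qed
    finally show ?thesis by (simp add: sum_negf)
  qed
  have ev: "\<forall>\<^sub>F n in F. (\<forall>k\<in>{1..n}. 0 \<le> \<alpha> k n \<and> \<alpha> k n \<le> 4) \<and> (\<Sum>k=1..n. \<alpha> k n) = 2 * real n \<and> 1 \<le> n"
    using roots assms(3)
  proof eventually_elim
    case (elim n)
    then have eq: "image_mset (\<lambda>k. \<alpha> k n) (mset_set {1..n}) =
        image_mset (\<lambda>k. 2 + 2 * cos (?\<theta> n k)) (mset_set {1..n})"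
      by (simp add: proots_cheb04)
    have "sum_mset (image_mset (\<lambda>k. \<alpha> k n) (mset_set {1..n})) =
        sum_mset (image_mset (\<lambda>k. 2 + 2 * cos (?\<theta> n k)) (mset_set {1..n}))"
      unfolding eq ..
    then have "(\<Sum>k=1..n. \<alpha> k n) = (\<Sum>k=1..n. 2 + 2 * cos (?\<theta> n k))"
      by (simp add: sum_unfold_sum_mset)
    also have "\<dots> = 2 * real n"
      using sum_cos elim by (simp add: sum.distrib sum_distrib_left[symmetric])
    finally have "(\<Sum>k=1..n. \<alpha> k n) = 2 * real n" .
    moreover have "0 \<le> \<alpha> k n \<and> \<alpha> k n \<le> 4" if "k \<in> {1..n}" for k
    proof -
      have "\<alpha> k n \<in> set_mset (image_mset (\<lambda>k. \<alpha> k n) (mset_set {1..n}))" using that by auto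
      then obtain j where "\<alpha> k n = 2 + 2 * cos (?\<theta> n j)" unfolding eq by auto
      then show ?thesis using cos_ge_minus_one[of "?\<theta> n j"] cos_le_one[of "?\<theta> n j"] by linarith
    qed
    ultimately show ?case using elim by blast
  qed
  have "Limsup F (\<lambda>n. ereal (symmetric_mean m n (\<lambda>k. \<alpha> k n))) \<le> ereal (2 ^ m)"
    using ev by (intro Limsup_symmetric_mean_le F) (auto elim: eventually_mono)
  moreover have "ereal (2 ^ m) \<le> Liminf F (\<lambda>n. ereal (symmetric_mean m n (\<lambda>k. \<alpha> k n)))"
  \<comment> \<open>The roots lie in [0,4], so truncation at 4 changes nothing.\<close>
  proof (rule Liminf_symmetric_mean_ge[where R = 4])
    show "\<forall>\<^sub>F n in F. \<forall>k\<in>{1..n}. 0 \<le> \<alpha> k n" using ev by (auto elim: eventually_mono)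
    fix c :: real assume "c < 2"
    show "\<forall>\<^sub>F n in F. c \<le> (\<Sum>k=1..n. min (\<alpha> k n) 4) / real n"
      using ev
    proof eventually_elim
      case (elim n)
      then have "(\<Sum>k=1..n. min (\<alpha> k n) 4) = (\<Sum>k=1..n. \<alpha> k n)"
        by (intro sum.cong) auto
      then show ?case using elim \<open>c < 2\<close> by simp
    qed
  qed (use F in auto)
  moreover have "Liminf F (\<lambda>n. ereal (symmetric_mean m n (\<lambda>k. \<alpha> k n))) \<le>
     Limsup F (\<lambda>n. ereal (symmetric_mean m n (\<lambda>k. \<alpha> k n)))"
    by (rule Liminf_le_Limsup) (use F in auto)
  ultimately show ?thesis by (meson order_antisym order_trans)
qed

section \<open>The discriminant of an integer polynomial\<close>

text \<open>The monomial case of a Bezoutian. For i < j the quotient is minus (x y)^i times the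
  homogeneous geometric sum of degree j - i - 1; hence the witness is -1 on a stretch of the
  antidiagonal k + l = i + j - 1.\<close>

lemma antisymmetric_power_quotient:
  assumes "i \<le> n" "j \<le> n"
  shows "\<exists>c :: nat \<Rightarrow> nat \<Rightarrow> int. \<forall>x y :: 'a::comm_ring_1.
    (x - y) * (\<Sum>k<n. \<Sum>l<n. of_int (c k l) * x ^ k * y ^ l) = x ^ i * y ^ j - x ^ j * y ^ i"
  using assms
proof (induction i j rule: linorder_wlog)
  case (sym j i)
  then obtain c :: "nat \<Rightarrow> nat \<Rightarrow> int" where c: "\<And>x y :: 'a.
    (x - y) * (\<Sum>k<n. \<Sum>l<n. of_int (c k l) * x ^ k * y ^ l) = x ^ i * y ^ j - x ^ j * y ^ i" by blast
  show ?case
  proof (intro exI[of _ "\<lambda>k l. - c k l"] allI)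
    fix x y :: 'a
    show "(x - y) * (\<Sum>k<n. \<Sum>l<n. of_int (- c k l) * x ^ k * y ^ l) = x ^ j * y ^ i - x ^ i * y ^ j"
      using c[of x y] by (simp add: sum_negf)
  qed
next
  case (le i j)
  show ?case
  proof (cases "i = j")
    case True
    then show ?thesis by (intro exI[of _ "\<lambda>_ _. 0"]) simp
  next
    case False
    then obtain d where d: "j = Suc (i + d)" using le less_imp_Suc_add[of i j] by auto
    show ?thesis
    proof (intro exI[of _ "\<lambda>k l. if i \<le> k \<and> k < j \<and> l = i + j - 1 - k then -1 else 0"] allI)
      fix x y :: 'a
      have inner: "(\<Sum>l<n. of_int (if i \<le> k \<and> k < j \<and> l = i + j - 1 - k then -1 else 0) * x ^ k * y ^ l) =
          (if i \<le> k \<and> k < j then - (x ^ k * y ^ (i + j - 1 - k)) else 0)" if "k < n" for k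
      proof (cases "i \<le> k \<and> k < j")
        case True
        then have "i + j - 1 - k < n" using le by auto
        have "(\<Sum>l<n. of_int (if i \<le> k \<and> k < j \<and> l = i + j - 1 - k then -1 else 0) * x ^ k * y ^ l) =
          (\<Sum>l<n. if l = i + j - 1 - k then - (x ^ k * y ^ l) else 0)"
          using True by (intro sum.cong) auto
        then show ?thesis using \<open>i + j - 1 - k < n\<close> True by simp
      qed auto
      have "(\<Sum>k<n. \<Sum>l<n. of_int (if i \<le> k \<and> k < j \<and> l = i + j - 1 - k then -1 else 0) * x ^ k * y ^ l)
         = (\<Sum>k<n. if i \<le> k \<and> k < j then - (x ^ k * y ^ (i + j - 1 - k)) else 0)"
        using inner by (intro sum.cong) auto
      also have "\<dots> = (\<Sum>k\<in>{i..<j}. - (x ^ k * y ^ (i + j - 1 - k)))"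
        using le by (intro sum.mono_neutral_cong_right) auto
      also have "\<dots> = (\<Sum>s<Suc d. - (x ^ (s + i) * y ^ (i + j - 1 - (s + i))))"
        unfolding d by (rule sum.reindex_bij_witness[where i = "\<lambda>s. s + i" and j = "\<lambda>k. k - i"]) auto
      also have "\<dots> = - ((x * y) ^ i * (\<Sum>s<Suc d. x ^ s * y ^ (d - s)))"
      proof -
        have "i + j - 1 - (s + i) = (d - s) + i" if "s < Suc d" for s using that d by auto
        then have "x ^ (s + i) * y ^ (i + j - 1 - (s + i)) = (x * y) ^ i * (x ^ s * y ^ (d - s))" if "s < Suc d" for s
          using that by (simp only: power_add power_mult_distrib mult_ac)
        then show ?thesis
          unfolding sum_distrib_left sum_negf[symmetric] by (intro sum.cong) auto
      qed
      finally have "(x - y) * (\<Sum>k<n. \<Sum>l<n. of_int (if i \<le> k \<and> k < j \<and> l = i + j - 1 - k then -1 else 0) * x ^ k * y ^ l)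
         = - ((x * y) ^ i * ((x - y) * (\<Sum>s<Suc d. x ^ s * y ^ (d - s))))"
        by (simp add: mult_ac)
      also have "(x - y) * (\<Sum>s<Suc d. x ^ s * y ^ (d - s)) = x ^ Suc d - y ^ Suc d"
        by (simp only: power_diff_sumr2 diff_Suc_Suc mult.commute)
      also have "- ((x * y) ^ i * (x ^ Suc d - y ^ Suc d)) = x ^ i * y ^ j - x ^ j * y ^ i"
        unfolding d by (simp add: power_add power_mult_distrib algebra_simps)
      finally show "(x - y) * (\<Sum>k<n. \<Sum>l<n. of_int (if i \<le> k \<and> k < j \<and> l = i + j - 1 - k then -1 else 0) * x ^ k * y ^ l)
         = x ^ i * y ^ j - x ^ j * y ^ i" .
    qed
  qed
qed

lemma poly_eq_sum_atMost: "degree (p :: complex poly) \<le> n \<Longrightarrow> poly p x = (\<Sum>i\<le>n. coeff p i * x ^ i)"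
  unfolding poly_altdef by (rule sum.mono_neutral_left) (auto simp: coeff_eq_0)

lemma coeff_Ints_of_int:
  fixes p :: "complex poly"
  assumes "\<And>i. coeff p i \<in> \<int>"
  shows "\<exists>u. \<forall>i. coeff p i = of_int (u i)"
proof -
  have "\<exists>v. coeff p i = of_int v" for i
    using assms[of i] by (rule Ints_cases) blast
  then show ?thesis by (intro choice) blast
qed

text \<open>The Bezoutian is bilinear in p and q, so integrality is inherited from the monomial
  case.\<close>

lemma bezoutian_exists:
  fixes p q :: "complex poly"
  assumes "degree p \<le> n" "degree q \<le> n" "\<And>i. coeff p i \<in> \<int>" "\<And>i. coeff q i \<in> \<int>"
  shows "\<exists>c :: nat \<Rightarrow> nat \<Rightarrow> int. \<forall>x y.
    (x - y) * (\<Sum>k<n. \<Sum>l<n. of_int (c k l) * x ^ k * y ^ l) = poly p x * poly q y - poly p y * poly q x"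
proof -
  obtain u where u: "\<And>i. coeff p i = of_int (u i)" using coeff_Ints_of_int[OF assms(3)] by blast
  obtain v where v: "\<And>i. coeff q i = of_int (v i)" using coeff_Ints_of_int[OF assms(4)] by blast
  define c :: "nat \<Rightarrow> nat \<Rightarrow> nat \<Rightarrow> nat \<Rightarrow> int" where "c i j = (SOME c. \<forall>x y :: complex.
    (x - y) * (\<Sum>k<n. \<Sum>l<n. of_int (c k l) * x ^ k * y ^ l) = x ^ i * y ^ j - x ^ j * y ^ i)" for i j
  have c: "(x - y) * (\<Sum>k<n. \<Sum>l<n. of_int (c i j k l) * x ^ k * y ^ l) = x ^ i * y ^ j - x ^ j * y ^ i"
    if "i \<le> n" "j \<le> n" for i j and x y :: complex
    using someI_ex[OF antisymmetric_power_quotient[OF that, where 'a = complex]] unfolding c_def by blast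
  have pp: "poly p x = (\<Sum>i\<le>n. of_int (u i) * x ^ i)" and pq: "poly q x = (\<Sum>i\<le>n. of_int (v i) * x ^ i)" for x
    unfolding u[symmetric] v[symmetric] by (rule poly_eq_sum_atMost[OF assms(1)], rule poly_eq_sum_atMost[OF assms(2)])
  show ?thesis
  proof (intro exI[of _ "\<lambda>k l. \<Sum>i\<le>n. \<Sum>j\<le>n. u i * v j * c i j k l"] allI)
    fix x y :: complex
    have "(\<Sum>k<n. \<Sum>l<n. of_int (\<Sum>i\<le>n. \<Sum>j\<le>n. u i * v j * c i j k l) * x ^ k * y ^ l) =
      (\<Sum>k<n. \<Sum>l<n. \<Sum>i\<le>n. \<Sum>j\<le>n. of_int (u i * v j) * (of_int (c i j k l) * x ^ k * y ^ l))"
      by (simp add: sum_distrib_left sum_distrib_right mult_ac)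
    also have "\<dots> = (\<Sum>i\<le>n. \<Sum>j\<le>n. \<Sum>k<n. \<Sum>l<n. of_int (u i * v j) * (of_int (c i j k l) * x ^ k * y ^ l))"
    proof -
      have "(\<Sum>k<n. \<Sum>l<n. \<Sum>i\<le>n. \<Sum>j\<le>n. f i j k l) = (\<Sum>i\<le>n. \<Sum>j\<le>n. \<Sum>k<n. \<Sum>l<n. f i j k l)"
        for f :: "nat \<Rightarrow> nat \<Rightarrow> nat \<Rightarrow> nat \<Rightarrow> complex"
      proof -
        have "(\<Sum>k<n. \<Sum>l<n. \<Sum>i\<le>n. \<Sum>j\<le>n. f i j k l) = (\<Sum>k<n. \<Sum>i\<le>n. \<Sum>l<n. \<Sum>j\<le>n. f i j k l)"
          by (rule sum.cong[OF refl], rule sum.swap)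
        also have "\<dots> = (\<Sum>i\<le>n. \<Sum>k<n. \<Sum>l<n. \<Sum>j\<le>n. f i j k l)" by (rule sum.swap)
        also have "\<dots> = (\<Sum>i\<le>n. \<Sum>k<n. \<Sum>j\<le>n. \<Sum>l<n. f i j k l)"
          by (rule sum.cong[OF refl], rule sum.cong[OF refl], rule sum.swap)
        also have "\<dots> = (\<Sum>i\<le>n. \<Sum>j\<le>n. \<Sum>k<n. \<Sum>l<n. f i j k l)"
          by (rule sum.cong[OF refl], rule sum.swap)
        finally show ?thesis .
      qed
      then show ?thesis .
    qed
    also have "\<dots> = (\<Sum>i\<le>n. \<Sum>j\<le>n. of_int (u i * v j) * (\<Sum>k<n. \<Sum>l<n. of_int (c i j k l) * x ^ k * y ^ l))"
      by (simp only: sum_distrib_left)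
    finally have "(x - y) * (\<Sum>k<n. \<Sum>l<n. of_int (\<Sum>i\<le>n. \<Sum>j\<le>n. u i * v j * c i j k l) * x ^ k * y ^ l) =
      (\<Sum>i\<le>n. \<Sum>j\<le>n. of_int (u i * v j) * ((x - y) * (\<Sum>k<n. \<Sum>l<n. of_int (c i j k l) * x ^ k * y ^ l)))"
      by (simp only: sum_distrib_left mult_ac)
    also have "\<dots> = (\<Sum>i\<le>n. \<Sum>j\<le>n. of_int (u i * v j) * (x ^ i * y ^ j - x ^ j * y ^ i))"
      using c by (intro sum.cong refl) auto
    also have "\<dots> = (\<Sum>i\<le>n. \<Sum>j\<le>n. (of_int (u i) * x ^ i) * (of_int (v j) * y ^ j)) -
        (\<Sum>i\<le>n. \<Sum>j\<le>n. (of_int (u i) * y ^ i) * (of_int (v j) * x ^ j))"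
      by (simp add: sum_subtractf[symmetric] algebra_simps)
    also have "\<dots> = poly p x * poly q y - poly p y * poly q x"
      unfolding pp pq by (simp add: sum_product)
    finally show "(x - y) * (\<Sum>k<n. \<Sum>l<n. of_int (\<Sum>i\<le>n. \<Sum>j\<le>n. u i * v j * c i j k l) * x ^ k * y ^ l) =
       poly p x * poly q y - poly p y * poly q x" .
  qed
qed

text \<open>On the diagonal the defining identity of a Bezoutian reads 0 = 0 and says nothing. Its
  value there is recovered by cancelling the factor X - z as polynomials.\<close>

lemma poly_quotient_at_root:
  fixes p :: "complex poly" and b :: "nat \<Rightarrow> complex"
  assumes "\<And>x. (x - z) * (\<Sum>k<n. b k * x ^ k) = poly p x * w" "p = [:-z, 1:] * s"
  shows "(\<Sum>k<n. b k * z ^ k) = poly s z * w"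
proof -
  let ?b = "\<Sum>k<n. monom (b k) k"
  have b: "poly ?b x = (\<Sum>k<n. b k * x ^ k)" for x by (simp add: poly_sum poly_monom)
  have "[:-z, 1:] * ?b = [:-z, 1:] * smult w s"
  proof (rule poly_ext)
    fix x
    show "poly ([:-z, 1:] * ?b) x = poly ([:-z, 1:] * smult w s) x"
      using assms(1)[of x] by (simp add: b assms(2) algebra_simps)
  qed
  then have "?b = smult w s" by (metis mult_cancel_left one_neq_zero pCons_eq_0_iff)
  then show ?thesis using b[of z] by (simp add: mult.commute)
qed

text \<open>Two integer matrices, the Bezoutians of p with 1 and of p with p', are diagonalized by
  the same Vandermonde matrices, with diagonal entries p'(z_i) and p'(z_i)^2. The first has
  determinant \<open>a ^ n\<close>, so dividing shows that \<open>a ^ n\<close> times the product of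
  the p'(z_i) is a nonzero integer. The exponent \<open>2 * n\<close> exceeds that of the
  discriminant by 2, which is harmless because only the scale n^2 of the logarithm matters
  later.\<close>

lemma discriminant_bound:
  fixes a :: complex and z :: "nat \<Rightarrow> complex" and p :: "complex poly"
  assumes p: "p = smult a (\<Prod>i<n. [:- z i, 1:])" and "a \<noteq> 0"
    and int: "\<And>i. coeff p i \<in> \<int>" and inj: "inj_on z {..<n}"
  shows "1 \<le> norm a ^ (2 * n) * (\<Prod>i<n. \<Prod>j\<in>{..<n} - {i}. norm (z i - z j))"
proof -
  define s where "s i = smult a (\<Prod>j\<in>{..<n} - {i}. [:- z j, 1:])" for i
  define \<delta> where "\<delta> i = poly (s i) (z i)" for i
  have ps: "p = [:- z i, 1:] * s i" if "i < n" for i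
    unfolding p s_def using that by (subst prod.remove[of _ i]) auto
  have \<delta>: "\<delta> i = a * (\<Prod>j\<in>{..<n} - {i}. z i - z j)" for i
    by (simp add: \<delta>_def s_def poly_prod)
  have \<delta>0: "\<delta> i \<noteq> 0" if "i < n" for i
    unfolding \<delta> using \<open>a \<noteq> 0\<close> inj that by (auto simp: inj_on_def)
  have root: "poly p (z i) = 0" if "i < n" for i using ps[OF that] by simp
  have deg_prod: "degree (\<Prod>i<n. [:- z i, 1:]) = n"
    by (simp add: degree_prod_eq_sum_degree)
  have deg: "degree p = n" unfolding p using \<open>a \<noteq> 0\<close> deg_prod by simp
  have lead: "coeff p n = a"
  proof -
    have "lead_coeff p = a" unfolding p by (simp add: lead_coeff_prod)
    then show ?thesis using deg by simp
  qed
  have dp: "poly (pderiv p) (z i) = \<delta> i" if "i < n" for i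
  proof -
    have "poly (pderiv ([:- z i, 1:] * s i)) (z i) = \<delta> i"
      by (simp only: pderiv_mult) (simp add: pderiv_pCons \<delta>_def)
    then show ?thesis using ps[OF that] by metis
  qed
  define V where "V = Matrix.mat n n (\<lambda>(i, k). z i ^ k)"
  \<comment> \<open>The powers are listed in reverse order, and so are the columns of the
    coefficient matrices; this turns the Hankel matrix of \<open>h\<close> into an upper triangular
    one.\<close>
  define W where "W = Matrix.mat n n (\<lambda>(l, j). z j ^ (n - 1 - l))"
  have VMW: "V * Matrix.mat n n (\<lambda>(k, l). of_int (c k (n - 1 - l))) * W =
      Matrix.mat n n (\<lambda>(i, j). \<Sum>k<n. \<Sum>l<n. of_int (c k l) * z i ^ k * z j ^ l)" for c :: "nat \<Rightarrow> nat \<Rightarrow> int"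
  proof (rule eq_matI, goal_cases)
    case (1 i j)
    then have ij: "i < n" "j < n" by auto
    have "(V * Matrix.mat n n (\<lambda>(k, l). of_int (c k (n - 1 - l))) * W) $$ (i, j) =
       (\<Sum>l<n. (\<Sum>k<n. z i ^ k * of_int (c k (n - 1 - l))) * z j ^ (n - 1 - l))"
      using ij by (simp add: V_def W_def scalar_prod_def atLeast0LessThan)
    also have "\<dots> = (\<Sum>l<n. (\<Sum>k<n. z i ^ k * of_int (c k l)) * z j ^ l)"
      using sum.nat_diff_reindex[of "\<lambda>l. (\<Sum>k<n. z i ^ k * of_int (c k l)) * z j ^ l" n] by simp
    also have "\<dots> = (\<Sum>k<n. \<Sum>l<n. of_int (c k l) * z i ^ k * z j ^ l)"
      unfolding sum_distrib_right by (subst sum.swap) (simp add: mult_ac)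
    finally show ?case using ij by simp
  qed (auto simp: V_def W_def)
  have carr: "V \<in> carrier_mat n n" "W \<in> carrier_mat n n" by (auto simp: V_def W_def)
  have det_VMW: "Determinant.det V * Determinant.det (Matrix.mat n n (\<lambda>(k, l). of_int (c k (n - 1 - l)) :: complex))
       * Determinant.det W = (\<Prod>i<n. d i)"
    if "\<And>i j. i < n \<Longrightarrow> j < n \<Longrightarrow> (\<Sum>k<n. \<Sum>l<n. of_int (c k l) * z i ^ k * z j ^ l) = (if i = j then d i else 0)"
    for c :: "nat \<Rightarrow> nat \<Rightarrow> int" and d
  proof -
    let ?M = "Matrix.mat n n (\<lambda>(k, l). of_int (c k (n - 1 - l)) :: complex)"
    have M: "?M \<in> carrier_mat n n" by simp
    have "Determinant.det V * Determinant.det ?M * Determinant.det W = Determinant.det (V * ?M * W)"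
      using carr M by (simp add: det_mult[where n = n])
    also have "V * ?M * W = Matrix.mat n n (\<lambda>(i, j). if i = j then d i else 0)"
      unfolding VMW by (rule eq_matI) (auto simp: that)
    also have "Determinant.det \<dots> = (\<Prod>i<n. d i)"
      by (subst det_upper_triangular[where n = n]) (auto simp: prod_list_diag_prod atLeast0LessThan)
    finally show ?thesis .
  qed
  obtain u where u: "\<And>i. coeff p i = of_int (u i)" using coeff_Ints_of_int[OF int] by blast
  \<comment> \<open>The Bezoutian of p and 1, that is, the coefficients of (p(x) - p(y)) / (x - y).
    With reversed columns the diagonal entries are \<open>u n\<close>, the leading coefficient, and
    entries below it are coefficients beyond the degree.\<close>
  define h where "h k l = u (k + l + 1)" for k l
  have h: "(x - y) * (\<Sum>k<n. \<Sum>l<n. of_int (h k l) * x ^ k * y ^ l) = poly p x - poly p y" for x y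
  proof -
    have pp: "poly p x = (\<Sum>i\<le>n. of_int (u i) * x ^ i)" for x
      unfolding u[symmetric] by (rule poly_eq_sum_atMost) (simp add: deg)
    have u0: "u i = 0" if "n < i" for i using u[of i] that deg coeff_eq_0[of p i] by simp
    have h0: "h k l = 0" if "\<not> k + l < n" for k l
      unfolding h_def using that by (intro u0) simp
    have "poly p x - poly p y = (\<Sum>i\<le>n. of_int (u i) * (x ^ i - y ^ i))"
      unfolding pp by (simp only: sum_subtractf[symmetric] right_diff_distrib)
    also have "\<dots> = (\<Sum>i\<le>n. \<Sum>k<i. of_int (u i) * x ^ k * y ^ (i - Suc k)) * (x - y)"
    proof -
      have "of_int (u i) * (x ^ i - y ^ i) = (\<Sum>k<i. of_int (u i) * x ^ k * y ^ (i - Suc k)) * (x - y)" for i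
      proof -
        have "(\<Sum>k<i. of_int (u i) * x ^ k * y ^ (i - Suc k)) = of_int (u i) * (\<Sum>k<i. y ^ (i - Suc k) * x ^ k)"
          unfolding sum_distrib_left by (intro sum.cong refl) (simp only: mult_ac)
        then show ?thesis using power_diff_sumr2[of x i y] by (simp only: mult_ac)
      qed
      then show ?thesis by (simp only: sum_distrib_right)
    qed
    also have "(\<Sum>i\<le>n. \<Sum>k<i. of_int (u i) * x ^ k * y ^ (i - Suc k)) =
        (\<Sum>(i, k)\<in>(SIGMA i:{..n}. {..<i}). of_int (u i) * x ^ k * y ^ (i - Suc k))"
      by (subst sum.Sigma) auto
    also have "\<dots> = (\<Sum>(k, l)\<in>{(k, l). k + l < n}. of_int (h k l) * x ^ k * y ^ l)"
      by (rule sum.reindex_bij_witness[where i = "\<lambda>(k, l). (k + l + 1, k)" and j = "\<lambda>(i, k). (k, i - Suc k)"])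
        (auto simp: h_def)
    also have "\<dots> = (\<Sum>(k, l)\<in>{..<n} \<times> {..<n}. of_int (h k l) * x ^ k * y ^ l)"
      by (rule sum.mono_neutral_left; use h0 in force)
    also have "\<dots> = (\<Sum>k<n. \<Sum>l<n. of_int (h k l) * x ^ k * y ^ l)"
      by (rule sum.cartesian_product[symmetric])
    finally show ?thesis by (simp only: mult.commute)
  qed
  have diag: "(\<Sum>k<n. \<Sum>l<n. of_int (c k l) * z i ^ k * z j ^ l) = (if i = j then \<delta> i * w i else 0)"
    if c: "\<And>x y. (x - y) * (\<Sum>k<n. \<Sum>l<n. of_int (c k l) * x ^ k * y ^ l) = poly p x * poly q y - poly p y * poly q x"
      and q: "poly q (z j) = w j" and ij: "i < n" "j < n" for c :: "nat \<Rightarrow> nat \<Rightarrow> int" and q w i j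
  proof (cases "i = j")
    case False
    then have "z i \<noteq> z j" using inj ij by (auto simp: inj_on_def)
    then show ?thesis using c[of "z i" "z j"] root ij False by simp
  next
    case True
    have "(\<Sum>k<n. (\<Sum>l<n. of_int (c k l) * z j ^ l) * z j ^ k) = poly (s j) (z j) * w j"
    proof (rule poly_quotient_at_root)
      show "p = [:- z j, 1:] * s j" by (rule ps[OF ij(2)])
      fix x
      have "(\<Sum>k<n. (\<Sum>l<n. of_int (c k l) * z j ^ l) * x ^ k) = (\<Sum>k<n. \<Sum>l<n. of_int (c k l) * x ^ k * z j ^ l)"
        by (simp add: sum_distrib_left sum_distrib_right mult_ac)
      then show "(x - z j) * (\<Sum>k<n. (\<Sum>l<n. of_int (c k l) * z j ^ l) * x ^ k) = poly p x * w j"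
        using c[of x "z j"] root ij q by simp
    qed
    then show ?thesis using True by (simp add: sum_distrib_left sum_distrib_right mult_ac \<delta>_def)
  qed
  let ?T = "\<lambda>c :: nat \<Rightarrow> nat \<Rightarrow> int. Matrix.mat n n (\<lambda>(k, l). c k (n - 1 - l))"
  let ?C = "\<lambda>c :: nat \<Rightarrow> nat \<Rightarrow> int. Matrix.mat n n (\<lambda>(k, l). of_int (c k (n - 1 - l)) :: complex)"
  have "Determinant.det V * Determinant.det (?C h) * Determinant.det W = (\<Prod>i<n. \<delta> i * 1)"
    by (rule det_VMW, rule diag[where q = 1]) (auto simp: h)
  moreover have "Determinant.det (?C h) = a ^ n"
  proof -
    have u0: "u i = 0" if "n < i" for i using u[of i] that deg coeff_eq_0[of p i] by simp
    have "upper_triangular (?C h)" by (auto simp: h_def u0)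
    then have "Determinant.det (?C h) = (\<Prod>i<n. a)"
      by (subst det_upper_triangular[where n = n])
        (auto simp: prod_list_diag_prod atLeast0LessThan h_def u[symmetric] lead)
    then show ?thesis by simp
  qed
  ultimately have H: "Determinant.det V * Determinant.det W * a ^ n = (\<Prod>i<n. \<delta> i)"
    by (simp add: mult_ac)
  have "coeff (pderiv p) i \<in> \<int>" for i using int by (auto simp: coeff_pderiv)
  then obtain c :: "nat \<Rightarrow> nat \<Rightarrow> int" where c: "\<And>x y. (x - y) * (\<Sum>k<n. \<Sum>l<n. of_int (c k l) * x ^ k * y ^ l) =
     poly p x * poly (pderiv p) y - poly p y * poly (pderiv p) x"
    using bezoutian_exists[of p n "pderiv p"] deg int by (force simp: degree_pderiv)
  have "Determinant.det V * Determinant.det (?C c) * Determinant.det W = (\<Prod>i<n. \<delta> i * \<delta> i)"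
    by (rule det_VMW, rule diag[OF c]) (auto simp: dp)
  then have B: "Determinant.det V * Determinant.det W * Determinant.det (?C c) = (\<Prod>i<n. \<delta> i) * (\<Prod>i<n. \<delta> i)"
    by (simp add: prod.distrib mult_ac)
  have nz: "(\<Prod>i<n. \<delta> i) \<noteq> 0" using \<delta>0 by auto
  \<comment> \<open>Both identities contain \<open>det V * det W\<close>, which \<open>H\<close>
    shows to be nonzero; dividing one by the other isolates the integer determinant.\<close>
  have "Determinant.det (?C c) = a ^ n * (\<Prod>i<n. \<delta> i)"
  proof -
    have "(Determinant.det V * Determinant.det W) * Determinant.det (?C c) =
      (Determinant.det V * Determinant.det W) * (a ^ n * (\<Prod>i<n. \<delta> i))"
      using B H by (metis mult.assoc)
    moreover have "Determinant.det V * Determinant.det W \<noteq> 0" using H nz by auto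
    ultimately show ?thesis using mult_cancel_left by blast
  qed
  moreover have "Determinant.det (?C c) = of_int (Determinant.det (?T c))"
  proof -
    have "?C c = map_mat of_int (?T c)" by (rule eq_matI) auto
    then show ?thesis by (simp add: of_int_hom.hom_det)
  qed
  ultimately have eq: "of_int (Determinant.det (?T c)) = a ^ n * (\<Prod>i<n. \<delta> i)" by simp
  then have "Determinant.det (?T c) \<noteq> 0" using nz \<open>a \<noteq> 0\<close> by auto
  then have "1 \<le> norm (of_int (Determinant.det (?T c)) :: complex)" by simp
  also have "\<dots> = norm a ^ n * (\<Prod>i<n. norm a * (\<Prod>j\<in>{..<n} - {i}. norm (z i - z j)))"
    unfolding eq \<delta> by (simp add: norm_mult norm_power prod_norm[symmetric])
  also have "\<dots> = norm a ^ (2 * n) * (\<Prod>i<n. \<Prod>j\<in>{..<n} - {i}. norm (z i - z j))"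
    by (simp add: prod.distrib mult_2 power_add)
  finally show ?thesis .
qed

section \<open>Laguerre polynomials\<close>

text \<open>Since t/(1-t) has derivative 1/(1-t)^2, each differentiation either hits a coefficient
  or brings down -x/(1-t)^2, raising the degree in x by one. The top coefficient is tracked
  explicitly because it makes the Taylor coefficient at 0 monic up to sign.\<close>

lemma higher_deriv_exp_moebius:
  "\<exists>a :: nat \<Rightarrow> complex \<Rightarrow> complex. (\<forall>k. a k holomorphic_on ball 0 1) \<and>
     (\<forall>t\<in>ball 0 1. a n t = (- 1) ^ n * (1 / (1 - t)) ^ (2 * n)) \<and>
     (\<forall>x. \<forall>t\<in>ball 0 1. (deriv ^^ n) (\<lambda>t. exp (- x * (t / (1 - t)))) t =
        (\<Sum>k\<le>n. a k t * x ^ k) * exp (- x * (t / (1 - t))))"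
proof (induction n)
  case 0
  show ?case by (intro exI[of _ "\<lambda>_ _. 1"]) auto
next
  case (Suc n)
  then obtain a :: "nat \<Rightarrow> complex \<Rightarrow> complex" where hol: "\<And>k. a k holomorphic_on ball 0 1"
    and top: "\<And>t. t \<in> ball 0 1 \<Longrightarrow> a n t = (- 1) ^ n * (1 / (1 - t)) ^ (2 * n)"
    and der: "\<And>x t. t \<in> ball 0 1 \<Longrightarrow> (deriv ^^ n) (\<lambda>t. exp (- x * (t / (1 - t)))) t =
        (\<Sum>k\<le>n. a k t * x ^ k) * exp (- x * (t / (1 - t)))"
    by blast
  define b where "b k t = (if k \<le> n then deriv (a k) t else 0) -
     (if 0 < k then a (k - 1) t / (1 - t) ^ 2 else 0)" for k t
  have ne: "1 - t \<noteq> 0" if "t \<in> ball 0 1" for t :: complex using that by auto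
  show ?case
  proof (intro exI[of _ b] conjI allI ballI)
    show "b k holomorphic_on ball 0 1" for k
      unfolding b_def by (cases "k \<le> n"; cases "0 < k")
        (auto intro!: holomorphic_intros holomorphic_deriv hol dest: ne)
    show "b (Suc n) t = (- 1) ^ Suc n * (1 / (1 - t)) ^ (2 * Suc n)" if "t \<in> ball 0 1" for t
    proof -
      have "(1 / (1 - t)) ^ (2 * Suc n) = (1 / (1 - t)) ^ (2 * n + 2)" by simp
      also have "\<dots> = (1 / (1 - t)) ^ (2 * n) * (1 / (1 - t)) ^ 2" by (rule power_add)
      finally show ?thesis by (simp only: power_one_over) (simp add: b_def top[OF that] power_one_over)
    qed
    fix x t :: complex assume t: "t \<in> ball 0 1"
    let ?e = "\<lambda>t. exp (- x * (t / (1 - t)))"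
    have e: "(?e has_field_derivative (- x / (1 - t) ^ 2) * ?e t) (at t)"
    proof -
      have "((\<lambda>t. t / (1 - t)) has_field_derivative (1 * (1 - t) - t * (0 - 1)) / ((1 - t) * (1 - t))) (at t)"
        by (intro derivative_intros ne[OF t])
      then have "((\<lambda>t. t / (1 - t)) has_field_derivative 1 / (1 - t) ^ 2) (at t)"
        by (simp add: power2_eq_square)
      from DERIV_fun_exp[OF DERIV_cmult[OF this, of "- x"]] show ?thesis
        by (simp add: mult.commute)
    qed
    have "((\<lambda>t. \<Sum>k\<le>n. a k t * x ^ k) has_field_derivative (\<Sum>k\<le>n. deriv (a k) t * x ^ k)) (at t)"
    proof (rule DERIV_sum)
      fix k
      have "(a k has_field_derivative deriv (a k) t) (at t)"
        using hol[of k] t by (intro holomorphic_derivI) auto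
      then show "((\<lambda>t. a k t * x ^ k) has_field_derivative deriv (a k) t * x ^ k) (at t)"
        by (rule DERIV_cmult_right)
    qed
    from DERIV_mult[OF this e]
    have "((\<lambda>t. (\<Sum>k\<le>n. a k t * x ^ k) * ?e t) has_field_derivative
       (\<Sum>k\<le>n. deriv (a k) t * x ^ k) * ?e t + (- x / (1 - t) ^ 2) * ?e t * (\<Sum>k\<le>n. a k t * x ^ k)) (at t)" .
    then have "((deriv ^^ n) ?e has_field_derivative
       (\<Sum>k\<le>n. deriv (a k) t * x ^ k) * ?e t + (- x / (1 - t) ^ 2) * ?e t * (\<Sum>k\<le>n. a k t * x ^ k)) (at t)"
      by (rule has_field_derivative_transform_within_open[OF _ open_ball t der[symmetric]])
    then have "(deriv ^^ Suc n) ?e t =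
       (\<Sum>k\<le>n. deriv (a k) t * x ^ k) * ?e t + (- x / (1 - t) ^ 2) * ?e t * (\<Sum>k\<le>n. a k t * x ^ k)"
      by (simp add: DERIV_imp_deriv)
    also have "\<dots> = ((\<Sum>k\<le>n. deriv (a k) t * x ^ k) - (\<Sum>k\<le>n. a k t / (1 - t) ^ 2 * x ^ Suc k)) * ?e t"
    proof -
      have "(\<Sum>k\<le>n. a k t / (1 - t) ^ 2 * x ^ Suc k) = x / (1 - t) ^ 2 * (\<Sum>k\<le>n. a k t * x ^ k)"
        unfolding sum_distrib_left by (intro sum.cong) auto
      then show ?thesis by (simp add: left_diff_distrib)
    qed
    also have "(\<Sum>k\<le>n. deriv (a k) t * x ^ k) = (\<Sum>k\<le>Suc n. (if k \<le> n then deriv (a k) t else 0) * x ^ k)"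
      by simp
    also have "(\<Sum>k\<le>n. a k t / (1 - t) ^ 2 * x ^ Suc k) =
        (\<Sum>k\<le>Suc n. (if 0 < k then a (k - 1) t / (1 - t) ^ 2 else 0) * x ^ k)"
      by (subst sum.atMost_Suc_shift) simp
    also have "(\<Sum>k\<le>Suc n. (if k \<le> n then deriv (a k) t else 0) * x ^ k) -
        (\<Sum>k\<le>Suc n. (if 0 < k then a (k - 1) t / (1 - t) ^ 2 else 0) * x ^ k) = (\<Sum>k\<le>Suc n. b k t * x ^ k)"
      unfolding sum_subtractf[symmetric] b_def by (simp only: left_diff_distrib)
    finally show "(deriv ^^ Suc n) ?e t = (\<Sum>k\<le>Suc n. b k t * x ^ k) * ?e t" .
  qed
qed

text \<open>The map t/(1-t) takes the unit disc onto the half-plane of real parts above -1/2. For x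
  \<ge> 0 this bounds the generating function by \<open>exp (x / 2)\<close> on the whole
  disc.\<close>

lemma Re_moebius_ge:
  fixes t :: complex
  assumes "norm t < 1"
  shows "- 1 / 2 \<le> Re (t / (1 - t))"
proof -
  have ne: "1 - t \<noteq> 0" using assms by auto
  have "(norm t)\<^sup>2 \<le> 1" using assms by (simp add: power_le_one)
  then have "0 \<le> 1 - (norm t)\<^sup>2" by simp
  then have "0 \<le> (1 - (norm t)\<^sup>2) / (norm (1 - t))\<^sup>2" by simp
  also have "\<dots> = 1 + 2 * Re (t / (1 - t))"
  proof -
    have "(norm (1 - t))\<^sup>2 \<noteq> 0" using ne by simp
    moreover have "Re (t / (1 - t)) = (Re t * (1 - Re t) - (Im t)\<^sup>2) / (norm (1 - t))\<^sup>2"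
      by (simp add: Re_divide cmod_power2) (simp add: power2_eq_square)
    moreover have "1 - (norm t)\<^sup>2 = (norm (1 - t))\<^sup>2 + 2 * (Re t * (1 - Re t) - (Im t)\<^sup>2)"
      unfolding cmod_power2 by (simp add: power2_eq_square algebra_simps)
    ultimately show ?thesis by (simp add: field_simps)
  qed
  finally show ?thesis by simp
qed

text \<open>Up to sign and a factor \<open>n!\<close>, the polynomial is the \<open>n\<close>-th Taylor coefficient at \<open>t = 0\<close> of
  the generating function \<open>exp (- x t / (1 - t))\<close> of the Laguerre polynomials with parameter \<open>-1\<close>.\<close>

lemma laguerre_exists:
  "\<exists>q :: complex poly. degree q = n \<and> lead_coeff q = 1 \<and>
     (\<forall>x\<ge>0. norm (poly q (of_real x)) \<le> fact n * exp (x / 2))"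
proof -
  obtain a :: "nat \<Rightarrow> complex \<Rightarrow> complex" where
    top: "a n 0 = (- 1) ^ n"
    and der: "\<And>x. (deriv ^^ n) (\<lambda>t. exp (- x * (t / (1 - t)))) 0 = (\<Sum>k\<le>n. a k 0 * x ^ k)"
  proof -
    obtain a :: "nat \<Rightarrow> complex \<Rightarrow> complex" where a:
      "\<forall>t\<in>ball 0 1. a n t = (- 1) ^ n * (1 / (1 - t)) ^ (2 * n)"
      "\<forall>x. \<forall>t\<in>ball 0 1. (deriv ^^ n) (\<lambda>t. exp (- x * (t / (1 - t)))) t =
        (\<Sum>k\<le>n. a k t * x ^ k) * exp (- x * (t / (1 - t)))"
      using higher_deriv_exp_moebius[of n] by blast
    show ?thesis
    proof (rule that)
      show "a n 0 = (- 1) ^ n" using bspec[OF a(1), of 0] by simp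
      show "(deriv ^^ n) (\<lambda>t. exp (- x * (t / (1 - t)))) 0 = (\<Sum>k\<le>n. a k 0 * x ^ k)" for x
        using bspec[OF spec[OF a(2), of x], of 0] by simp
    qed
  qed
  define q where "q = (\<Sum>k\<le>n. monom ((- 1) ^ n * a k 0) k)"
  have coeff_q: "coeff q k = (if k \<le> n then (- 1) ^ n * a k 0 else 0)" for k
    by (simp add: q_def coeff_sum if_distrib cong: if_cong)
  have lead: "coeff q n = 1" using coeff_q[of n] top by (simp add: power_mult_distrib[symmetric])
  have deg: "degree q = n"
    using lead by (intro antisym degree_le le_degree) (auto simp: coeff_q)
  have "norm (poly q (of_real x)) \<le> fact n * exp (x / 2)" if "0 \<le> x" for x :: real
  proof -
    let ?f = "\<lambda>t. exp (- of_real x * (t / (1 - t))) :: complex"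
    have "poly q (of_real x) = (- 1) ^ n * (deriv ^^ n) ?f 0"
      unfolding der by (simp add: q_def poly_sum poly_monom sum_distrib_left mult.assoc)
    then have norm: "norm (poly q (of_real x)) = norm ((deriv ^^ n) ?f 0)"
      by (simp add: norm_mult norm_power)
    have le: "norm ((deriv ^^ n) ?f 0) * r ^ n \<le> fact n * exp (x / 2)" if r: "0 < r" "r < 1" for r :: real
    proof -
      have ne: "t \<noteq> 1" if "norm t \<le> r" for t :: complex using that r by auto
      have "norm ((deriv ^^ n) ?f 0) \<le> fact n * exp (x / 2) / r ^ n"
      proof (rule Cauchy_inequality)
        show "?f holomorphic_on ball 0 r"
          using ne by (auto intro!: holomorphic_intros)
        show "continuous_on (cball 0 r) ?f"
          using ne by (auto intro!: continuous_intros)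
        fix t :: complex assume "norm (0 - t) = r"
        then have "norm t < 1" using r by simp
        from Re_moebius_ge[OF this] have "x * - (1 / 2) \<le> x * Re (t / (1 - t))"
          using \<open>0 \<le> x\<close> by (intro mult_left_mono) auto
        moreover have "Re (- of_real x * w) = - x * Re w" for w by simp
        ultimately show "norm (?f t) \<le> exp (x / 2)"
          by (simp only: norm_exp_eq_Re exp_le_cancel_iff)
      qed (use r in auto)
      then show ?thesis using r by (simp add: pos_le_divide_eq)
    qed
    \<comment> \<open>The unit circle contains the singularity t = 1, so Cauchy's inequality is used
      on smaller circles and the radius then tends to 1.\<close>
    have "((\<lambda>r. norm ((deriv ^^ n) ?f 0) * r ^ n) \<longlongrightarrow> norm ((deriv ^^ n) ?f 0) * 1 ^ n) (at_left 1)"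
      by (intro tendsto_intros)
    moreover have "\<forall>\<^sub>F r in at_left 1. norm ((deriv ^^ n) ?f 0) * r ^ n \<le> fact n * exp (x / 2)"
      using eventually_at_left_real[of 0 1] le by (auto elim: eventually_mono)
    ultimately have "norm ((deriv ^^ n) ?f 0) * 1 ^ n \<le> fact n * exp (x / 2)"
      by (rule tendsto_upperbound) simp
    then show ?thesis using norm by simp
  qed
  then show ?thesis using deg lead by blast
qed

text \<open>Stirling's upper bound up to a factor of order n. Its term -n is the source of the -1 in
  the majorant s/2 - 1.\<close>

lemma ln_fact_le:
  assumes "1 \<le> n"
  shows "ln (fact n) \<le> 1 + ln (real n) + real n * (ln (real n) - 1)"
  using assms
proof (induction n rule: dec_induct)
  case base
  then show ?case by simp
next
  case (step n)
  have "1 / (real n + 1) \<le> ln (1 + 1 / real n)"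
  proof -
    have "ln (real n / (real n + 1)) \<le> real n / (real n + 1) - 1"
      using step by (intro ln_le_minus_one) auto
    also have "\<dots> = - (1 / (real n + 1))" using step by (simp add: field_simps)
    finally show ?thesis using step by (simp add: ln_div field_simps)
  qed
  moreover define u v where "u = ln (real n + 1)" and "v = ln (real n)"
  moreover have "ln (1 + 1 / real n) = ln ((real n + 1) / real n)"
    using step by (simp add: field_simps)
  ultimately have "1 / (real n + 1) \<le> u - v"
    using step by (simp add: ln_div)
  then have "(real n + 1) * (1 / (real n + 1)) \<le> (real n + 1) * (u - v)"
    using step by (intro mult_left_mono) auto
  then have "1 \<le> (real n + 1) * (u - v)" using step by simp
  moreover have "ln (fact (Suc n)) = u + ln (fact n :: real)"
    by (simp add: ln_mult u_def add.commute)
  moreover have "ln (fact n) \<le> 1 + v + real n * (v - 1)" using step by (simp add: v_def)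
  ultimately have "ln (fact (Suc n)) \<le> 1 + u + (real n + 1) * (u - 1)"
    by (simp add: algebra_simps)
  then show ?case by (simp add: u_def add.commute)
qed

text \<open>The points are Laguerre zeros divided by n. Substituting x = n s subtracts
  \<open>n * ln n\<close>, which cancels the main term of \<open>ln (fact n)\<close>. Points s equal
  to some \<open>z j\<close> are excluded because \<open>ln 0 = 0\<close> would stand where the true
  value is minus infinity.\<close>

lemma exponential_majorant:
  assumes "1 \<le> n"
  shows "\<exists>z :: nat \<Rightarrow> complex. \<forall>s\<ge>0. (\<forall>j<n. of_real s \<noteq> z j) \<longrightarrow>
     (\<Sum>j<n. ln (dist (of_real s) (z j))) / real n \<le> s / 2 - 1 + (1 + ln (real n)) / real n"
proof -
  obtain q :: "complex poly" where q: "degree q = n" "lead_coeff q = 1"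
    "\<And>x. 0 \<le> x \<Longrightarrow> norm (poly q (of_real x)) \<le> fact n * exp (x / 2)"
    using laguerre_exists[of n] by blast
  then obtain A where A: "size A = n" "q = (\<Prod>x\<in>#A. [:- x, 1:])"
    using complex_poly_decompose_multiset[of q] size_proots_complex[of q] by (metis smult_1_left)
  obtain w where w: "mset w = A" using ex_mset by blast
  then have len: "length w = n" using A(1) by (metis size_mset)
  have "q = (\<Prod>x\<leftarrow>w. [:- x, 1:])"
    unfolding A(2) w[symmetric] by (simp flip: mset_map add: prod_mset_prod_list)
  then have fac: "q = (\<Prod>j<n. [:- (w ! j), 1:])"
    by (simp add: prod.list_conv_set_nth len atLeast0LessThan)
  show ?thesis
  proof (intro exI[of _ "\<lambda>j. w ! j / of_nat n"] allI impI)
    fix s :: real assume s: "0 \<le> s" "\<forall>j<n. of_real s \<noteq> w ! j / of_nat n"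
    have d: "dist (of_real s) (w ! j / of_nat n) = norm (of_real (real n * s) - w ! j) / real n" if "j < n" for j
    proof -
      have "of_real s - w ! j / of_nat n = (of_real (real n * s) - w ! j) / of_nat n"
        using assms by (simp add: field_simps)
      then show ?thesis by (simp add: dist_norm norm_divide)
    qed
    have ne: "norm (of_real (real n * s) - w ! j) > 0" if "j < n" for j
      using d[OF that] s(2) that assms by (metis dist_eq_0_iff div_0 zero_less_norm_iff norm_zero)
    have "(\<Sum>j<n. ln (dist (of_real s) (w ! j / of_nat n))) =
        (\<Sum>j<n. ln (norm (of_real (real n * s) - w ! j)) - ln (real n))"
      using ne assms by (intro sum.cong refl) (simp only: d lessThan_iff, subst ln_div, auto)
    also have "\<dots> = (\<Sum>j<n. ln (norm (of_real (real n * s) - w ! j))) - real n * ln (real n)"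
      by (simp add: sum_subtractf)
    also have "(\<Sum>j<n. ln (norm (of_real (real n * s) - w ! j))) = ln (\<Prod>j<n. norm (of_real (real n * s) - w ! j))"
      using ne by (intro ln_prod[symmetric]) auto
    also have "(\<Prod>j<n. norm (of_real (real n * s) - w ! j)) = norm (poly q (of_real (real n * s)))"
      by (subst fac) (simp add: poly_prod prod_norm[symmetric])
    also have "ln \<dots> \<le> ln (fact n * exp (real n * s / 2))"
    proof (rule ln_mono)
      have "0 < (\<Prod>j<n. norm (of_real (real n * s) - w ! j))" using ne by (intro prod_pos) auto
      also have "\<dots> = norm (poly q (of_real (real n * s)))"
        by (subst fac) (simp add: poly_prod prod_norm[symmetric])
      finally show "0 < norm (poly q (of_real (real n * s)))" .
    qed (use q(3)[of "real n * s"] s in auto)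
    also have "\<dots> = ln (fact n) + real n * s / 2" by (simp add: ln_mult)
    finally have "(\<Sum>j<n. ln (dist (of_real s) (w ! j / of_nat n))) \<le>
        1 + ln (real n) + real n * (s / 2 - 1)"
      using ln_fact_le[OF assms] by (simp add: algebra_simps)
    then show "(\<Sum>j<n. ln (dist (of_real s) (w ! j / of_nat n))) / real n \<le> s / 2 - 1 + (1 + ln (real n)) / real n"
      using assms by (simp add: field_simps)
  qed
qed

section \<open>Logarithmic kernel and energy\<close>

text \<open>
  Adding \<open>C\<close> makes the kernel nonnegative at distances up to \<open>exp C\<close>, so that Fatou's lemma and Tonelli's
  theorem apply; at larger distances \<^const>\<open>ennreal\<close> truncates it to \<open>0\<close>.
\<close>

definition logker :: "real \<Rightarrow> complex \<Rightarrow> complex \<Rightarrow> ennreal" where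
  "logker C z w = (if z = w then \<infinity> else ennreal (C - ln (dist z w)))"

definition logpot :: "real \<Rightarrow> complex measure \<Rightarrow> complex \<Rightarrow> ennreal" where
  "logpot C \<mu> z = (\<integral>\<^sup>+w. logker C z w \<partial>\<mu>)"

definition shifted_energy :: "real \<Rightarrow> complex measure \<Rightarrow> ennreal" where
  "shifted_energy C \<mu> = (\<integral>\<^sup>+z. logpot C \<mu> z \<partial>\<mu>)"

lemma measurable_logker [measurable]:
  assumes [measurable]: "f \<in> borel_measurable M" "g \<in> borel_measurable M"
  shows "(\<lambda>x. logker C (f x) (g x)) \<in> borel_measurable M"
  unfolding logker_def by measurable

lemma measurable_logpot [measurable]:
  assumes "prob_space \<mu>" and [measurable_cong]: "sets \<mu> = sets borel"
  shows "logpot C \<mu> \<in> borel_measurable borel"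
proof -
  interpret prob_space \<mu> by fact
  show ?thesis unfolding logpot_def[abs_def] by measurable
qed

lemma logker_commute: "logker C z w = logker C w z"
  by (simp add: logker_def dist_commute)

lemma logker_mono:
  assumes "dist x y \<le> dist z w"
  shows "logker C z w \<le> logker C x y"
proof (cases "x = y")
  case False
  then have "0 < dist x y" by simp
  with assms have "0 < dist z w" by linarith
  then have "ln (dist x y) \<le> ln (dist z w)"
    using assms \<open>0 < dist x y\<close> by (simp only: ln_le_cancel_iff)
  then show ?thesis using False \<open>0 < dist z w\<close> by (auto simp: logker_def intro!: ennreal_leI)
qed (simp add: logker_def)

text \<open>The value infinity on the diagonal makes the kernel jointly continuous into the extended
  nonnegative reals. Every use of Fatou's lemma for energies and potentials rests on this.\<close>

lemma tendsto_logker: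
  assumes u: "(u \<longlongrightarrow> z) F" and v: "(v \<longlongrightarrow> w) F"
  shows "((\<lambda>i. logker C (u i) (v i)) \<longlongrightarrow> logker C z w) F"
proof (cases "z = w")
  case False
  have d: "((\<lambda>i. dist (u i) (v i)) \<longlongrightarrow> dist z w) F" by (intro tendsto_intros u v)
  then have "\<forall>\<^sub>F i in F. 0 < dist (u i) (v i)"
    using False by (intro order_tendstoD(1)) auto
  then have "\<forall>\<^sub>F i in F. ennreal (C - ln (dist (u i) (v i))) = logker C (u i) (v i)"
    by eventually_elim (auto simp: logker_def)
  moreover have "((\<lambda>i. ennreal (C - ln (dist (u i) (v i)))) \<longlongrightarrow> ennreal (C - ln (dist z w))) F"
    using False by (intro tendsto_intros d) auto
  ultimately have "((\<lambda>i. logker C (u i) (v i)) \<longlongrightarrow> ennreal (C - ln (dist z w))) F"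
    by (rule Lim_transform_eventually[rotated])
  then show ?thesis using False by (simp add: logker_def)
next
  case True
  have d: "((\<lambda>i. dist (u i) (v i)) \<longlongrightarrow> 0) F"
    using tendsto_dist[OF u v] True by simp
  have "((\<lambda>i. logker C (u i) (v i)) \<longlongrightarrow> \<top>) F"
  proof (rule order_tendstoI)
    fix a :: ennreal assume "a < \<top>"
    then obtain r where r: "0 \<le> r" "a = ennreal r" by (cases a) auto
    have "\<forall>\<^sub>F i in F. dist (u i) (v i) < exp (C - r)"
      using d by (rule order_tendstoD) simp
    then show "\<forall>\<^sub>F i in F. a < logker C (u i) (v i)"
    proof eventually_elim
      case (elim i)
      show ?case
      proof (cases "u i = v i")
        case False
        then have "ln (dist (u i) (v i)) < C - r"
          using elim by (metis dist_pos_lt ln_less_cancel_iff exp_gt_zero ln_exp)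
        then show ?thesis using False r by (simp add: logker_def ennreal_less_iff)
      qed (simp add: logker_def r)
    qed
  qed auto
  then show ?thesis using True by (simp add: logker_def)
qed

section \<open>Energy and capacity through the shifted kernel\<close>

lemma prob_measures_on_compact_iff:
  assumes "compact S"
  shows "\<mu> \<in> prob_measures_on S \<longleftrightarrow> prob_space \<mu> \<and> sets \<mu> = sets borel \<and> (AE z in \<mu>. z \<in> S)"
proof -
  have "(\<exists>K. compact K \<and> K \<subseteq> S \<and> emeasure \<mu> (- K) = 0) \<longleftrightarrow> (AE z in \<mu>. z \<in> S)"
    if \<mu>: "prob_space \<mu>" and sets: "sets \<mu> = sets borel"
  proof
    assume "\<exists>K. compact K \<and> K \<subseteq> S \<and> emeasure \<mu> (- K) = 0"
    then obtain K where K: "compact K" "K \<subseteq> S" "emeasure \<mu> (- K) = 0" by blast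
    have "- K \<in> sets \<mu>" using K(1) sets by (simp add: borel_open open_Compl compact_imp_closed)
    then have "- K \<in> null_sets \<mu>" using K(3) by (auto intro: null_setsI)
    then have "AE z in \<mu>. z \<notin> - K" by (rule AE_not_in)
    then show "AE z in \<mu>. z \<in> S" using K(2) by (auto elim: eventually_mono)
  next
    assume AE: "AE z in \<mu>. z \<in> S"
    have "- S \<in> sets \<mu>" using assms sets by (simp add: borel_open open_Compl compact_imp_closed)
    moreover have "{z \<in> space \<mu>. z \<notin> S} = - S" using sets_eq_imp_space_eq[OF sets] by auto
    ultimately have "emeasure \<mu> (- S) = 0" using AE AE_iff_measurable[of "- S" \<mu> "\<lambda>z. z \<in> S"] by simp
    then show "\<exists>K. compact K \<and> K \<subseteq> S \<and> emeasure \<mu> (- K) = 0" using assms by blast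
  qed
  then show ?thesis unfolding prob_measures_on_def by blast
qed

lemma prob_measures_onD:
  assumes "\<mu> \<in> prob_measures_on S"
  shows "prob_space \<mu>" "sets \<mu> = sets borel" "AE z in \<mu>. z \<in> S"
proof -
  obtain K where K: "compact K" "K \<subseteq> S" "emeasure \<mu> (- K) = 0" and s: "prob_space \<mu>" "sets \<mu> = sets borel"
    using assms unfolding prob_measures_on_def by blast
  then show "prob_space \<mu>" "sets \<mu> = sets borel" by auto
  have "\<mu> \<in> prob_measures_on K" unfolding prob_measures_on_def using K s by blast
  then have "AE z in \<mu>. z \<in> K" using prob_measures_on_compact_iff[OF K(1)] by blast
  then show "AE z in \<mu>. z \<in> S" using K(2) by (auto elim: eventually_mono)
qed

text \<open>Pointwise, the shifted kernel plus the positive part of ln equals C plus the negative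
  part of ln. The bound on the distances makes this true without truncation.\<close>

lemma log_energy_plus:
  assumes \<mu>: "\<mu> \<in> prob_measures_on S" and diam: "\<And>z w. z \<in> S \<Longrightarrow> w \<in> S \<Longrightarrow> dist z w \<le> exp C" and "0 \<le> C"
  shows "log_energy \<mu> + ereal C = enn2ereal (shifted_energy C \<mu>)"
proof -
  note sets[measurable_cong] = prob_measures_onD(2)[OF \<mu>]
  interpret prob_space \<mu> using \<mu> by (rule prob_measures_onD)
  define Lm where "Lm = (\<integral>\<^sup>+z. \<integral>\<^sup>+w. (if z = w then \<infinity> else ennreal (- ln (dist z w))) \<partial>\<mu> \<partial>\<mu>)"
  define Lp where "Lp = (\<integral>\<^sup>+z. \<integral>\<^sup>+w. ennreal (ln (dist z w)) \<partial>\<mu> \<partial>\<mu>)"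
  have AE: "AE z in \<mu>. z \<in> S" using \<mu> by (rule prob_measures_onD)
  have ln_le: "ln (dist z w) \<le> C" if "z \<in> S" "w \<in> S" for z w
  proof (cases "z = w")
    case False
    then have "ln (dist z w) \<le> ln (exp C)" using diam[OF that] by (subst ln_le_cancel_iff) auto
    then show ?thesis by simp
  qed (use \<open>0 \<le> C\<close> in auto)
  have pointwise: "logker C z w + ennreal (ln (dist z w)) =
      ennreal C + (if z = w then \<infinity> else ennreal (- ln (dist z w)))" if "z \<in> S" "w \<in> S" for z w
  proof (cases "z = w")
    case False
    show ?thesis
    proof (cases "0 \<le> ln (dist z w)")
      case True
      then show ?thesis using False ln_le[OF that] \<open>0 \<le> C\<close>
        by (simp add: logker_def ennreal_neg flip: ennreal_plus)
    next
      case neg: False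
      then show ?thesis using False \<open>0 \<le> C\<close>
        by (simp add: logker_def ennreal_neg flip: ennreal_plus)
    qed
  qed (simp add: logker_def)
  have "shifted_energy C \<mu> + Lp = (\<integral>\<^sup>+z. \<integral>\<^sup>+w. logker C z w + ennreal (ln (dist z w)) \<partial>\<mu> \<partial>\<mu>)"
    unfolding shifted_energy_def logpot_def Lp_def
    by (simp add: nn_integral_add)
  also have "\<dots> = (\<integral>\<^sup>+z. \<integral>\<^sup>+w. ennreal C + (if z = w then \<infinity> else ennreal (- ln (dist z w))) \<partial>\<mu> \<partial>\<mu>)"
  proof (rule nn_integral_cong_AE)
    show "AE z in \<mu>. (\<integral>\<^sup>+w. logker C z w + ennreal (ln (dist z w)) \<partial>\<mu>) =
        (\<integral>\<^sup>+w. ennreal C + (if z = w then \<infinity> else ennreal (- ln (dist z w))) \<partial>\<mu>)"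
      using AE
    proof eventually_elim
      case (elim z)
      show ?case
        by (rule nn_integral_cong_AE) (use AE in eventually_elim, use pointwise elim in blast)
    qed
  qed
  also have "\<dots> = ennreal C + Lm"
    unfolding Lm_def by (simp add: nn_integral_add emeasure_space_1)
  finally have eq: "shifted_energy C \<mu> + Lp = ennreal C + Lm" .
  \<comment> \<open>Finiteness of this part allows it to be moved across the equation in the
    extended reals.\<close>
  have "Lp \<le> (\<integral>\<^sup>+z. \<integral>\<^sup>+w. ennreal C \<partial>\<mu> \<partial>\<mu>)"
    unfolding Lp_def
  proof (rule nn_integral_mono_AE)
    show "AE z in \<mu>. (\<integral>\<^sup>+w. ennreal (ln (dist z w)) \<partial>\<mu>) \<le> (\<integral>\<^sup>+w. ennreal C \<partial>\<mu>)"
      using AE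
    proof eventually_elim
      case (elim z)
      show ?case
        by (rule nn_integral_mono_AE) (use AE in eventually_elim, use ln_le elim in \<open>auto intro: ennreal_leI\<close>)
    qed
  qed
  then have "Lp \<le> ennreal C" by (simp add: emeasure_space_1)
  then obtain l where l: "0 \<le> l" "Lp = ennreal l"
    by (metis ennreal_cases ennreal_less_top leD top_greatest)
  have "enn2ereal (shifted_energy C \<mu>) + ereal l = ereal C + enn2ereal Lm"
    using arg_cong[OF eq, of enn2ereal] l \<open>0 \<le> C\<close> by (simp add: plus_ennreal.rep_eq)
  moreover have "log_energy \<mu> = enn2ereal Lm - ereal l"
    using l unfolding log_energy_def Lm_def[symmetric] Lp_def[symmetric] by simp
  ultimately show ?thesis
    by (cases "enn2ereal Lm"; cases "enn2ereal (shifted_energy C \<mu>)") auto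
qed

lemma log_capacity_eq_0_iff:
  assumes diam: "\<And>z w. z \<in> S \<Longrightarrow> w \<in> S \<Longrightarrow> dist z w \<le> exp C" and "0 \<le> C"
  shows "log_capacity S = 0 \<longleftrightarrow> (\<forall>\<mu>\<in>prob_measures_on S. shifted_energy C \<mu> = \<infinity>)"
proof -
  have "log_energy \<mu> = \<infinity> \<longleftrightarrow> shifted_energy C \<mu> = \<infinity>" if "\<mu> \<in> prob_measures_on S" for \<mu>
  proof -
    have "log_energy \<mu> + ereal C = enn2ereal (shifted_energy C \<mu>)"
      by (rule log_energy_plus[OF that]) (use assms in auto)
    then show ?thesis by (cases "log_energy \<mu>"; cases "shifted_energy C \<mu>") (auto simp: top_ereal_def)
  qed
  then show ?thesis
    unfolding log_capacity_def bot_ennreal[symmetric] SUP_bot_conv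
    by (auto simp: bot_ennreal split: if_splits)
qed

text \<open>Capacity 1 means that the infimum of the unshifted energy is 0, hence C after the shift.
  The second part only gives near-minimizers; that the infimum is attained is the content of
  \<open>equilibrium_exists\<close>.\<close>

lemma log_capacity_eq_1D:
  assumes cap: "log_capacity S = 1"
    and diam: "\<And>z w. z \<in> S \<Longrightarrow> w \<in> S \<Longrightarrow> dist z w \<le> exp C" and "0 \<le> C"
  shows "\<mu> \<in> prob_measures_on S \<Longrightarrow> ennreal C \<le> shifted_energy C \<mu>"
    and "0 < \<epsilon> \<Longrightarrow> \<exists>\<mu>\<in>prob_measures_on S. shifted_energy C \<mu> \<le> ennreal (C + \<epsilon>)"
proof -
  have plus: "log_energy \<mu> + ereal C = enn2ereal (shifted_energy C \<mu>)" if "\<mu> \<in> prob_measures_on S" for \<mu>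
    by (rule log_energy_plus[OF that]) (use assms in auto)
  {
    assume \<mu>: "\<mu> \<in> prob_measures_on S"
    have le: "(if log_energy \<mu> = \<infinity> then 0 else ennreal (exp (- real_of_ereal (log_energy \<mu>)))) \<le> 1"
      using SUP_upper[OF \<mu>, of "\<lambda>\<mu>. if log_energy \<mu> = \<infinity> then 0 else ennreal (exp (- real_of_ereal (log_energy \<mu>)))"] cap
      unfolding log_capacity_def by simp
    show "ennreal C \<le> shifted_energy C \<mu>"
    proof (cases "shifted_energy C \<mu>")
      case (real r)
      then have "log_energy \<mu> = ereal (r - C)"
        using plus[OF \<mu>] by (cases "log_energy \<mu>") auto
      then show ?thesis using le real by (simp add: ennreal_le_1 ennreal_leI)
    qed simp
  }
  {
    assume "0 < \<epsilon>"
    have "ennreal (exp (- \<epsilon>)) < log_capacity S" using cap \<open>0 < \<epsilon>\<close> by (simp add: ennreal_less_one_iff)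
    then obtain \<mu> where \<mu>: "\<mu> \<in> prob_measures_on S"
      "ennreal (exp (- \<epsilon>)) < (if log_energy \<mu> = \<infinity> then 0 else ennreal (exp (- real_of_ereal (log_energy \<mu>))))"
      unfolding log_capacity_def less_SUP_iff by blast
    then have fin: "log_energy \<mu> \<noteq> \<infinity>" by auto
    with \<mu> have less: "real_of_ereal (log_energy \<mu>) < \<epsilon>" by (simp add: ennreal_less_iff)
    show "\<exists>\<mu>\<in>prob_measures_on S. shifted_energy C \<mu> \<le> ennreal (C + \<epsilon>)"
    proof (rule bexI[OF _ \<mu>(1)])
      show "shifted_energy C \<mu> \<le> ennreal (C + \<epsilon>)"
      proof (cases "shifted_energy C \<mu>")
        case (real r)
        then have "log_energy \<mu> = ereal (r - C)"
          using plus[OF \<mu>(1)] by (cases "log_energy \<mu>") auto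
        then show ?thesis using less real by (simp add: ennreal_leI)
      next
        case top
        then show ?thesis using fin plus[OF \<mu>(1)] by (cases "log_energy \<mu>") auto
      qed
    qed
  }
qed

section \<open>Weak limits of measures and of their energies\<close>

text \<open>Pointwise convergence on one probability space replaces weak convergence, so that
  Fatou's lemma applies directly to the unbounded kernel.\<close>

lemma tight_subsequence_Skorohod:
  assumes "tight \<mu>"
  shows "\<exists>s (\<Omega> :: real measure) Y_seq Y. strict_mono s \<and> prob_space \<Omega> \<and>
    (\<forall>n. Y_seq n \<in> borel_measurable \<Omega> \<and> distr \<Omega> borel (Y_seq n) = \<mu> (s n)) \<and>
    Y \<in> borel_measurable \<Omega> \<and> (\<forall>x\<in>space \<Omega>. (\<lambda>n. Y_seq n x) \<longlonglongrightarrow> Y x)"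
proof -
  obtain s M where s: "strict_mono (s :: nat \<Rightarrow> nat)" "real_distribution M" "weak_conv_m (\<mu> \<circ> id \<circ> s) M"
    using tight_imp_convergent_subsubsequence[OF assms strict_mono_id] by blast
  have real: "real_distribution ((\<mu> \<circ> id \<circ> s) n)" for n
    using assms by (simp add: tight_def)
  obtain \<Omega> :: "real measure" and Y_seq Y where "prob_space \<Omega>" "\<forall>n. Y_seq n \<in> borel_measurable \<Omega>"
    "\<forall>n. distr \<Omega> borel (Y_seq n) = \<mu> (s n)" "Y \<in> borel_measurable \<Omega>"
    "\<forall>x\<in>space \<Omega>. (\<lambda>n. Y_seq n x) \<longlonglongrightarrow> Y x"
    using Skorohod[OF real s(2,3)] by (auto simp: comp_def)
  then show ?thesis using s(1) by blast
qed

lemma shifted_energy_distr: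
  assumes "prob_space \<Omega>" and Y[measurable]: "Y \<in> borel_measurable \<Omega>"
  shows "shifted_energy C (distr \<Omega> borel Y) = (\<integral>\<^sup>+x. \<integral>\<^sup>+y. logker C (Y x) (Y y) \<partial>\<Omega> \<partial>\<Omega>)"
proof -
  interpret prob_space \<Omega> by fact
  have [measurable]: "logpot C (distr \<Omega> borel Y) \<in> borel_measurable borel"
    by (rule measurable_logpot) (auto intro: prob_space_distr)
  show ?thesis
    unfolding shifted_energy_def by (subst nn_integral_distr) (auto simp: logpot_def nn_integral_distr)
qed

text \<open>The cap \<open>M n\<close> is there for discrete measures, whose atoms would give
  infinite energy on the diagonal. It tends to infinity and so is invisible in the limit; the
  constant cap infinity gives plain lower semicontinuity.\<close>

lemma energy_le_liminf_truncated:
  fixes Y_seq :: "nat \<Rightarrow> 'a \<Rightarrow> real" and M :: "nat \<Rightarrow> ennreal"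
  assumes "prob_space \<Omega>" and [measurable]: "\<And>n. Y_seq n \<in> borel_measurable \<Omega>" "Y \<in> borel_measurable \<Omega>"
    and lim: "\<And>x. x \<in> space \<Omega> \<Longrightarrow> (\<lambda>n. Y_seq n x) \<longlonglongrightarrow> Y x" and M: "M \<longlonglongrightarrow> \<infinity>"
  shows "(\<integral>\<^sup>+x. \<integral>\<^sup>+y. logker C (of_real (Y x)) (of_real (Y y)) \<partial>\<Omega> \<partial>\<Omega>) \<le>
    liminf (\<lambda>n. \<integral>\<^sup>+x. \<integral>\<^sup>+y. min (logker C (of_real (Y_seq n x)) (of_real (Y_seq n y))) (M n) \<partial>\<Omega> \<partial>\<Omega>)"
proof -
  interpret prob_space \<Omega> by fact
  have pointwise: "logker C (of_real (Y x)) (of_real (Y y)) =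
      liminf (\<lambda>n. min (logker C (of_real (Y_seq n x)) (of_real (Y_seq n y))) (M n))"
    if "x \<in> space \<Omega>" "y \<in> space \<Omega>" for x y
  proof -
    have "(\<lambda>n. min (logker C (of_real (Y_seq n x)) (of_real (Y_seq n y))) (M n)) \<longlonglongrightarrow>
        min (logker C (of_real (Y x)) (of_real (Y y))) \<infinity>"
      by (intro tendsto_min tendsto_logker tendsto_of_real lim that M)
    then show ?thesis by (simp add: lim_imp_Liminf)
  qed
  have "(\<integral>\<^sup>+x. \<integral>\<^sup>+y. logker C (of_real (Y x)) (of_real (Y y)) \<partial>\<Omega> \<partial>\<Omega>) =
    (\<integral>\<^sup>+x. \<integral>\<^sup>+y. liminf (\<lambda>n. min (logker C (of_real (Y_seq n x)) (of_real (Y_seq n y))) (M n)) \<partial>\<Omega> \<partial>\<Omega>)"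
    using pointwise by (intro nn_integral_cong) auto
  also have "\<dots> \<le> (\<integral>\<^sup>+x. liminf (\<lambda>n. \<integral>\<^sup>+y. min (logker C (of_real (Y_seq n x)) (of_real (Y_seq n y))) (M n) \<partial>\<Omega>) \<partial>\<Omega>)"
    by (intro nn_integral_mono nn_integral_liminf) measurable
  also have "\<dots> \<le> liminf (\<lambda>n. \<integral>\<^sup>+x. \<integral>\<^sup>+y. min (logker C (of_real (Y_seq n x)) (of_real (Y_seq n y))) (M n) \<partial>\<Omega> \<partial>\<Omega>)"
    by (intro nn_integral_liminf) measurable
  finally show ?thesis .
qed

definition counting_distr :: "nat \<Rightarrow> (nat \<Rightarrow> real) \<Rightarrow> real measure" where
  "counting_distr n x = distr (measure_pmf (pmf_of_set {1..n})) borel x"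

lemma real_distribution_counting_distr: "real_distribution (counting_distr n x)"
proof -
  have "prob_space (counting_distr n x)"
    unfolding counting_distr_def by (rule measure_pmf.prob_space_distr) simp
  then show ?thesis
    by (simp add: real_distribution_def real_distribution_axioms_def counting_distr_def)
qed

lemma nn_integral_counting_distr:
  assumes "1 \<le> n" "f \<in> borel_measurable borel"
  shows "(\<integral>\<^sup>+y. f y \<partial>counting_distr n x) = (\<Sum>k=1..n. f (x k)) / of_nat n"
proof -
  have "(\<integral>\<^sup>+y. f y \<partial>counting_distr n x) = (\<integral>\<^sup>+k. f (x k) \<partial>measure_pmf (pmf_of_set {1..n}))"
    unfolding counting_distr_def by (rule nn_integral_distr) (use assms in auto)
  also have "\<dots> = (\<Sum>k=1..n. f (x k)) / of_nat n"
    using assms(1) by (subst nn_integral_pmf_of_set) auto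
  finally show ?thesis .
qed

text \<open>Turns a bound on off-diagonal sums into an energy bound for a weak limit. It serves
  twice: for the greedy points on a set of capacity zero and for the zeros of the
  polynomials.\<close>

lemma discrete_energy_limit:
  assumes n: "filterlim n at_top sequentially" "\<And>i. 1 \<le> n i"
    and tight: "tight (\<lambda>i. counting_distr (n i) (x i))"
    and energy: "\<And>i. (\<Sum>j=1..n i. \<Sum>k\<in>{1..n i} - {j}. logker C (of_real (x i j)) (of_real (x i k))) \<le>
      ennreal (D i * real (n i) ^ 2)"
    and D: "D \<longlonglongrightarrow> d" "\<And>i. 0 \<le> D i"
  shows "\<exists>s (\<Omega> :: real measure) Y_seq Y. strict_mono s \<and> prob_space \<Omega> \<and>
    (\<forall>i. Y_seq i \<in> borel_measurable \<Omega> \<and> distr \<Omega> borel (Y_seq i) = counting_distr (n (s i)) (x (s i))) \<and>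
    Y \<in> borel_measurable \<Omega> \<and> (\<forall>x\<in>space \<Omega>. (\<lambda>n. Y_seq n x) \<longlonglongrightarrow> Y x) \<and>
    shifted_energy C (distr \<Omega> borel (\<lambda>x. complex_of_real (Y x))) \<le> ennreal d"
proof -
  obtain s and \<Omega> :: "real measure" and Y_seq Y where s: "strict_mono s" and \<Omega>: "prob_space \<Omega>"
    and [measurable]: "\<And>i. Y_seq i \<in> borel_measurable \<Omega>" "Y \<in> borel_measurable \<Omega>"
    and distr: "\<And>i. distr \<Omega> borel (Y_seq i) = counting_distr (n (s i)) (x (s i))"
    and lim: "\<And>x. x \<in> space \<Omega> \<Longrightarrow> (\<lambda>n. Y_seq n x) \<longlonglongrightarrow> Y x"
    using tight_subsequence_Skorohod[OF tight] by blast
  interpret prob_space \<Omega> by fact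
  have ns: "filterlim (\<lambda>i. n (s i)) at_top sequentially"
    using filterlim_compose[OF n(1) filterlim_subseq[OF s]] .
  \<comment> \<open>The diagonal contributes n terms of size at most M, hence M/n after division by
    n^2. The square root lets the cap grow while this contribution vanishes.\<close>
  define M where "M i = ennreal (sqrt (real (n (s i))))" for i
  have M: "M \<longlonglongrightarrow> \<infinity>"
    unfolding M_def infinity_ennreal_def ennreal_tendsto_top_eq_at_top
    by (intro filterlim_compose[OF sqrt_at_top]
        filterlim_compose[OF filterlim_real_sequentially ns])
  have bound: "(\<integral>\<^sup>+u. \<integral>\<^sup>+v. min (logker C (of_real (Y_seq i u)) (of_real (Y_seq i v))) (M i) \<partial>\<Omega> \<partial>\<Omega>) \<le>
      ennreal (1 / sqrt (real (n (s i))) + D (s i))" for i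
  proof -
    let ?n = "n (s i)" and ?x = "x (s i)"
    let ?k = "\<lambda>a b. min (logker C (of_real a) (of_real b)) (M i)"
    have n1: "1 \<le> ?n" by (rule n)
    have "(\<integral>\<^sup>+u. \<integral>\<^sup>+v. ?k (Y_seq i u) (Y_seq i v) \<partial>\<Omega> \<partial>\<Omega>) = (\<integral>\<^sup>+u. \<integral>\<^sup>+b. ?k (Y_seq i u) b \<partial>distr \<Omega> borel (Y_seq i) \<partial>\<Omega>)"
      by (subst nn_integral_distr) auto
    also have "\<dots> = (\<integral>\<^sup>+u. (\<Sum>k=1..?n. ?k (Y_seq i u) (?x k)) / of_nat ?n \<partial>\<Omega>)"
      unfolding distr by (subst nn_integral_counting_distr[OF n1]) auto
    also have "\<dots> = (\<integral>\<^sup>+a. (\<Sum>k=1..?n. ?k a (?x k)) / of_nat ?n \<partial>distr \<Omega> borel (Y_seq i))"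
      by (subst nn_integral_distr) auto
    also have "\<dots> = (\<Sum>j=1..?n. (\<Sum>k=1..?n. ?k (?x j) (?x k)) / of_nat ?n) / of_nat ?n"
      unfolding distr by (subst nn_integral_counting_distr[OF n1]) auto
    also have "\<dots> = (\<Sum>j=1..?n. \<Sum>k=1..?n. ?k (?x j) (?x k)) / ennreal (real ?n ^ 2)"
    proof -
      have "(a / of_nat ?n) / of_nat ?n = a / ennreal (real ?n ^ 2)" for a :: ennreal
        using n1 by (simp add: divide_ennreal_def mult.assoc inverse_ennreal ennreal_of_nat_eq_real_of_nat
            power2_eq_square flip: ennreal_mult)
      then show ?thesis by (simp add: divide_ennreal_def sum_distrib_right)
    qed
    also have "\<dots> \<le> ennreal ((1 / sqrt (real ?n) + D (s i)) * real ?n ^ 2) / ennreal (real ?n ^ 2)"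
    proof (rule divide_right_mono_ennreal)
      have "(\<Sum>j=1..?n. \<Sum>k=1..?n. ?k (?x j) (?x k)) \<le>
        (\<Sum>j=1..?n. M i + (\<Sum>k\<in>{1..?n} - {j}. logker C (of_real (?x j)) (of_real (?x k))))"
      proof (rule sum_mono)
        fix j assume "j \<in> {1..?n}"
        then have "(\<Sum>k=1..?n. ?k (?x j) (?x k)) = ?k (?x j) (?x j) + (\<Sum>k\<in>{1..?n} - {j}. ?k (?x j) (?x k))"
          by (intro sum.remove) auto
        also have "\<dots> \<le> M i + (\<Sum>k\<in>{1..?n} - {j}. logker C (of_real (?x j)) (of_real (?x k)))"
          by (intro add_mono sum_mono) auto
        finally show "(\<Sum>k=1..?n. ?k (?x j) (?x k)) \<le> \<dots>" .
      qed
      also have "\<dots> = of_nat ?n * M i + (\<Sum>j=1..?n. \<Sum>k\<in>{1..?n} - {j}. logker C (of_real (?x j)) (of_real (?x k)))"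
        by (simp add: sum.distrib)
      also have "\<dots> \<le> ennreal (real ?n * sqrt (real ?n)) + ennreal (D (s i) * real ?n ^ 2)"
        by (intro add_mono energy) (simp add: M_def ennreal_of_nat_eq_real_of_nat ennreal_mult)
      also have "\<dots> = ennreal ((1 / sqrt (real ?n) + D (s i)) * real ?n ^ 2)"
      proof -
        have "real ?n * sqrt (real ?n) = 1 / sqrt (real ?n) * real ?n ^ 2"
          using n1 by (simp add: field_simps power2_eq_square)
        then show ?thesis using D(2) by (simp add: distrib_right flip: ennreal_plus)
      qed
      finally show "(\<Sum>j=1..?n. \<Sum>k=1..?n. ?k (?x j) (?x k)) \<le> ennreal ((1 / sqrt (real ?n) + D (s i)) * real ?n ^ 2)" .
    qed
    also have "\<dots> = ennreal (1 / sqrt (real ?n) + D (s i))"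
      using n1 D(2) by (subst divide_ennreal) auto
    finally show ?thesis .
  qed
  have "(\<lambda>i. 1 / sqrt (real (n (s i))) + D (s i)) \<longlonglongrightarrow> 0 + d"
    by (intro tendsto_add LIMSEQ_subseq_LIMSEQ[OF D(1) s, unfolded comp_def] real_tendsto_divide_at_top[OF tendsto_const]
        filterlim_compose[OF sqrt_at_top] filterlim_compose[OF filterlim_real_sequentially ns])
  then have lim_bound: "(\<lambda>i. ennreal (1 / sqrt (real (n (s i))) + D (s i))) \<longlonglongrightarrow> ennreal d"
    by simp
  have "shifted_energy C (distr \<Omega> borel (\<lambda>x. complex_of_real (Y x))) =
      (\<integral>\<^sup>+x. \<integral>\<^sup>+y. logker C (of_real (Y x)) (of_real (Y y)) \<partial>\<Omega> \<partial>\<Omega>)"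
    by (rule shifted_energy_distr) (use \<Omega> in auto)
  also have "\<dots> \<le> liminf (\<lambda>i. \<integral>\<^sup>+x. \<integral>\<^sup>+y. min (logker C (of_real (Y_seq i x)) (of_real (Y_seq i y))) (M i) \<partial>\<Omega> \<partial>\<Omega>)"
    using \<Omega> lim M by (intro energy_le_liminf_truncated) auto
  also have "\<dots> \<le> liminf (\<lambda>i. ennreal (1 / sqrt (real (n (s i))) + D (s i)))"
    using bound by (intro Liminf_mono always_eventually) auto
  also have "\<dots> = ennreal d" using lim_bound by (simp add: lim_imp_Liminf)
  finally have "shifted_energy C (distr \<Omega> borel (\<lambda>x. complex_of_real (Y x))) \<le> ennreal d" .
  then show ?thesis
    using s \<Omega> distr lim by (intro exI[of _ s] exI[of _ \<Omega>] exI[of _ Y_seq] exI[of _ Y] conjI allI ballI) simp_all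
qed

lemma tight_AE_bounded:
  assumes "\<And>n. real_distribution (\<mu> n)" "\<And>n. AE x in \<mu> n. \<bar>x\<bar> \<le> B"
  shows "tight \<mu>"
  unfolding tight_def
proof (intro conjI allI impI)
  show "real_distribution (\<mu> n)" for n by fact
  fix \<epsilon> :: real assume "0 < \<epsilon>"
  have "1 - \<epsilon> < measure (\<mu> n) {-\<bar>B\<bar> - 1<..\<bar>B\<bar>}" for n
  proof -
    interpret real_distribution "\<mu> n" by fact
    have "AE x in \<mu> n. x \<in> {-\<bar>B\<bar> - 1<..\<bar>B\<bar>}"
      using assms(2)[of n] by eventually_elim auto
    then have "measure (\<mu> n) {-\<bar>B\<bar> - 1<..\<bar>B\<bar>} = 1" by (subst prob_eq_1) auto
    then show ?thesis using \<open>0 < \<epsilon>\<close> by simp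
  qed
  then show "\<exists>a b. a < b \<and> (\<forall>n. 1 - \<epsilon> < measure (\<mu> n) {a<..b})"
    by (intro exI[of _ "-\<bar>B\<bar> - 1"] exI[of _ "\<bar>B\<bar>"]) auto
qed

lemma AE_limit_in_closed:
  assumes "prob_space \<Omega>" and [measurable]: "\<And>n. Y_seq n \<in> borel_measurable \<Omega>" "Y \<in> borel_measurable \<Omega>"
    and lim: "\<And>x. x \<in> space \<Omega> \<Longrightarrow> (\<lambda>n. Y_seq n x) \<longlonglongrightarrow> Y x"
    and "closed (S :: real set)" and AE: "\<And>n. AE x in distr \<Omega> borel (Y_seq n). x \<in> S"
  shows "AE x in \<Omega>. Y x \<in> S"
proof -
  have "AE x in \<Omega>. Y_seq n x \<in> S" for n
  proof -
    have [measurable]: "S \<in> sets borel" using \<open>closed S\<close> by (rule borel_closed)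
    show ?thesis using AE[of n] by (subst (asm) AE_distr_iff) auto
  qed
  then have "AE x in \<Omega>. \<forall>n. Y_seq n x \<in> S" by (simp add: AE_all_countable)
  then show ?thesis
  proof (rule AE_mp, intro AE_I2 impI)
    fix x assume x: "x \<in> space \<Omega>" and mem: "\<forall>n. Y_seq n x \<in> S"
    show "Y x \<in> S"
      using mem by (intro closed_sequentially[OF \<open>closed S\<close> _ lim[OF x]]) blast
  qed
qed

section \<open>Equilibrium measures on the real line\<close>

text \<open>The convex combination of the two measures with weights t and 1 - t, encoded as sampling
  by a biased coin so that its integrals follow from the rule for bind.\<close>

definition mixture :: "real \<Rightarrow> 'a measure \<Rightarrow> 'a measure \<Rightarrow> 'a measure" where
  "mixture t \<sigma> \<mu> = measure_pmf (bernoulli_pmf t) \<bind> (\<lambda>b. if b then \<sigma> else \<mu>)"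

context
  fixes \<sigma> \<mu> :: "complex measure"
  assumes prob: "prob_space \<sigma>" "prob_space \<mu>" and sets: "sets \<sigma> = sets borel" "sets \<mu> = sets borel"
begin

lemma measurable_mixture_kernel:
  "(\<lambda>b. if b then \<sigma> else \<mu>) \<in> measure_pmf (bernoulli_pmf t) \<rightarrow>\<^sub>M subprob_algebra borel"
proof (rule measurableI)
  fix b :: bool
  show "(if b then \<sigma> else \<mu>) \<in> space (subprob_algebra borel)"
    using prob sets by (auto simp: space_subprob_algebra prob_space_imp_subprob_space)
qed simp

lemma sets_mixture: "sets (mixture t \<sigma> \<mu>) = sets borel"
  unfolding mixture_def using sets by (subst sets_bind[where N = borel]) auto

lemma nn_integral_mixture:
  assumes "0 \<le> t" "t \<le> 1" "f \<in> borel_measurable borel"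
  shows "(\<integral>\<^sup>+x. f x \<partial>mixture t \<sigma> \<mu>) = ennreal t * (\<integral>\<^sup>+x. f x \<partial>\<sigma>) + ennreal (1 - t) * (\<integral>\<^sup>+x. f x \<partial>\<mu>)"
  unfolding mixture_def nn_integral_bind[OF assms(3) measurable_mixture_kernel]
  using assms(1,2) by (subst nn_integral_bernoulli_pmf) (auto simp: mult.commute)

lemma prob_space_mixture:
  assumes "0 \<le> t" "t \<le> 1"
  shows "prob_space (mixture t \<sigma> \<mu>)"
proof (rule prob_spaceI)
  interpret \<sigma>: prob_space \<sigma> by fact
  interpret \<mu>: prob_space \<mu> by fact
  have "emeasure (mixture t \<sigma> \<mu>) (space (mixture t \<sigma> \<mu>)) = (\<integral>\<^sup>+x. 1 \<partial>mixture t \<sigma> \<mu>)"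
    by simp
  also have "\<dots> = ennreal t + ennreal (1 - t)"
    using assms by (subst nn_integral_mixture) (auto simp: \<sigma>.emeasure_space_1 \<mu>.emeasure_space_1)
  also have "\<dots> = 1" using assms by (simp flip: ennreal_plus)
  finally show "emeasure (mixture t \<sigma> \<mu>) (space (mixture t \<sigma> \<mu>)) = 1" .
qed

lemma mixture_in_prob_measures_on:
  assumes "0 \<le> t" "t \<le> 1" "compact S" "\<sigma> \<in> prob_measures_on S" "\<mu> \<in> prob_measures_on S"
  shows "mixture t \<sigma> \<mu> \<in> prob_measures_on S"
proof -
  have S: "- S \<in> sets borel" using assms(3) by (simp add: borel_open open_Compl compact_imp_closed)
  have null: "(\<integral>\<^sup>+x. indicator (- S) x \<partial>\<nu>) = 0" if "\<nu> \<in> prob_measures_on S" for \<nu> :: "complex measure"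
  proof -
    have "AE x in \<nu>. indicator (- S) x = (0 :: ennreal)"
      using prob_measures_onD(3)[OF that] by eventually_elim auto
    then have "(\<integral>\<^sup>+x. indicator (- S) x \<partial>\<nu>) = (\<integral>\<^sup>+x. 0 \<partial>\<nu>)" by (rule nn_integral_cong_AE)
    then show ?thesis by simp
  qed
  have "(\<integral>\<^sup>+x. indicator (- S) x \<partial>mixture t \<sigma> \<mu>) = 0"
    using assms S null by (subst nn_integral_mixture) auto
  then have "emeasure (mixture t \<sigma> \<mu>) (- S) = 0" using S sets_mixture by simp
  then show ?thesis
    unfolding prob_measures_on_def using assms prob_space_mixture sets_mixture by blast
qed

lemma nn_integral_logpot_commute:
  "(\<integral>\<^sup>+z. logpot C \<sigma> z \<partial>\<mu>) = (\<integral>\<^sup>+z. logpot C \<mu> z \<partial>\<sigma>)"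
proof -
  interpret \<sigma>: prob_space \<sigma> by fact
  interpret \<mu>: prob_space \<mu> by fact
  interpret pair_sigma_finite \<sigma> \<mu> ..
  note [measurable_cong] = sets
  have "(\<integral>\<^sup>+z. (\<integral>\<^sup>+w. logker C z w \<partial>\<sigma>) \<partial>\<mu>) = (\<integral>\<^sup>+z. (\<integral>\<^sup>+w. logker C w z \<partial>\<sigma>) \<partial>\<mu>)"
    by (simp add: logker_commute)
  also have "\<dots> = (\<integral>\<^sup>+w. (\<integral>\<^sup>+z. logker C w z \<partial>\<mu>) \<partial>\<sigma>)"
    by (rule Fubini') measurable
  finally show ?thesis by (simp add: logpot_def)
qed

lemma shifted_energy_mixture:
  assumes "0 \<le> t" "t \<le> 1"
  shows "shifted_energy C (mixture t \<sigma> \<mu>) = ennreal (t\<^sup>2) * shifted_energy C \<sigma> +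
     ennreal (2 * t * (1 - t)) * (\<integral>\<^sup>+z. logpot C \<mu> z \<partial>\<sigma>) + ennreal ((1 - t)\<^sup>2) * shifted_energy C \<mu>"
proof -
  have [measurable]: "logpot C \<sigma> \<in> borel_measurable borel" "logpot C \<mu> \<in> borel_measurable borel"
    using prob sets by (auto intro: measurable_logpot)
  note [measurable_cong] = sets
  have pot: "logpot C (mixture t \<sigma> \<mu>) z = ennreal t * logpot C \<sigma> z + ennreal (1 - t) * logpot C \<mu> z" for z
    unfolding logpot_def using assms by (subst nn_integral_mixture) auto
  let ?m = "\<integral>\<^sup>+z. logpot C \<mu> z \<partial>\<sigma>"
  have "shifted_energy C (mixture t \<sigma> \<mu>) =
    ennreal t * (ennreal t * shifted_energy C \<sigma> + ennreal (1 - t) * ?m) +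
    ennreal (1 - t) * (ennreal t * ?m + ennreal (1 - t) * shifted_energy C \<mu>)"
    unfolding shifted_energy_def pot using assms
    by (subst nn_integral_mixture) (auto simp: nn_integral_add nn_integral_cmult nn_integral_logpot_commute)
  also have "\<dots> = ennreal (t * t) * shifted_energy C \<sigma> + (ennreal (t * (1 - t)) + ennreal (t * (1 - t))) * ?m
      + ennreal ((1 - t) * (1 - t)) * shifted_energy C \<mu>"
    using assms by (simp add: ennreal_mult distrib_left distrib_right mult_ac add_ac)
  also have "ennreal (t * (1 - t)) + ennreal (t * (1 - t)) = ennreal (2 * t * (1 - t))"
    using assms by (simp flip: ennreal_plus)
  finally show ?thesis by (simp add: power2_eq_square)
qed

end

text \<open>Lower semicontinuity of the potential, from Fatou's lemma and continuity of the
  kernel.\<close>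

lemma closed_logpot_le:
  assumes "prob_space \<mu>" and [measurable_cong]: "sets \<mu> = sets borel"
  shows "closed {z. logpot C \<mu> z \<le> c}"
  unfolding closed_sequential_limits
proof (intro allI impI, elim conjE)
  fix u z assume u: "\<forall>n. u n \<in> {z. logpot C \<mu> z \<le> c}" and lim: "u \<longlonglongrightarrow> z"
  have "logpot C \<mu> z = (\<integral>\<^sup>+w. liminf (\<lambda>n. logker C (u n) w) \<partial>\<mu>)"
    unfolding logpot_def
  proof (rule nn_integral_cong)
    fix w
    have "(\<lambda>n. logker C (u n) w) \<longlonglongrightarrow> logker C z w" by (intro tendsto_logker lim tendsto_const)
    then show "logker C z w = liminf (\<lambda>n. logker C (u n) w)" by (simp add: lim_imp_Liminf)
  qed
  also have "\<dots> \<le> liminf (\<lambda>n. logpot C \<mu> (u n))"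
    unfolding logpot_def by (rule nn_integral_liminf) measurable
  also have "\<dots> \<le> liminf (\<lambda>n. c)" using u by (intro Liminf_mono always_eventually) auto
  finally show "z \<in> {z. logpot C \<mu> z \<le> c}" by (simp add: Liminf_const)
qed

text \<open>
  The \<open>1\<close> in \<open>diam_add_1\<close> keeps the kernel untruncated also at points near \<open>E\<close>, where the boundary
  values of the potential are computed.
\<close>

locale equilibrium =
  fixes E :: "complex set" and C :: real and \<mu> :: "complex measure"
  assumes compact: "compact E" and real: "E \<subseteq> range of_real"
    and diam_add_1: "\<And>z w. z \<in> E \<Longrightarrow> w \<in> E \<Longrightarrow> dist z w + 1 \<le> exp C" and C_pos: "0 < C"
    and energy_ge: "\<And>\<sigma>. \<sigma> \<in> prob_measures_on E \<Longrightarrow> ennreal C \<le> shifted_energy C \<sigma>"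
    and \<mu>: "\<mu> \<in> prob_measures_on E" and energy_le: "shifted_energy C \<mu> \<le> ennreal C"
begin

lemma diam: "z \<in> E \<Longrightarrow> w \<in> E \<Longrightarrow> dist z w \<le> exp C"
  using diam_add_1[of z w] by simp

lemma C_nonneg: "0 \<le> C"
  using C_pos by simp

sublocale prob_space \<mu> using \<mu> by (rule prob_measures_onD)

lemma sets_\<mu> [measurable_cong]: "sets \<mu> = sets borel"
  using \<mu> by (rule prob_measures_onD)

lemma AE_\<mu>: "AE z in \<mu>. z \<in> E"
  using \<mu> by (rule prob_measures_onD)

lemma measurable_logpot_\<mu> [measurable]: "logpot C \<mu> \<in> borel_measurable borel"
  by (rule measurable_logpot[OF prob_space_axioms sets_\<mu>])

section \<open>Frostman's theorem on the real line\<close>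

text \<open>First variation at a minimum: the energy of the mixture is quadratic in t and at least
  C, so subtracting C, dividing by t and letting t tend to 0 leaves the linear coefficient.\<close>

lemma nn_integral_logpot_ge:
  assumes \<sigma>: "\<sigma> \<in> prob_measures_on E" and fin: "shifted_energy C \<sigma> < \<infinity>"
  shows "ennreal C \<le> (\<integral>\<^sup>+z. logpot C \<mu> z \<partial>\<sigma>)"
proof (cases "\<integral>\<^sup>+z. logpot C \<mu> z \<partial>\<sigma>")
  case (real m)
  obtain a where a: "0 \<le> a" "shifted_energy C \<sigma> = ennreal a"
    using fin by (cases "shifted_energy C \<sigma>") auto
  have ineq: "2 * C - t * C \<le> t * a + 2 * (1 - t) * m" if t: "0 < t" "t < 1" for t
  proof -
    have "ennreal C \<le> shifted_energy C (mixture t \<sigma> \<mu>)"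
      using t compact \<sigma> \<mu> prob_measures_onD[OF \<sigma>] prob_measures_onD[OF \<mu>]
      by (intro energy_ge mixture_in_prob_measures_on) auto
    also have "\<dots> = ennreal (t\<^sup>2) * ennreal a + ennreal (2 * t * (1 - t)) * ennreal m + ennreal ((1 - t)\<^sup>2) * shifted_energy C \<mu>"
      using t prob_measures_onD[OF \<sigma>] prob_measures_onD[OF \<mu>] real a
      by (subst shifted_energy_mixture) auto
    also have "\<dots> \<le> ennreal (t\<^sup>2) * ennreal a + ennreal (2 * t * (1 - t)) * ennreal m + ennreal ((1 - t)\<^sup>2) * ennreal C"
      by (intro add_left_mono mult_left_mono energy_le) simp
    also have "\<dots> = ennreal (t\<^sup>2 * a + 2 * t * (1 - t) * m + (1 - t)\<^sup>2 * C)"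
      using t a real C_nonneg by (simp add: ennreal_mult[symmetric] ennreal_plus[symmetric] del: ennreal_plus)
    finally have "C \<le> t\<^sup>2 * a + 2 * t * (1 - t) * m + (1 - t)\<^sup>2 * C"
      using t a real C_nonneg by (subst (asm) ennreal_le_iff) auto
    then have "t * (2 * C - t * C) \<le> t * (t * a + 2 * (1 - t) * m)"
      by (simp add: power2_eq_square algebra_simps)
    then show ?thesis using t by simp
  qed
  have "((\<lambda>t. 2 * C - t * C) \<longlongrightarrow> 2 * C - 0 * C) (at_right 0)"
    "((\<lambda>t. t * a + 2 * (1 - t) * m) \<longlongrightarrow> 0 * a + 2 * (1 - 0) * m) (at_right 0)"
    by (intro tendsto_intros)+
  moreover have "\<forall>\<^sub>F t in at_right 0. 2 * C - t * C \<le> t * a + 2 * (1 - t) * m"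
    using eventually_at_right_real[of 0 1] ineq by (auto elim: eventually_mono)
  ultimately have "2 * C - 0 * C \<le> 0 * a + 2 * (1 - 0) * m"
    by (intro tendsto_le[OF trivial_limit_at_right_real]) auto
  then show ?thesis using real by (auto intro: ennreal_leI)
qed simp

lemma not_AE_logpot_less:
  assumes \<sigma>: "\<sigma> \<in> prob_measures_on E" and fin: "shifted_energy C \<sigma> < \<infinity>"
    and less: "AE z in \<sigma>. logpot C \<mu> z < ennreal C"
  shows False
proof -
  interpret \<sigma>: prob_space \<sigma> using \<sigma> by (rule prob_measures_onD)
  note [measurable_cong] = prob_measures_onD(2)[OF \<sigma>]
  have le: "(\<integral>\<^sup>+z. logpot C \<mu> z \<partial>\<sigma>) \<le> (\<integral>\<^sup>+z. ennreal C \<partial>\<sigma>)"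
    by (rule nn_integral_mono_AE) (use less in eventually_elim, simp)
  have "(\<integral>\<^sup>+z. logpot C \<mu> z \<partial>\<sigma>) < (\<integral>\<^sup>+z. ennreal C \<partial>\<sigma>)"
  proof (rule nn_integral_less)
    show "(\<integral>\<^sup>+z. logpot C \<mu> z \<partial>\<sigma>) \<noteq> \<infinity>" using le by (auto simp: \<sigma>.emeasure_space_1 top_unique)
    show "AE z in \<sigma>. logpot C \<mu> z \<le> ennreal C" using less by eventually_elim simp
    show "\<not> (AE z in \<sigma>. ennreal C \<le> logpot C \<mu> z)"
    proof
      assume "AE z in \<sigma>. ennreal C \<le> logpot C \<mu> z"
      with less have "AE z in \<sigma>. False" by eventually_elim simp
      then show False by simp
    qed
  qed measurable
  then show False using nn_integral_logpot_ge[OF \<sigma> fin] by (simp add: \<sigma>.emeasure_space_1)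
qed

text \<open>A measure of finite energy on this set would have mean potential below C, against the
  first variation. The set later serves as the exceptional boundary set of the Green
  function.\<close>

lemma log_capacity_logpot_less: "log_capacity {z \<in> E. logpot C \<mu> z < ennreal C} = 0"
proof -
  let ?N = "{z \<in> E. logpot C \<mu> z < ennreal C}"
  have "shifted_energy C \<sigma> = \<infinity>" if \<sigma>: "\<sigma> \<in> prob_measures_on ?N" for \<sigma>
  proof (rule ccontr)
    assume "shifted_energy C \<sigma> \<noteq> \<infinity>"
    then have "shifted_energy C \<sigma> < \<infinity>" by (simp add: less_top)
    moreover have "\<sigma> \<in> prob_measures_on E" using \<sigma> unfolding prob_measures_on_def by blast
    moreover have "AE z in \<sigma>. logpot C \<mu> z < ennreal C"
      using prob_measures_onD(3)[OF \<sigma>] by eventually_elim simp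
    ultimately show False using not_AE_logpot_less by blast
  qed
  then show ?thesis using log_capacity_eq_0_iff[of ?N C] diam C_nonneg by blast
qed

text \<open>If the set where the potential is below C had mass m > 0, the normalized restriction of
  \<mu> to it would have energy at most C/m^2, hence finite, and \<open>not_AE_logpot_less\<close>
  would apply to it.\<close>

lemma AE_logpot_ge: "AE z in \<mu>. ennreal C \<le> logpot C \<mu> z"
proof -
  define A where "A = {z. logpot C \<mu> z < ennreal C}"
  have A[measurable]: "A \<in> sets \<mu>" unfolding A_def by measurable
  have "emeasure \<mu> A = 0"
  proof (rule ccontr)
    assume pos: "emeasure \<mu> A \<noteq> 0"
    define m where "m = measure \<mu> A"
    have m: "emeasure \<mu> A = ennreal m" "0 < m"
      using pos unfolding m_def by (auto simp: emeasure_eq_measure zero_less_measure_iff)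
    define \<sigma> where "\<sigma> = uniform_measure \<mu> A"
    have sets_\<sigma>: "sets \<sigma> = sets borel" by (simp add: \<sigma>_def sets_\<mu>)
    have int: "(\<integral>\<^sup>+z. f z \<partial>\<sigma>) = (\<integral>\<^sup>+z. f z * indicator A z \<partial>\<mu>) / ennreal m" if "f \<in> borel_measurable borel" for f
      unfolding \<sigma>_def using that by (subst nn_integral_uniform_measure) (auto simp: m)
    have le: "(\<integral>\<^sup>+z. f z \<partial>\<sigma>) \<le> (\<integral>\<^sup>+z. f z \<partial>\<mu>) * ennreal (1 / m)" if f: "f \<in> borel_measurable borel" for f
    proof -
      have "(\<integral>\<^sup>+z. f z * indicator A z \<partial>\<mu>) \<le> (\<integral>\<^sup>+z. f z \<partial>\<mu>)"
        by (intro nn_integral_mono) (auto simp: indicator_def)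
      then have "(\<integral>\<^sup>+z. f z \<partial>\<sigma>) \<le> (\<integral>\<^sup>+z. f z \<partial>\<mu>) / ennreal m"
        unfolding int[OF f] by (rule divide_right_mono_ennreal)
      then show ?thesis using m by (simp add: divide_ennreal_def inverse_ennreal inverse_eq_divide)
    qed
    have \<sigma>: "\<sigma> \<in> prob_measures_on E"
      unfolding prob_measures_on_compact_iff[OF compact]
    proof (intro conjI sets_\<sigma>)
      show "prob_space \<sigma>" unfolding \<sigma>_def using m by (intro prob_space_uniform_measure) auto
      show "AE z in \<sigma>. z \<in> E"
        unfolding \<sigma>_def by (rule AE_uniform_measureI[OF A]) (use AE_\<mu> in eventually_elim, simp)
    qed
    interpret \<sigma>: prob_space \<sigma> using \<sigma> by (rule prob_measures_onD)
    have "shifted_energy C \<sigma> \<le> (\<integral>\<^sup>+z. logpot C \<mu> z * ennreal (1 / m) \<partial>\<sigma>)"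
      unfolding shifted_energy_def
      by (intro nn_integral_mono) (auto simp: logpot_def intro!: le)
    also have "\<dots> = (\<integral>\<^sup>+z. logpot C \<mu> z \<partial>\<sigma>) * ennreal (1 / m)"
      using sets_\<sigma> by (intro nn_integral_multc) (simp add: measurable_logpot_\<mu> cong: measurable_cong_sets)
    also have "\<dots> \<le> shifted_energy C \<mu> * ennreal (1 / m) * ennreal (1 / m)"
      unfolding shifted_energy_def by (intro mult_right_mono le) auto
    also have "\<dots> \<le> ennreal C * ennreal (1 / m) * ennreal (1 / m)"
      by (intro mult_right_mono energy_le) auto
    also have "\<dots> < \<infinity>" by (simp add: ennreal_mult_less_top)
    finally have "shifted_energy C \<sigma> < \<infinity>" .
    moreover have "AE z in \<sigma>. logpot C \<mu> z < ennreal C"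
      unfolding \<sigma>_def by (rule AE_uniform_measureI[OF A]) (auto simp: A_def)
    ultimately show False using not_AE_logpot_less[OF \<sigma>] by blast
  qed
  then have "AE z in \<mu>. z \<notin> A" by (intro AE_not_in null_setsI) auto
  then show ?thesis by eventually_elim (simp add: A_def)
qed

lemma AE_logpot_le: "AE z in \<mu>. logpot C \<mu> z \<le> ennreal C"
proof (rule ccontr)
  assume not: "\<not> (AE z in \<mu>. logpot C \<mu> z \<le> ennreal C)"
  have "(\<integral>\<^sup>+z. ennreal C \<partial>\<mu>) < (\<integral>\<^sup>+z. logpot C \<mu> z \<partial>\<mu>)"
    by (rule nn_integral_less) (use AE_logpot_ge not in \<open>auto simp: emeasure_space_1\<close>)
  then show False using energy_le by (simp add: shifted_energy_def emeasure_space_1)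
qed

text \<open>The closed set \<open>F\<close> carries \<mu>, so only its complement is at issue. In an
  unbounded gap the end point is closer to every point of \<open>F\<close> than x is. In a bounded
  gap (p, q) the distance to any s in \<open>F\<close> is affine along the gap, so the kernel is
  convex there and the potential at x is at most a weighted mean of its values at p and q.\<close>

lemma logpot_le_real: "logpot C \<mu> (of_real x) \<le> ennreal C"
proof (rule ccontr)
  define F where "F = {y. logpot C \<mu> (of_real y) \<le> ennreal C}"
  assume "\<not> logpot C \<mu> (of_real x) \<le> ennreal C"
  then have x: "x \<notin> F" by (simp add: F_def)
  have "F = of_real -` {z. logpot C \<mu> z \<le> ennreal C}" by (auto simp: F_def)
  then have closed: "closed F"
    by (simp only:) (intro continuous_closed_vimage closed_logpot_le prob_space_axioms sets_\<mu> continuous_intros)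
  have AE: "AE w in \<mu>. \<exists>s\<in>F. w = of_real s"
    using AE_\<mu> AE_logpot_le
  proof eventually_elim
    case (elim w)
    then obtain s where "w = of_real s" using real by auto
    then show ?case using elim by (auto simp: F_def)
  qed
  have mono_contra: False if y: "y \<in> F" and near: "\<And>s. s \<in> F \<Longrightarrow> dist y s \<le> dist x s" for y
  proof -
    have "logpot C \<mu> (of_real x) \<le> logpot C \<mu> (of_real y)"
      unfolding logpot_def
    proof (rule nn_integral_mono_AE)
      show "AE w in \<mu>. logker C (of_real x) w \<le> logker C (of_real y) w"
        using AE
      proof eventually_elim
        case (elim w)
        then obtain s where "s \<in> F" "w = of_real s" by blast
        then show ?case using near by (intro logker_mono) simp
      qed
    qed
    then show False using x y by (auto simp: F_def)
  qed
  let ?L = "F \<inter> {..x}" and ?R = "F \<inter> {x..}"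
  have cl: "closed ?L" "closed ?R" using closed by auto
  have "F \<noteq> {}"
  proof
    assume "F = {}"
    then have "AE w in \<mu>. False" using AE by simp
    then show False by simp
  qed
  have a: "Sup ?L \<in> ?L" if "?L \<noteq> {}" using that cl by (intro closed_contains_Sup) auto
  have b: "Inf ?R \<in> ?R" if "?R \<noteq> {}" using that cl by (intro closed_contains_Inf) auto
  have le_a: "s \<le> Sup ?L" if "s \<in> F" "s \<le> x" for s using that by (intro cSup_upper) auto
  have b_le: "Inf ?R \<le> s" if "s \<in> F" "x \<le> s" for s using that by (intro cInf_lower) auto
  consider "?L = {}" | "?R = {}" | "?L \<noteq> {}" "?R \<noteq> {}" by blast
  then show False
  proof cases
    case 1
    then have "?R \<noteq> {}" using \<open>F \<noteq> {}\<close> by fastforce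
    show False
    proof (rule mono_contra[of "Inf ?R"])
      show "dist (Inf ?R) s \<le> dist x s" if "s \<in> F" for s
        using b[OF \<open>?R \<noteq> {}\<close>] 1 that b_le[of s] by (cases "x \<le> s") (auto simp: dist_real_def)
    qed (use b[OF \<open>?R \<noteq> {}\<close>] in auto)
  next
    case 2
    then have "?L \<noteq> {}" using \<open>F \<noteq> {}\<close> by fastforce
    show False
    proof (rule mono_contra[of "Sup ?L"])
      show "dist (Sup ?L) s \<le> dist x s" if "s \<in> F" for s
        using a[OF \<open>?L \<noteq> {}\<close>] 2 that le_a[of s] by (cases "s \<le> x") (auto simp: dist_real_def)
    qed (use a[OF \<open>?L \<noteq> {}\<close>] in auto)
  next
    case 3
    define p q where "p = Sup ?L" and "q = Inf ?R"
    have pF: "p \<in> F" and qF: "q \<in> F" using a[OF 3(1)] b[OF 3(2)] by (auto simp: p_def q_def)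
    have "p \<le> x" "x \<le> q" using a[OF 3(1)] b[OF 3(2)] by (auto simp: p_def q_def)
    then have px: "p < x" and xq: "x < q" using x pF qF by (auto simp: order_less_le)
    define t where "t = (x - p) / (q - p)"
    have t: "0 < t" "t < 1" using px xq by (auto simp: t_def field_simps)
    have "t * (q - p) = x - p" using px xq by (simp add: t_def)
    then have xt: "x = (1 - t) * p + t * q" by (simp add: algebra_simps)
    have gap: "s \<le> p \<or> q \<le> s" if "s \<in> F" for s
      using le_a[of s] b_le[of s] that by (fastforce simp: p_def q_def)
    have convex: "logker C (of_real x) (of_real s) \<le>
        ennreal (1 - t) * logker C (of_real p) (of_real s) + ennreal t * logker C (of_real q) (of_real s)"
      if s: "s \<in> F" for s
    proof (cases "s = p \<or> s = q")
      case True
      then show ?thesis using t by (auto simp: logker_def ennreal_mult_top)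
    next
      case False
      then have less: "s < p \<or> q < s" using gap[OF s] by auto
      have d: "\<bar>x - s\<bar> = (1 - t) * \<bar>p - s\<bar> + t * \<bar>q - s\<bar>"
      proof (cases "s < p")
        case True
        then have "\<bar>x - s\<bar> = x - s" "\<bar>p - s\<bar> = p - s" "\<bar>q - s\<bar> = q - s" using px xq by auto
        then show ?thesis by (simp add: xt algebra_simps)
      next
        case F: False
        then have "\<bar>x - s\<bar> = s - x" "\<bar>p - s\<bar> = s - p" "\<bar>q - s\<bar> = s - q" using px xq less by auto
        then show ?thesis by (simp add: xt algebra_simps)
      qed
      have "(1 - t) * ln \<bar>p - s\<bar> + t * ln \<bar>q - s\<bar> \<le> ln ((1 - t) * \<bar>p - s\<bar> + t * \<bar>q - s\<bar>)"
        using concave_onD[OF ln_concave, of t "\<bar>p - s\<bar>" "\<bar>q - s\<bar>"] t False by simp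
      then have "C - ln \<bar>x - s\<bar> \<le> (1 - t) * (C - ln \<bar>p - s\<bar>) + t * (C - ln \<bar>q - s\<bar>)"
        unfolding d by (simp add: algebra_simps)
      \<comment> \<open>\<open>F\<close> may extend beyond \<open>E\<close>, where distances can
        exceed \<open>exp C\<close>; the convexity inequality therefore has to be passed to positive
        parts.\<close>
      then have "ennreal (C - ln \<bar>x - s\<bar>) \<le> ennreal ((1 - t) * max 0 (C - ln \<bar>p - s\<bar>) + t * max 0 (C - ln \<bar>q - s\<bar>))"
        using t by (intro ennreal_leI) (smt (verit) mult_left_mono)
      also have "\<dots> = ennreal (1 - t) * ennreal (C - ln \<bar>p - s\<bar>) + ennreal t * ennreal (C - ln \<bar>q - s\<bar>)"
      proof -
        have "ennreal (max 0 y) = ennreal y" for y by (cases "0 \<le> y") (auto simp: ennreal_neg max_def)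
        then show ?thesis using t by (simp add: ennreal_plus ennreal_mult)
      qed
      finally show ?thesis using False s x by (auto simp: logker_def dist_real_def)
    qed
    have "logpot C \<mu> (of_real x) \<le> (\<integral>\<^sup>+w. ennreal (1 - t) * logker C (of_real p) w + ennreal t * logker C (of_real q) w \<partial>\<mu>)"
      unfolding logpot_def
    proof (rule nn_integral_mono_AE)
      show "AE w in \<mu>. logker C (of_real x) w \<le> ennreal (1 - t) * logker C (of_real p) w + ennreal t * logker C (of_real q) w"
        using AE
      proof eventually_elim
        case (elim w)
        then show ?case using convex by auto
      qed
    qed
    also have "\<dots> = ennreal (1 - t) * logpot C \<mu> (of_real p) + ennreal t * logpot C \<mu> (of_real q)"
      unfolding logpot_def by (simp add: nn_integral_add nn_integral_cmult)
    also have "\<dots> \<le> ennreal (1 - t) * ennreal C + ennreal t * ennreal C"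
      using pF qF by (intro add_mono mult_left_mono) (auto simp: F_def)
    also have "\<dots> = ennreal C"
    proof -
      have "ennreal (1 - t) + ennreal t = 1" using t by (simp flip: ennreal_plus)
      then show ?thesis by (metis distrib_right mult_1)
    qed
    finally show False using x by (simp add: F_def)
  qed
qed

text \<open>Orthogonal projection to the real axis does not increase the distance to any point of
  \<open>E\<close>.\<close>

lemma logpot_le: "logpot C \<mu> z \<le> ennreal C"
proof -
  have "logpot C \<mu> z \<le> logpot C \<mu> (of_real (Re z))"
    unfolding logpot_def
  proof (rule nn_integral_mono_AE)
    show "AE w in \<mu>. logker C z w \<le> logker C (of_real (Re z)) w"
      using AE_\<mu>
    proof eventually_elim
      case (elim w)
      then obtain s where w: "w = of_real s" using real by auto
      have "dist (of_real (Re z)) w = \<bar>Re (z - w)\<bar>" by (simp add: w dist_real_def)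
      also have "\<dots> \<le> dist z w" unfolding dist_norm by (rule abs_Re_le_cmod)
      finally show ?case by (rule logker_mono)
    qed
  qed
  then show ?thesis using logpot_le_real order_trans by blast
qed

end

section \<open>Harmonic functions\<close>

lemma harmonic_on_add:
  assumes "f harmonic_on U" "g harmonic_on U"
  shows "(\<lambda>z. f z + g z) harmonic_on U"
proof -
  obtain fx fy fxx fxy fyx fyy where f: "open U" "continuous_on U fxx" "continuous_on U fxy"
    "continuous_on U fyx" "continuous_on U fyy"
    "\<And>z. z \<in> U \<Longrightarrow> (f has_derivative (\<lambda>v. fx z * Re v + fy z * Im v)) (at z)"
    "\<And>z. z \<in> U \<Longrightarrow> (fx has_derivative (\<lambda>v. fxx z * Re v + fxy z * Im v)) (at z)"
    "\<And>z. z \<in> U \<Longrightarrow> (fy has_derivative (\<lambda>v. fyx z * Re v + fyy z * Im v)) (at z)"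
    "\<And>z. z \<in> U \<Longrightarrow> fxx z + fyy z = 0"
    using assms(1) unfolding harmonic_on_def by blast
  obtain gx gy gxx gxy gyx gyy where g: "continuous_on U gxx" "continuous_on U gxy"
    "continuous_on U gyx" "continuous_on U gyy"
    "\<And>z. z \<in> U \<Longrightarrow> (g has_derivative (\<lambda>v. gx z * Re v + gy z * Im v)) (at z)"
    "\<And>z. z \<in> U \<Longrightarrow> (gx has_derivative (\<lambda>v. gxx z * Re v + gxy z * Im v)) (at z)"
    "\<And>z. z \<in> U \<Longrightarrow> (gy has_derivative (\<lambda>v. gyx z * Re v + gyy z * Im v)) (at z)"
    "\<And>z. z \<in> U \<Longrightarrow> gxx z + gyy z = 0"
    using assms(2) unfolding harmonic_on_def by blast
  have d: "((\<lambda>z. p z + q z) has_derivative (\<lambda>v. (a + c) * Re v + (b + d) * Im v)) (at z)"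
    if "(p has_derivative (\<lambda>v. a * Re v + b * Im v)) (at z)" "(q has_derivative (\<lambda>v. c * Re v + d * Im v)) (at z)"
    for p q :: "complex \<Rightarrow> real" and a b c d z
    using has_derivative_add[OF that] by (simp add: algebra_simps)
  show ?thesis
    unfolding harmonic_on_def
  proof (intro conjI exI ballI)
    fix z assume z: "z \<in> U"
    show "((\<lambda>z. f z + g z) has_derivative (\<lambda>v. (\<lambda>z. fx z + gx z) z * Re v + (\<lambda>z. fy z + gy z) z * Im v)) (at z)"
      using d[OF f(6)[OF z] g(5)[OF z]] by simp
    show "((\<lambda>z. fx z + gx z) has_derivative (\<lambda>v. (\<lambda>z. fxx z + gxx z) z * Re v + (\<lambda>z. fxy z + gxy z) z * Im v)) (at z)"
      using d[OF f(7)[OF z] g(6)[OF z]] by simp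
    show "((\<lambda>z. fy z + gy z) has_derivative (\<lambda>v. (\<lambda>z. fyx z + gyx z) z * Re v + (\<lambda>z. fyy z + gyy z) z * Im v)) (at z)"
      using d[OF f(8)[OF z] g(7)[OF z]] by simp
    show "(\<lambda>z. fxx z + gxx z) z + (\<lambda>z. fyy z + gyy z) z = 0"
      using f(9)[OF z] g(8)[OF z] by simp
  qed (use f(1-5) g(1-4) in \<open>auto intro: continuous_on_add\<close>)
qed

lemma harmonic_on_cmult:
  assumes "f harmonic_on U"
  shows "(\<lambda>z. c * f z) harmonic_on U"
proof -
  obtain fx fy fxx fxy fyx fyy where f: "open U" "continuous_on U fxx" "continuous_on U fxy"
    "continuous_on U fyx" "continuous_on U fyy"
    "\<And>z. z \<in> U \<Longrightarrow> (f has_derivative (\<lambda>v. fx z * Re v + fy z * Im v)) (at z)"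
    "\<And>z. z \<in> U \<Longrightarrow> (fx has_derivative (\<lambda>v. fxx z * Re v + fxy z * Im v)) (at z)"
    "\<And>z. z \<in> U \<Longrightarrow> (fy has_derivative (\<lambda>v. fyx z * Re v + fyy z * Im v)) (at z)"
    "\<And>z. z \<in> U \<Longrightarrow> fxx z + fyy z = 0"
    using assms unfolding harmonic_on_def by blast
  have d: "((\<lambda>z. c * p z) has_derivative (\<lambda>v. (c * a) * Re v + (c * b) * Im v)) (at z)"
    if "(p has_derivative (\<lambda>v. a * Re v + b * Im v)) (at z)" for p :: "complex \<Rightarrow> real" and a b z
    using has_derivative_mult_right[OF that, of c] by (simp add: algebra_simps)
  show ?thesis
    unfolding harmonic_on_def
  proof (intro conjI exI ballI)
    fix z assume z: "z \<in> U"
    show "((\<lambda>z. c * f z) has_derivative (\<lambda>v. (\<lambda>z. c * fx z) z * Re v + (\<lambda>z. c * fy z) z * Im v)) (at z)"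
      using d[OF f(6)[OF z]] by simp
    show "((\<lambda>z. c * fx z) has_derivative (\<lambda>v. (\<lambda>z. c * fxx z) z * Re v + (\<lambda>z. c * fxy z) z * Im v)) (at z)"
      using d[OF f(7)[OF z]] by simp
    show "((\<lambda>z. c * fy z) has_derivative (\<lambda>v. (\<lambda>z. c * fyx z) z * Re v + (\<lambda>z. c * fyy z) z * Im v)) (at z)"
      using d[OF f(8)[OF z]] by simp
    show "(\<lambda>z. c * fxx z) z + (\<lambda>z. c * fyy z) z = 0"
      using f(9)[OF z] by (metis distrib_left mult_zero_right)
  qed (use f(1-5) in \<open>auto intro!: continuous_intros\<close>)
qed

lemma harmonic_on_subset:
  assumes "f harmonic_on U" "open V" "V \<subseteq> U"
  shows "f harmonic_on V"
proof -
  obtain fx fy fxx fxy fyx fyy where "continuous_on U fxx" "continuous_on U fxy"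
    "continuous_on U fyx" "continuous_on U fyy"
    and "\<forall>z\<in>U. (f has_derivative (\<lambda>v. fx z * Re v + fy z * Im v)) (at z) \<and>
               (fx has_derivative (\<lambda>v. fxx z * Re v + fxy z * Im v)) (at z) \<and>
               (fy has_derivative (\<lambda>v. fyx z * Re v + fyy z * Im v)) (at z) \<and> fxx z + fyy z = 0"
    using assms(1) unfolding harmonic_on_def by blast
  moreover from this have "continuous_on V fxx" "continuous_on V fxy" "continuous_on V fyx" "continuous_on V fyy"
    using \<open>V \<subseteq> U\<close> continuous_on_subset by blast+
  ultimately show ?thesis
    using assms(2,3) unfolding harmonic_on_def by blast
qed

text \<open>Here f is h_x - i h_y, and its Cauchy-Riemann equations make the Laplacian of h vanish.
  This form suits ln |z - a| and its averages, whose harmonic conjugates are multivalued.\<close>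

lemma harmonic_on_holomorphic_gradient:
  assumes "open U" and hol: "f holomorphic_on U"
    and deriv: "\<And>z. z \<in> U \<Longrightarrow> (h has_derivative (\<lambda>v. Re (f z * v))) (at z)"
  shows "h harmonic_on U"
  unfolding harmonic_on_def
proof (intro conjI exI ballI)
  have hol': "deriv f holomorphic_on U" using hol \<open>open U\<close> by (rule holomorphic_deriv)
  then have cont: "continuous_on U (deriv f)" by (rule holomorphic_on_imp_continuous_on)
  show "continuous_on U (\<lambda>z. Re (deriv f z))" "continuous_on U (\<lambda>z. - Im (deriv f z))"
    "continuous_on U (\<lambda>z. - Im (deriv f z))" "continuous_on U (\<lambda>z. - Re (deriv f z))"
    by (intro continuous_intros cont)+
  fix z assume z: "z \<in> U"
  show "(h has_derivative (\<lambda>v. (\<lambda>z. Re (f z)) z * Re v + (\<lambda>z. - Im (f z)) z * Im v)) (at z)"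
    using deriv[OF z] by simp
  have f: "(f has_derivative (\<lambda>v. deriv f z * v)) (at z)"
    using holomorphic_derivI[OF hol \<open>open U\<close> z] by (simp add: has_field_derivative_def)
  show "((\<lambda>z. Re (f z)) has_derivative (\<lambda>v. (\<lambda>z. Re (deriv f z)) z * Re v + (\<lambda>z. - Im (deriv f z)) z * Im v)) (at z)"
    using has_derivative_Re[OF f] by simp
  show "((\<lambda>z. - Im (f z)) has_derivative (\<lambda>v. (\<lambda>z. - Im (deriv f z)) z * Re v + (\<lambda>z. - Re (deriv f z)) z * Im v)) (at z)"
    using has_derivative_minus[OF has_derivative_Im[OF f]] by (simp add: algebra_simps)
qed (use \<open>open U\<close> in auto)

lemma harmonic_on_imp_continuous_on:
  assumes "h harmonic_on U"
  shows "continuous_on U h"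
proof (rule continuous_at_imp_continuous_on, rule ballI)
  fix z assume "z \<in> U"
  obtain hx hy where "\<And>z. z \<in> U \<Longrightarrow> (h has_derivative (\<lambda>v. hx z * Re v + hy z * Im v)) (at z)"
    using assms unfolding harmonic_on_def by blast
  then show "isCont h z" using \<open>z \<in> U\<close> has_derivative_continuous by blast
qed

lemma second_deriv_nonneg_at_local_min:
  fixes f :: "real \<Rightarrow> real"
  assumes "0 < d" and f: "\<And>t. \<bar>t\<bar> < d \<Longrightarrow> (f has_real_derivative f' t) (at t)"
    and f': "(f' has_real_derivative D) (at 0)" and min: "\<And>t. \<bar>t\<bar> < d \<Longrightarrow> f 0 \<le> f t"
  shows "0 \<le> D"
proof (rule ccontr)
  assume "\<not> 0 \<le> D"
  then have "D < 0" by simp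
  have "f' 0 = 0"
    using f[of 0] assms(1) by (rule DERIV_local_min) (use assms(1) min in auto)
  obtain e where e: "0 < e" "\<And>h. 0 < h \<Longrightarrow> h < e \<Longrightarrow> f' h < f' 0"
    using DERIV_neg_dec_right[OF f' \<open>D < 0\<close>] by auto
  define t where "t = min d e / 2"
  have t: "0 < t" "t < d" "t < e" using assms(1) e(1) by (auto simp: t_def)
  obtain \<xi> where \<xi>: "0 < \<xi>" "\<xi> < t" "f t - f 0 = (t - 0) * f' \<xi>"
    using MVT2[of 0 t f f'] t f by auto
  have "f' \<xi> < 0" using e(2)[of \<xi>] \<xi> t \<open>f' 0 = 0\<close> by simp
  then have "t * f' \<xi> < 0" using t(1) by (simp add: mult_pos_neg)
  then have "f t < f 0" using \<xi>(3) by simp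
  then show False using min[of t] t by simp
qed

text \<open>The correction makes the Laplacian equal to -4 \<epsilon>, while at a local minimum both
  pure second derivatives would be nonnegative.\<close>

lemma harmonic_minus_square_no_local_min:
  assumes "h harmonic_on U" "z1 \<in> U" "0 < \<epsilon>" "0 < d"
    and min: "\<And>z. dist z z1 < d \<Longrightarrow> h z1 - \<epsilon> * (norm z1)\<^sup>2 \<le> h z - \<epsilon> * (norm z)\<^sup>2"
  shows False
proof -
  obtain hx hy hxx hxy hyx hyy where U: "open U" and
    h: "\<And>z. z \<in> U \<Longrightarrow> (h has_derivative (\<lambda>v. hx z * Re v + hy z * Im v)) (at z)"
    "\<And>z. z \<in> U \<Longrightarrow> (hx has_derivative (\<lambda>v. hxx z * Re v + hxy z * Im v)) (at z)"
    "\<And>z. z \<in> U \<Longrightarrow> (hy has_derivative (\<lambda>v. hyx z * Re v + hyy z * Im v)) (at z)"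
    "\<And>z. z \<in> U \<Longrightarrow> hxx z + hyy z = 0"
    using assms(1) unfolding harmonic_on_def by blast
  obtain d' where d': "0 < d'" "ball z1 d' \<subseteq> U" using U \<open>z1 \<in> U\<close> by (auto simp: open_contains_ball)
  define \<rho> where "\<rho> = min d d'"
  have \<rho>: "0 < \<rho>" using \<open>0 < d\<close> d' by (simp add: \<rho>_def)
  have line: "((\<lambda>t. z1 + of_real t * e) has_derivative (\<lambda>s. of_real s * e)) (at t)" for e and t :: real
    by (auto intro!: derivative_eq_intros)
  have along: "((\<lambda>t. p (z1 + of_real t * e)) has_real_derivative (a * Re e + b * Im e)) (at t)"
    if "(p has_derivative (\<lambda>v. a * Re v + b * Im v)) (at (z1 + of_real t * e))" for p a b e and t :: real
  proof -
    have "((\<lambda>t. p (z1 + of_real t * e)) has_derivative (\<lambda>s. a * Re (of_real s * e) + b * Im (of_real s * e))) (at t)"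
      using has_derivative_compose[OF line that] by simp
    then show ?thesis
      unfolding has_field_derivative_def by (rule has_derivative_eq_rhs) (auto simp: algebra_simps)
  qed
  have in_U: "z1 + of_real t * e \<in> U" if "\<bar>t\<bar> < \<rho>" "norm e = 1" for t :: real and e
    using that d'(2) by (auto simp: \<rho>_def subset_iff dist_norm norm_mult)
  have "0 \<le> hxx z1 - 2 * \<epsilon>"
  proof (rule second_deriv_nonneg_at_local_min[OF \<rho>])
    fix t :: real assume t: "\<bar>t\<bar> < \<rho>"
    have "((\<lambda>t. h (z1 + of_real t * 1)) has_real_derivative hx (z1 + of_real t * 1) * Re 1 + hy (z1 + of_real t * 1) * Im 1) (at t)"
      using in_U[OF t, of 1] by (intro along h) auto
    then show "((\<lambda>t. h (z1 + of_real t) - \<epsilon> * ((Re z1 + t)\<^sup>2 + (Im z1)\<^sup>2)) has_real_derivative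
        hx (z1 + of_real t) - \<epsilon> * (2 * (Re z1 + t))) (at t)"
      by (auto intro!: derivative_eq_intros)
    have "dist (z1 + of_real t) z1 < d" using t by (simp add: \<rho>_def dist_norm)
    from min[OF this] show "h (z1 + of_real 0) - \<epsilon> * ((Re z1 + 0)\<^sup>2 + (Im z1)\<^sup>2) \<le> h (z1 + of_real t) - \<epsilon> * ((Re z1 + t)\<^sup>2 + (Im z1)\<^sup>2)"
      by (simp add: cmod_power2)
  next
    have "((\<lambda>t. hx (z1 + of_real t * 1)) has_real_derivative hxx z1 * Re 1 + hxy z1 * Im 1) (at 0)"
      using h(2)[OF \<open>z1 \<in> U\<close>] by (intro along) auto
    then show "((\<lambda>t. hx (z1 + of_real t) - \<epsilon> * (2 * (Re z1 + t))) has_real_derivative hxx z1 - 2 * \<epsilon>) (at 0)"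
      by (auto intro!: derivative_eq_intros)
  qed
  moreover have "0 \<le> hyy z1 - 2 * \<epsilon>"
  proof (rule second_deriv_nonneg_at_local_min[OF \<rho>])
    fix t :: real assume t: "\<bar>t\<bar> < \<rho>"
    have "((\<lambda>t. h (z1 + of_real t * \<i>)) has_real_derivative hx (z1 + of_real t * \<i>) * Re \<i> + hy (z1 + of_real t * \<i>) * Im \<i>) (at t)"
      using in_U[OF t, of \<i>] by (intro along h) auto
    then show "((\<lambda>t. h (z1 + of_real t * \<i>) - \<epsilon> * ((Re z1)\<^sup>2 + (Im z1 + t)\<^sup>2)) has_real_derivative
        hy (z1 + of_real t * \<i>) - \<epsilon> * (2 * (Im z1 + t))) (at t)"
      by (auto intro!: derivative_eq_intros)
    have "dist (z1 + of_real t * \<i>) z1 < d" using t by (simp add: \<rho>_def dist_norm norm_mult)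
    from min[OF this] show "h (z1 + of_real 0 * \<i>) - \<epsilon> * ((Re z1)\<^sup>2 + (Im z1 + 0)\<^sup>2) \<le> h (z1 + of_real t * \<i>) - \<epsilon> * ((Re z1)\<^sup>2 + (Im z1 + t)\<^sup>2)"
      by (simp add: cmod_power2)
  next
    have "((\<lambda>t. hy (z1 + of_real t * \<i>)) has_real_derivative hyx z1 * Re \<i> + hyy z1 * Im \<i>) (at 0)"
      using h(3)[OF \<open>z1 \<in> U\<close>] by (intro along) auto
    then show "((\<lambda>t. hy (z1 + of_real t * \<i>) - \<epsilon> * (2 * (Im z1 + t))) has_real_derivative hyy z1 - 2 * \<epsilon>) (at 0)"
      by (auto intro!: derivative_eq_intros)
  qed
  ultimately show False using h(4)[OF \<open>z1 \<in> U\<close>] \<open>0 < \<epsilon>\<close> by simp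
qed

text \<open>The boundary condition is a bound on the lower limit only, so g may be discontinuous at
  the boundary. It keeps the sublevel set \<open>S\<close> away from the frontier, which makes
  \<open>S\<close> compact.\<close>

lemma harmonic_minimum_principle:
  assumes h: "h harmonic_on U" and "bounded U"
    and boundary: "\<And>\<zeta> \<kappa>. \<zeta> \<in> frontier U \<Longrightarrow> 0 < \<kappa> \<Longrightarrow> \<forall>\<^sub>F z in at \<zeta> within U. m - \<kappa> < h z"
    and "z0 \<in> U"
  shows "m \<le> h z0"
proof (rule ccontr)
  assume "\<not> m \<le> h z0"
  \<comment> \<open>A third of the deficit separates \<open>S\<close> from the boundary, a third
    absorbs the quadratic perturbation, and the last puts the minimizer strictly inside the sublevel
    set.\<close>
  define \<kappa> where "\<kappa> = (m - h z0) / 3"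
  have "3 * \<kappa> = m - h z0" by (simp add: \<kappa>_def)
  then have \<kappa>: "0 < \<kappa>" "h z0 = m - 3 * \<kappa>" using \<open>\<not> m \<le> h z0\<close> by linarith+
  have U: "open U" using h by (simp add: harmonic_on_def)
  have cont: "continuous_on U h" using h by (rule harmonic_on_imp_continuous_on)
  define S where "S = {z \<in> U. h z \<le> m - \<kappa>}"
  have "z0 \<in> S" using \<open>z0 \<in> U\<close> \<kappa> by (simp add: S_def)
  have "closed S"
    unfolding closed_sequential_limits
  proof (intro allI impI, elim conjE)
    fix u z assume u: "\<forall>n. u n \<in> S" and lim: "u \<longlonglongrightarrow> z"
    have uU: "u n \<in> U" and uh: "h (u n) \<le> m - \<kappa>" for n using u by (auto simp: S_def)
    show "z \<in> S"
    proof (cases "z \<in> U")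
      case True
      have "(\<lambda>n. h (u n)) \<longlonglongrightarrow> h z"
        by (rule continuous_on_tendsto_compose[OF cont lim True]) (use uU in auto)
      then have "h z \<le> m - \<kappa>" by (rule LIMSEQ_le_const2) (use uh in auto)
      then show ?thesis using True by (simp add: S_def)
    next
      case False
      have "z \<in> closure U" using uU lim by (auto simp: closure_sequential)
      then have "z \<in> frontier U" using False U by (simp add: frontier_def interior_open)
      moreover have "filterlim u (at z within U) sequentially"
        using lim uU False by (auto simp: filterlim_at intro!: always_eventually)
      ultimately have "\<forall>\<^sub>F n in sequentially. m - \<kappa> < h (u n)"
        using boundary[of z \<kappa>] \<kappa>(1) by (auto dest: eventually_compose_filterlim)
      then obtain n where "m - \<kappa> < h (u n)" by (auto simp: eventually_sequentially)
      then show ?thesis using uh[of n] by simp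
    qed
  qed
  moreover have "bounded S" using \<open>bounded U\<close> by (rule bounded_subset) (auto simp: S_def)
  ultimately have "compact S" by (simp add: compact_eq_bounded_closed)
  obtain B where B: "0 < B" "\<And>z. z \<in> S \<Longrightarrow> norm z \<le> B"
    using \<open>bounded S\<close> by (meson bounded_pos)
  define \<epsilon> where "\<epsilon> = \<kappa> / B\<^sup>2"
  have \<epsilon>: "0 < \<epsilon>" using \<kappa> B by (simp add: \<epsilon>_def)
  have small: "\<epsilon> * (norm z)\<^sup>2 \<le> \<kappa>" if "z \<in> S" for z
  proof -
    have "(norm z)\<^sup>2 \<le> B\<^sup>2" using B(2)[OF that] by (intro power_mono) auto
    then have "\<epsilon> * (norm z)\<^sup>2 \<le> \<epsilon> * B\<^sup>2" using \<epsilon> by (intro mult_left_mono) auto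
    then show ?thesis using B by (simp add: \<epsilon>_def)
  qed
  have "continuous_on S (\<lambda>z. h z - \<epsilon> * (norm z)\<^sup>2)"
    by (intro continuous_intros continuous_on_subset[OF cont]) (auto simp: S_def)
  then obtain z1 where z1: "z1 \<in> S" "\<And>z. z \<in> S \<Longrightarrow> h z1 - \<epsilon> * (norm z1)\<^sup>2 \<le> h z - \<epsilon> * (norm z)\<^sup>2"
    using continuous_attains_inf[OF \<open>compact S\<close>] \<open>z0 \<in> S\<close> by blast
  have "h z1 \<le> h z0 + \<epsilon> * (norm z1)\<^sup>2"
    using z1(2)[OF \<open>z0 \<in> S\<close>] \<epsilon> by (smt (verit) mult_nonneg_nonneg zero_le_power2)
  also have "\<dots> < m - \<kappa>" using small[OF z1(1)] \<kappa> by simp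
  finally have less: "h z1 < m - \<kappa>" .
  have "z1 \<in> U" using z1 by (simp add: S_def)
  have "open (U \<inter> h -` {..<m - \<kappa>})"
    by (intro continuous_open_preimage cont U open_lessThan)
  moreover have "z1 \<in> U \<inter> h -` {..<m - \<kappa>}" using \<open>z1 \<in> U\<close> less by simp
  ultimately obtain d where d: "0 < d" "ball z1 d \<subseteq> U \<inter> h -` {..<m - \<kappa>}"
    by (rule openE)
  show False
  proof (rule harmonic_minus_square_no_local_min[OF h \<open>z1 \<in> U\<close> \<epsilon> d(1)])
    fix z assume "dist z z1 < d"
    then have "z \<in> U \<inter> h -` {..<m - \<kappa>}" using d(2) by (auto simp: dist_commute)
    then have "z \<in> S" by (auto simp: S_def)
    then show "h z1 - \<epsilon> * (norm z1)\<^sup>2 \<le> h z - \<epsilon> * (norm z)\<^sup>2" by (rule z1(2))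
  qed
qed

section \<open>Positivity of the Green function\<close>

text \<open>A vertical ray pointing away from the real axis leaves every bounded set without meeting
  \<open>E\<close>.\<close>

lemma outside_compact_real:
  assumes "compact E" "E \<subseteq> range complex_of_real"
  shows "outside E = - E"
proof
  show "outside E \<subseteq> - E" by (auto simp: outside_def)
  show "- E \<subseteq> outside E"
  proof
    fix z assume "z \<in> - E"
    define d :: complex where "d = (if 0 \<le> Im z then \<i> else - \<i>)"
    let ?ray = "(\<lambda>t. z + of_real t * d) ` {0..}"
    have "connected ?ray"
      by (intro connected_continuous_image continuous_intros) auto
    moreover have "?ray \<subseteq> - E"
    proof
      fix w assume "w \<in> ?ray"
      then obtain t where t: "0 \<le> t" "w = z + of_real t * d" by auto
      show "w \<in> - E"
      proof (cases "t = 0")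
        case False
        then have "Im w \<noteq> 0" using t by (auto simp: d_def)
        then show ?thesis using assms(2) by auto
      qed (use t \<open>z \<in> - E\<close> in auto)
    qed
    moreover have "z \<in> ?ray" by (auto intro!: image_eqI[of _ _ 0])
    ultimately have sub: "?ray \<subseteq> connected_component_set (- E) z"
      by (intro connected_component_maximal)
    have "\<not> bounded ?ray"
    proof
      assume "bounded ?ray"
      then obtain B where B: "\<And>w. w \<in> ?ray \<Longrightarrow> norm w \<le> B" by (auto simp: bounded_iff)
      let ?t = "\<bar>B\<bar> + norm z + 1"
      have "norm (z + of_real ?t * d) \<le> B"
        by (rule B, rule image_eqI[of _ _ ?t]) auto
      moreover have "norm (of_real ?t * d) \<le> norm (z + of_real ?t * d) + norm z"
        by (metis add_diff_cancel_left' norm_triangle_ineq4)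
      moreover have "norm (of_real ?t * d) = ?t" by (simp add: norm_mult d_def del: of_real_add)
      ultimately show False by linarith
    qed
    then have "\<not> bounded (connected_component_set (- E) z)" using sub bounded_subset by blast
    then show "z \<in> outside E" using \<open>z \<in> - E\<close> by (simp add: outside_def)
  qed
qed

section \<open>Sets of capacity zero and their barriers\<close>

lemma sum_offdiagonal_step:
  fixes f :: "nat \<Rightarrow> nat \<Rightarrow> 'a::comm_semiring_1"
  assumes "\<And>j k. f j k = f k j"
  shows "(\<Sum>j=1..Suc n. \<Sum>k\<in>{1..Suc n} - {j}. f j k) =
    (\<Sum>j=1..n. \<Sum>k\<in>{1..n} - {j}. f j k) + 2 * (\<Sum>j=1..n. f j (Suc n))"
proof -
  have "(\<Sum>k\<in>{1..Suc n} - {j}. f j k) = (\<Sum>k\<in>{1..n} - {j}. f j k) + f j (Suc n)" if "j \<in> {1..n}" for j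
  proof -
    have "{1..Suc n} - {j} = insert (Suc n) ({1..n} - {j})" using that by auto
    then show ?thesis by (simp add: add.commute)
  qed
  moreover have "{1..Suc n} - {Suc n} = {1..n}" by auto
  ultimately show ?thesis
    using assms by (simp add: sum.distrib mult_2 add_ac)
qed

text \<open>The points are chosen greedily, each maximizing the product of the distances to its predecessors;
  if all these maxima were large, their counting measures would have a limit of finite energy.\<close>

lemma capacity_zero_small_monic:
  fixes K :: "complex set"
  assumes K: "compact K" "K \<subseteq> range complex_of_real" "K \<noteq> {}" and cap: "log_capacity K = 0"
  shows "\<exists>n\<ge>1. \<exists>x :: nat \<Rightarrow> complex. (\<forall>j<n. x j \<in> K) \<and> (\<forall>z\<in>K. (\<Prod>j<n. norm (z - x j)) < exp (- (real n * L)))"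
proof (rule ccontr)
  assume not: "\<not> ?thesis"
  define T where "T = Re ` K"
  have KT: "K = of_real ` T" using K(2) by (force simp: T_def)
  have T: "compact T" "T \<noteq> {}"
    using K by (auto simp: T_def intro!: compact_continuous_image continuous_intros)
  define P where "P f n t \<longleftrightarrow> t \<in> T \<and> (\<forall>s\<in>T. (\<Prod>j<n. \<bar>s - f j\<bar>) \<le> (\<Prod>j<n. \<bar>t - f j\<bar>))"
    for f :: "nat \<Rightarrow> real" and n :: nat and t :: real
  have "\<exists>x. \<forall>n. P x n (x n)"
  proof (rule dependent_wf_choice[OF wf_less_than])
    show "P f n t = P g n t" if "\<And>m. (m, n) \<in> less_than \<Longrightarrow> f m = g m"
      for f g :: "nat \<Rightarrow> real" and n t
    proof -
      have "(\<Prod>j<n. \<bar>s - f j\<bar>) = (\<Prod>j<n. \<bar>s - g j\<bar>)" for s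
        using that by (intro prod.cong) auto
      then show ?thesis by (simp add: P_def)
    qed
    fix n and f :: "nat \<Rightarrow> real"
    have "continuous_on T (\<lambda>t. \<Prod>j<n. \<bar>t - f j\<bar>)" by (intro continuous_intros)
    from continuous_attains_sup[OF T this] show "\<exists>t. P f n t" unfolding P_def by blast
  qed
  then obtain x where "\<forall>n. P x n (x n)" ..
  then have x: "x n \<in> T" "s \<in> T \<Longrightarrow> (\<Prod>j<n. \<bar>s - x j\<bar>) \<le> (\<Prod>j<n. \<bar>x n - x j\<bar>)" for n s
    by (simp_all add: P_def)
  \<comment> \<open>By the negated claim, the product of distances to the first n points is not
    small on all of \<open>K\<close>; its maximum is attained at the greedy point
    \<open>x n\<close>.\<close>
  have large: "exp (- (real n * L)) \<le> (\<Prod>j<n. \<bar>x n - x j\<bar>)" for n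
  proof (cases "n = 0")
    case False
    have "\<not> (\<forall>z\<in>K. (\<Prod>j<n. norm (z - of_real (x j))) < exp (- (real n * L)))"
    proof
      assume small: "\<forall>z\<in>K. (\<Prod>j<n. norm (z - of_real (x j))) < exp (- (real n * L))"
      have "\<forall>j<n. complex_of_real (x j) \<in> K" using x(1) KT by simp
      with small have "\<exists>x :: nat \<Rightarrow> complex. (\<forall>j<n. x j \<in> K) \<and> (\<forall>z\<in>K. (\<Prod>j<n. norm (z - x j)) < exp (- (real n * L)))"
        by (intro exI[of _ "\<lambda>j. complex_of_real (x j)"] conjI)
      moreover have "1 \<le> n" using False by simp
      ultimately show False using not by blast
    qed
    then obtain z where z: "z \<in> K" "exp (- (real n * L)) \<le> (\<Prod>j<n. norm (z - of_real (x j)))"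
      unfolding not_less[symmetric] by blast
    then obtain s where s: "s \<in> T" "z = of_real s" using KT by blast
    have "norm (z - of_real (x j)) = \<bar>s - x j\<bar>" for j
      unfolding s by (simp only: of_real_diff[symmetric] norm_of_real)
    then show ?thesis using z(2) x(2)[OF s(1), of n] by simp
  qed simp
  have ne: "x n \<noteq> x j" if "j < n" for j n
  proof
    assume "x n = x j"
    then have "(\<Prod>j<n. \<bar>x n - x j\<bar>) = 0" using that by (intro prod_zero) auto
    then show False using large[of n] by (metis exp_gt_zero not_le)
  qed
  obtain D where D: "\<And>s. s \<in> T \<Longrightarrow> \<bar>s\<bar> \<le> D"
    using compact_imp_bounded[OF T(1)] by (auto simp: bounded_iff)
  define C where "C = ln (2 * \<bar>D\<bar> + 1)"
  have C: "0 \<le> C" "exp C = 2 * \<bar>D\<bar> + 1" by (auto simp: C_def)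
  have diam: "dist z w \<le> exp C" if zw: "z \<in> K" "w \<in> K" for z w
  proof -
    obtain s t where st: "s \<in> T" "t \<in> T" "z = of_real s" "w = of_real t" using zw KT by blast
    have "dist z w = \<bar>s - t\<bar>" unfolding st by (simp add: dist_real_def)
    then show ?thesis using D[OF st(1)] D[OF st(2)] C by linarith
  qed
  define y where "y k = x (k - 1)" for k :: nat
  \<comment> \<open>Taking logarithms in \<open>large\<close> bounds each new row of the kernel
    matrix linearly in n, so the off-diagonal energy of n points is O(n^2).\<close>
  have row: "(\<Sum>j=1..n. logker C (of_real (y j)) (of_real (y (Suc n)))) \<le> ennreal (real n * (C + \<bar>L\<bar>))" for n
  proof -
    have "(\<Sum>j=1..n. logker C (of_real (y j)) (of_real (y (Suc n)))) = (\<Sum>j<n. logker C (of_real (x j)) (of_real (x n)))"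
      by (rule sum.reindex_bij_witness[where i = Suc and j = "\<lambda>j. j - 1"]) (auto simp: y_def)
    also have "\<dots> = (\<Sum>j<n. ennreal (C - ln \<bar>x n - x j\<bar>))"
      using ne[THEN not_sym] by (intro sum.cong refl) (auto simp: logker_def dist_real_def abs_minus_commute)
    also have "\<dots> = ennreal (\<Sum>j<n. C - ln \<bar>x n - x j\<bar>)"
    proof (rule sum_ennreal)
      fix j assume "j \<in> {..<n}"
      have "\<bar>x n - x j\<bar> \<le> exp C" using D[OF x(1), of n] D[OF x(1), of j] C by linarith
      then have "ln \<bar>x n - x j\<bar> \<le> ln (exp C)"
        using ne[of j n] \<open>j \<in> {..<n}\<close> by (subst ln_le_cancel_iff) auto
      then show "0 \<le> C - ln \<bar>x n - x j\<bar>" by simp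
    qed
    also have "(\<Sum>j<n. C - ln \<bar>x n - x j\<bar>) = real n * C - ln (\<Prod>j<n. \<bar>x n - x j\<bar>)"
      using ne by (subst ln_prod) (auto simp: sum_subtractf)
    also have "ln (exp (- (real n * L))) \<le> ln (\<Prod>j<n. \<bar>x n - x j\<bar>)"
      using large[of n] by (subst ln_le_cancel_iff) (auto intro: less_le_trans[OF exp_gt_zero])
    then have "real n * C - ln (\<Prod>j<n. \<bar>x n - x j\<bar>) \<le> real n * C + real n * L" by simp
    also have "\<dots> \<le> real n * (C + \<bar>L\<bar>)" by (simp add: distrib_left mult_left_mono)
    finally show ?thesis by (simp add: ennreal_leI)
  qed
  let ?S = "\<lambda>n. \<Sum>j=1..n. \<Sum>k\<in>{1..n} - {j}. logker C (of_real (y j)) (of_real (y k))"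
  have energy: "?S n \<le> ennreal ((C + \<bar>L\<bar>) * real n ^ 2)" for n
  proof (induction n)
    case (Suc n)
    have "?S (Suc n) = ?S n + 2 * (\<Sum>j=1..n. logker C (of_real (y j)) (of_real (y (Suc n))))"
      by (rule sum_offdiagonal_step) (rule logker_commute)
    also have "\<dots> \<le> ennreal ((C + \<bar>L\<bar>) * real n ^ 2) + 2 * ennreal (real n * (C + \<bar>L\<bar>))"
      by (intro add_mono Suc mult_left_mono row) auto
    also have "\<dots> = ennreal ((C + \<bar>L\<bar>) * real n ^ 2 + 2 * (real n * (C + \<bar>L\<bar>)))"
      using C(1) by (simp add: ennreal_mult)
    also have "\<dots> \<le> ennreal ((C + \<bar>L\<bar>) * real (Suc n) ^ 2)"
      using C(1) by (intro ennreal_leI) (simp add: power2_eq_square algebra_simps)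
    finally show ?case .
  qed simp
  have yT: "y k \<in> T" for k using x(1) by (simp add: y_def)
  have AE_T: "AE t in counting_distr (Suc i) y. t \<in> T" for i
    unfolding counting_distr_def using yT T(1)
    by (subst AE_distr_iff) (auto simp: borel_closed compact_imp_closed)
  have tight: "tight (\<lambda>i. counting_distr (Suc i) y)"
  proof (rule tight_AE_bounded)
    show "real_distribution (counting_distr (Suc i) y)" for i by (rule real_distribution_counting_distr)
    show "AE t in counting_distr (Suc i) y. \<bar>t\<bar> \<le> D" for i
      using AE_T[of i] by eventually_elim (rule D)
  qed
  have "1 \<le> Suc i" "0 \<le> C + \<bar>L\<bar>" for i using C(1) by auto
  note discrete_energy_limit[OF filterlim_Suc this(1) tight energy tendsto_const this(2)]
  then obtain s \<Omega> Y_seq Y where lim: "prob_space (\<Omega> :: real measure)" "\<And>i. Y_seq i \<in> borel_measurable \<Omega>"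
      "\<And>i. distr \<Omega> borel (Y_seq i) = counting_distr (Suc (s i)) y" "Y \<in> borel_measurable \<Omega>"
      "\<And>x. x \<in> space \<Omega> \<Longrightarrow> (\<lambda>n. Y_seq n x) \<longlonglongrightarrow> Y x"
      "shifted_energy C (distr \<Omega> borel (\<lambda>x. complex_of_real (Y x))) \<le> ennreal (C + \<bar>L\<bar>)"
    by blast
  interpret prob_space \<Omega> by fact
  note [measurable] = lim(4)
  have "AE \<omega> in \<Omega>. Y \<omega> \<in> T"
  proof (rule AE_limit_in_closed[OF lim(1,2,4,5)])
    show "AE t in distr \<Omega> borel (Y_seq i). t \<in> T" for i
      unfolding lim(3) by (rule AE_T)
  qed (use T(1) in \<open>auto simp: compact_imp_closed\<close>)
  then have "AE \<omega> in \<Omega>. complex_of_real (Y \<omega>) \<in> K" by eventually_elim (simp add: KT)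
  then have "distr \<Omega> borel (\<lambda>x. complex_of_real (Y x)) \<in> prob_measures_on K"
    unfolding prob_measures_on_compact_iff[OF K(1)]
    using K(1) by (auto intro!: prob_space_distr simp: AE_distr_iff borel_closed compact_imp_closed)
  then have "shifted_energy C (distr \<Omega> borel (\<lambda>x. complex_of_real (Y x))) = \<infinity>"
    using cap log_capacity_eq_0_iff[of K C] diam C(1) by blast
  then show False using lim(6) by (simp add: top_unique)
qed

lemma log_capacity_mono:
  assumes "A \<subseteq> B"
  shows "log_capacity A \<le> log_capacity B"
proof -
  have "prob_measures_on A \<subseteq> prob_measures_on B"
    using assms unfolding prob_measures_on_def by blast
  then show ?thesis
    unfolding log_capacity_def by (rule SUP_subset_mono) (rule order_refl)
qed

lemma has_derivative_ln_norm:
  fixes z a :: complex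
  assumes "z \<noteq> a"
  shows "((\<lambda>z. ln (norm (z - a))) has_derivative (\<lambda>v. Re (1 / (z - a) * v))) (at z)"
proof -
  have "((\<lambda>z. norm (z - a)) has_derivative (\<lambda>v. inner v (sgn (z - a)))) (at z)"
  proof -
    have "((\<lambda>z. z - a) has_derivative (\<lambda>v. v)) (at z)" by (auto intro!: derivative_eq_intros)
    moreover have "(norm has_derivative (\<lambda>v. inner v (sgn (z - a)))) (at (z - a))"
      using GDERIV_norm[of "z - a"] assms by (simp add: gderiv_def)
    ultimately show ?thesis by (rule has_derivative_compose)
  qed
  then have "((\<lambda>z. ln (norm (z - a))) has_derivative (\<lambda>v. inner v (sgn (z - a)) * inverse (norm (z - a)))) (at z)"
    using assms by (intro has_derivative_ln) (auto simp: mult.commute)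
  moreover have "inner v (sgn (z - a)) * inverse (norm (z - a)) = Re (1 / (z - a) * v)" for v
  proof -
    have "1 / (z - a) = cnj (z - a) / of_real ((norm (z - a))\<^sup>2)"
      using complex_div_cnj[of 1 "z - a"] by simp
    then have "1 / (z - a) * v = cnj (z - a) * v / of_real ((norm (z - a))\<^sup>2)" by simp
    then have "Re (1 / (z - a) * v) = Re (cnj (z - a) * v) / (norm (z - a))\<^sup>2"
      by (simp only: Re_divide_of_real)
    moreover have "Re (cnj (z - a) * v) = inner v (z - a)" by (simp add: inner_complex_def algebra_simps)
    ultimately show ?thesis
      by (simp add: sgn_div_norm power2_eq_square divide_inverse mult_ac)
  qed
  ultimately show ?thesis by simp
qed

lemma harmonic_on_ln_norm:
  assumes "open U" "a \<notin> U"
  shows "(\<lambda>z. c * ln (norm (z - a))) harmonic_on U"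
proof (rule harmonic_on_holomorphic_gradient[where f = "\<lambda>z. of_real c * (1 / (z - a))"])
  show "(\<lambda>z. of_real c * (1 / (z - a))) holomorphic_on U"
    using assms by (intro holomorphic_intros) auto
  fix z assume "z \<in> U"
  then have "z \<noteq> a" using assms by auto
  have Re: "Re (of_real c * u) = c * Re u" for u by simp
  from has_derivative_mult_right[OF has_derivative_ln_norm[OF \<open>z \<noteq> a\<close>], of c]
  show "((\<lambda>z. c * ln (norm (z - a))) has_derivative (\<lambda>v. Re (of_real c * (1 / (z - a)) * v))) (at z)"
    by (simp only: mult.assoc Re)
qed fact

lemma harmonic_on_sum_ln_norm:
  fixes x :: "nat \<Rightarrow> complex"
  assumes "open U" "\<And>j. j < n \<Longrightarrow> x j \<notin> U"
  shows "(\<lambda>z. \<Sum>j<n. c * ln (norm (z - x j))) harmonic_on U"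
  using assms(2)
proof (induction n)
  case 0
  show ?case
    by (rule harmonic_on_holomorphic_gradient[OF assms(1), where f = "\<lambda>_. 0"]) auto
next
  case (Suc n)
  then have "(\<lambda>z. (\<Sum>j<n. c * ln (norm (z - x j))) + c * ln (norm (z - x n))) harmonic_on U"
    by (intro harmonic_on_add harmonic_on_ln_norm assms(1)) auto
  then show ?case by simp
qed

text \<open>The barrier is minus the logarithm of the n-th root of |p|, where p is monic with all n
  zeros on \<open>K\<close> and very small on \<open>K\<close>. Its height L near \<open>K\<close>
  is arbitrary, whereas the lower bound on U and the upper bound at \<open>z0\<close> involve only
  distances and not L; a small multiple is thus large near \<open>K\<close> and negligible at
  \<open>z0\<close>.\<close>

lemma capacity_zero_barrier:
  assumes K: "compact K" "K \<subseteq> range complex_of_real" "log_capacity K = 0"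
    and U: "open U" "U \<inter> K = {}" "U \<union> K \<subseteq> cball c R" "0 < R"
    and z0: "z0 \<in> U" "ball z0 \<delta> \<inter> K = {}" "0 < \<delta>"
  shows "\<exists>w. w harmonic_on U \<and> (\<forall>z\<in>U. - \<bar>ln (2 * R)\<bar> \<le> w z) \<and> w z0 \<le> \<bar>ln \<delta>\<bar> \<and>
     (\<forall>\<zeta>\<in>K. \<forall>\<^sub>F z in at \<zeta> within U. L \<le> w z)"
proof (cases "K = {}")
  case True
  have "(\<lambda>_. 0) harmonic_on U"
    by (rule harmonic_on_holomorphic_gradient[OF U(1), where f = "\<lambda>_. 0"]) auto
  then show ?thesis using True by (intro exI[of _ "\<lambda>_. 0"]) auto
next
  case False
  obtain n x where n: "1 \<le> n" and x: "\<And>j. j < n \<Longrightarrow> x j \<in> K"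
    and small: "\<And>z. z \<in> K \<Longrightarrow> (\<Prod>j<n. norm (z - x j)) < exp (- (real n * L))"
    using capacity_zero_small_monic[OF K(1,2) False K(3), of L] by blast
  define w where "w z = (\<Sum>j<n. (- 1 / real n) * ln (norm (z - x j)))" for z
  have xU: "x j \<notin> U" if "j < n" for j using x[OF that] U(2) by auto
  have pos: "0 < norm (z - x j)" if "z \<in> U" "j < n" for z j using xU that by auto
  have w_eq: "w z = (- 1 / real n) * (\<Sum>j<n. ln (norm (z - x j)))" for z
    unfolding w_def sum_distrib_left ..
  have upper: "w z \<le> b" if "\<And>j. j < n \<Longrightarrow> - b \<le> ln (norm (z - x j))" for z b
  proof -
    have "(\<Sum>j<n. - b) \<le> (\<Sum>j<n. ln (norm (z - x j)))" using that by (intro sum_mono) auto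
    then show ?thesis using n by (simp add: w_eq field_simps)
  qed
  have lower: "b \<le> w z" if "(\<Sum>j<n. ln (norm (z - x j))) \<le> real n * - b" for z b
    using that n by (simp add: w_eq field_simps)
  show ?thesis
  proof (intro exI[of _ w] conjI ballI)
    show "w harmonic_on U"
      unfolding w_def[abs_def] using U(1) xU by (rule harmonic_on_sum_ln_norm)
  next
    fix z assume z: "z \<in> U"
    have "(\<Sum>j<n. ln (norm (z - x j))) \<le> (\<Sum>j<n. \<bar>ln (2 * R)\<bar>)"
    proof (rule sum_mono)
      fix j assume "j \<in> {..<n}"
      then have j: "j < n" by simp
      have "z \<in> cball c R" "x j \<in> cball c R" using z x[OF j] U(3) by auto
      then have "norm (z - x j) \<le> 2 * R"
        using dist_triangle2[of z "x j" c] by (simp add: dist_norm norm_minus_commute)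
      then have "ln (norm (z - x j)) \<le> ln (2 * R)"
        using pos[OF z j] U(4) by (subst ln_le_cancel_iff) auto
      then show "ln (norm (z - x j)) \<le> \<bar>ln (2 * R)\<bar>" by simp
    qed
    then show "- \<bar>ln (2 * R)\<bar> \<le> w z" by (intro lower) simp
  next
    show "w z0 \<le> \<bar>ln \<delta>\<bar>"
    proof (rule upper)
      fix j assume j: "j < n"
      have "x j \<notin> ball z0 \<delta>" using z0(2) x[OF j] by blast
      then have "\<delta> \<le> norm (z0 - x j)" by (simp add: dist_norm)
      then have "ln \<delta> \<le> ln (norm (z0 - x j))" using z0(3) by (subst ln_le_cancel_iff) auto
      then show "- \<bar>ln \<delta>\<bar> \<le> ln (norm (z0 - x j))" by simp
    qed
  next
    fix \<zeta> assume \<zeta>: "\<zeta> \<in> K"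
    have "((\<lambda>z. \<Prod>j<n. norm (z - x j)) \<longlongrightarrow> (\<Prod>j<n. norm (\<zeta> - x j))) (at \<zeta> within U)"
      by (intro tendsto_intros)
    then have "\<forall>\<^sub>F z in at \<zeta> within U. (\<Prod>j<n. norm (z - x j)) < exp (- (real n * L))"
      using small[OF \<zeta>] by (rule order_tendstoD)
    moreover have "\<forall>\<^sub>F z in at \<zeta> within U. z \<in> U" by (simp add: eventually_at_filter)
    ultimately show "\<forall>\<^sub>F z in at \<zeta> within U. L \<le> w z"
    proof eventually_elim
      case (elim z)
      have "(\<Sum>j<n. ln (norm (z - x j))) = ln (\<Prod>j<n. norm (z - x j))"
        using pos[OF elim(2)] by (subst ln_prod) auto
      also have "\<dots> \<le> ln (exp (- (real n * L)))"
      proof (subst ln_le_cancel_iff)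
        show "0 < (\<Prod>j<n. norm (z - x j))" by (intro prod_pos) (use pos[OF elim(2)] in simp)
      qed (use elim(1) in simp_all)
      finally show ?case by (intro lower) simp
    qed
  qed
qed

lemma frontier_ball_diff_subset:
  fixes E :: "complex set"
  assumes "closed E"
  shows "frontier (ball c R - E) \<subseteq> E \<union> sphere c R"
proof
  fix \<zeta> assume \<zeta>: "\<zeta> \<in> frontier (ball c R - E)"
  have op: "open (ball c R - E)" using assms by (intro open_Diff) auto
  have "\<zeta> \<in> closure (ball c R - E)" "\<zeta> \<notin> ball c R - E"
    using \<zeta> op by (auto simp: frontier_def interior_open)
  moreover have "closure (ball c R - E) \<subseteq> cball c R" by (rule closure_minimal) auto
  ultimately show "\<zeta> \<in> E \<union> sphere c R" by auto
qed

text \<open>A quadratic harmonic minorant that is negative on \<open>E\<close> and positive at \<open>x0\<close> is compared with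
  the Green function, the exceptional boundary points being removed by the barrier.\<close>

lemma green_function_pos:
  assumes E: "compact E" "E \<subseteq> range complex_of_real" and g: "is_green_function E g"
    and x0: "complex_of_real x0 \<notin> E"
  shows "0 < g (of_real x0)"
proof -
  let ?x = "complex_of_real x0"
  have out: "outside E = - E" by (rule outside_compact_real) fact+
  have closed: "closed E" using E(1) by (rule compact_imp_closed)
  have harm: "g harmonic_on - E" and bdd: "\<And>R. bounded (g ` (- E \<inter> ball 0 R))"
    and inf: "(\<lambda>z. g z - ln (norm z)) \<in> O[at_infinity](\<lambda>_. 1)"
    using g unfolding is_green_function_def out by auto
  obtain N where N: "log_capacity N = 0" "\<And>\<zeta>. \<zeta> \<in> frontier (- E) - N \<Longrightarrow> (g \<longlongrightarrow> 0) (at \<zeta> within - E)"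
    using g unfolding is_green_function_def out by blast
  obtain c where c: "\<forall>\<^sub>F z in at_infinity. norm (g z - ln (norm z)) \<le> c * norm (1 :: real)"
    using inf by (rule landau_o.bigE)
  then obtain b where b: "\<And>z. b \<le> norm z \<Longrightarrow> \<bar>g z - ln (norm z)\<bar> \<le> c"
    by (auto simp: eventually_at_infinity)
  obtain D where D: "\<And>z. z \<in> E \<Longrightarrow> norm z \<le> D"
    using compact_imp_bounded[OF E(1)] by (auto simp: bounded_iff)
  \<comment> \<open>The circle must enclose \<open>E\<close> and lie where the estimate at infinity
    holds; the exponential makes g \<ge> 1 on it, which offsets q \<ge> -1.\<close>
  define R where "R = \<bar>x0\<bar> + \<bar>D\<bar> + \<bar>b\<bar> + exp (c + 1) + 1"
  have R: "0 < R" unfolding R_def by (smt (verit) exp_gt_zero)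
  have E_ball: "E \<subseteq> ball ?x R"
  proof
    fix z assume "z \<in> E"
    then have "norm (?x - z) \<le> \<bar>x0\<bar> + D" using D norm_triangle_ineq4[of ?x z] by fastforce
    then show "z \<in> ball ?x R" unfolding R_def by (simp add: dist_norm) (smt (verit) exp_gt_zero)
  qed
  have sphere: "1 \<le> g z" if "dist ?x z = R" for z
  proof -
    have "R \<le> norm z + \<bar>x0\<bar>" using that norm_triangle_ineq4[of ?x z] by (simp add: dist_norm)
    then have z: "\<bar>b\<bar> \<le> norm z" "exp (c + 1) \<le> norm z" unfolding R_def by (smt (verit) exp_gt_zero)+
    then have "ln (exp (c + 1)) \<le> ln (norm z)"
      by (subst ln_le_cancel_iff) (auto intro: less_le_trans[OF exp_gt_zero])
    moreover have "b \<le> norm z" using z(1) by linarith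
    ultimately show ?thesis using b[of z] by simp
  qed
  obtain \<delta> where \<delta>: "0 < \<delta>" "ball ?x \<delta> \<subseteq> - E"
    using closed x0 by (metis ComplI open_Compl openE)
  define \<eta> where "\<eta> = 1 / (\<delta>\<^sup>2 + R\<^sup>2)"
  have \<eta>: "0 < \<eta>" using R by (simp add: \<eta>_def add_nonneg_pos)
  \<comment> \<open>The negated minorant. On the real axis it is
    \<open>\<eta> * ((t - x0)\<^sup>2 - \<delta>\<^sup>2)\<close>, which is nonnegative on
    \<open>E\<close> because \<open>E\<close> keeps distance \<delta> from \<open>x0\<close>; \<eta>
    normalizes it to be at least -1 on the disc.\<close>
  define q where "q z = - (\<eta> * (\<delta>\<^sup>2 - Re ((z - ?x)\<^sup>2)))" for z
  define U where "U = ball ?x R - E"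
  have U: "open U" unfolding U_def using closed by (intro open_Diff) auto
  have UE: "U \<subseteq> - E" by (auto simp: U_def)
  have xU: "?x \<in> U" using x0 R by (simp add: U_def)
  have q_ge: "- 1 \<le> q z" if "z \<in> U" for z
  proof -
    have "\<bar>Re ((z - ?x)\<^sup>2)\<bar> \<le> norm ((z - ?x)\<^sup>2)" by (rule abs_Re_le_cmod)
    also have "\<dots> \<le> R\<^sup>2" unfolding norm_power
      using that by (intro power_mono) (auto simp: U_def dist_norm norm_minus_commute)
    finally have "\<eta> * (\<delta>\<^sup>2 - Re ((z - ?x)\<^sup>2)) \<le> \<eta> * (\<delta>\<^sup>2 + R\<^sup>2)"
      using \<eta> by (intro mult_left_mono) auto
    also have "\<dots> = 1" using R by (simp add: \<eta>_def add_nonneg_pos less_imp_neq[symmetric])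
    finally show ?thesis by (simp add: q_def)
  qed
  have q_E: "0 \<le> q z" if zE: "z \<in> E" for z
  proof -
    obtain t where t: "z = of_real t" using zE E(2) by blast
    have "z \<notin> ball ?x \<delta>" using \<delta>(2) that by auto
    then have "\<delta> \<le> \<bar>t - x0\<bar>" by (simp add: t dist_real_def abs_minus_commute)
    then have "\<delta>\<^sup>2 \<le> \<bar>t - x0\<bar>\<^sup>2" using \<delta>(1) by (intro power_mono) auto
    moreover have "Re ((z - ?x)\<^sup>2) = (t - x0)\<^sup>2" by (simp add: t flip: of_real_diff of_real_power)
    ultimately show ?thesis using \<eta> by (simp add: q_def mult_le_0_iff)
  qed
  have q_cont: "(q \<longlongrightarrow> q \<zeta>) (at \<zeta> within S)" for \<zeta> S
    unfolding q_def by (intro tendsto_intros)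
  have q_harm: "q harmonic_on U"
  proof (rule harmonic_on_holomorphic_gradient[OF U, where f = "\<lambda>z. of_real (2 * \<eta>) * (z - ?x)"])
    fix z
    have "((\<lambda>z. (z - ?x)\<^sup>2) has_derivative (\<lambda>v. 2 * (z - ?x) * v)) (at z)"
      by (auto intro!: derivative_eq_intros)
    from has_derivative_Re[OF this]
    show "(q has_derivative (\<lambda>v. Re (of_real (2 * \<eta>) * (z - ?x) * v))) (at z)"
      unfolding q_def by (auto intro!: derivative_eq_intros simp: algebra_simps)
  qed (intro holomorphic_intros)
  obtain M where M: "0 < M" "\<And>z. z \<in> U \<Longrightarrow> \<bar>g z\<bar> \<le> M"
  proof -
    have "bounded (g ` (- E \<inter> ball 0 (R + \<bar>x0\<bar>)))" by (rule bdd)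
    then obtain M where M: "0 < M" "\<And>y. y \<in> g ` (- E \<inter> ball 0 (R + \<bar>x0\<bar>)) \<Longrightarrow> norm y \<le> M"
      by (auto simp: bounded_pos)
    have "z \<in> ball 0 (R + \<bar>x0\<bar>)" if "z \<in> U" for z
      using that norm_triangle_sub[of z ?x] by (auto simp: U_def dist_norm norm_minus_commute)
    then show ?thesis using M UE by (intro that[of M]) fastforce+
  qed
  \<comment> \<open>A quarter of the minorant's value at \<open>x0\<close>: the boundary defect of g
    and the barrier use up one \<epsilon> each, and at least 2 \<epsilon> remain.\<close>
  define \<epsilon> where "\<epsilon> = \<eta> * \<delta>\<^sup>2 / 4"
  have \<epsilon>: "0 < \<epsilon>" using \<eta> \<delta>(1) by (simp add: \<epsilon>_def)
  \<comment> \<open>The exceptional set N is merely Borel, while the barrier requires a compact set.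
    The points near which g is not kept above -\<epsilon> form a closed subset of \<open>E\<close>
    contained in N.\<close>
  define K where "K = {\<zeta> \<in> E. \<not> (\<forall>\<^sub>F z in at \<zeta> within - E. - \<epsilon> < g z)}"
  have "K \<subseteq> N"
  proof
    fix \<zeta> assume "\<zeta> \<in> K"
    then have \<zeta>: "\<zeta> \<in> E" "\<not> (\<forall>\<^sub>F z in at \<zeta> within - E. - \<epsilon> < g z)" by (auto simp: K_def)
    then have "at \<zeta> within - E \<noteq> bot" by (metis eventually_bot)
    then have "\<zeta> \<in> closure (- E)" by (simp add: trivial_limit_within islimpt_in_closure) (use \<zeta>(1) in auto)
    moreover have "interior (- E) = - E" using closed by (simp add: interior_open open_Compl)
    ultimately have "\<zeta> \<in> frontier (- E)" using \<zeta>(1) by (simp add: frontier_def)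
    then show "\<zeta> \<in> N" using N(2)[of \<zeta>] order_tendstoD(1)[of g 0 _ "- \<epsilon>"] \<zeta>(2) \<epsilon> by fastforce
  qed
  then have capK: "log_capacity K = 0" using log_capacity_mono[of K N] N(1) by simp
  have "closed K"
    unfolding closed_sequential_limits
  proof (intro allI impI, elim conjE)
    fix u \<zeta> assume u: "\<forall>n. u n \<in> K" and lim: "u \<longlonglongrightarrow> \<zeta>"
    have "\<zeta> \<in> E" using closed u lim by (auto simp: closed_sequential_limits K_def)
    moreover have "\<not> (\<forall>\<^sub>F z in at \<zeta> within - E. - \<epsilon> < g z)"
    proof
      assume "\<forall>\<^sub>F z in at \<zeta> within - E. - \<epsilon> < g z"
      then obtain d where d: "0 < d" "\<And>z. z \<in> - E \<Longrightarrow> z \<noteq> \<zeta> \<Longrightarrow> dist z \<zeta> < d \<Longrightarrow> - \<epsilon> < g z"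
        by (auto simp: eventually_at)
      obtain n where n: "dist (u n) \<zeta> < d" using lim d(1) by (auto simp: lim_sequentially)
      have "\<forall>\<^sub>F z in at (u n) within - E. - \<epsilon> < g z"
        unfolding eventually_at
      proof (intro exI[of _ "d - dist (u n) \<zeta>"] conjI ballI impI)
        fix z assume z: "z \<in> - E" "z \<noteq> u n \<and> dist z (u n) < d - dist (u n) \<zeta>"
        have "dist z \<zeta> < d" using z(2) dist_triangle[of z \<zeta> "u n"] by simp
        moreover have "z \<noteq> \<zeta>" using z(1) \<open>\<zeta> \<in> E\<close> by auto
        ultimately show "- \<epsilon> < g z" using d(2) z(1) by blast
      qed (use n in simp)
      then show False using u by (auto simp: K_def)
    qed
    ultimately show "\<zeta> \<in> K" by (simp add: K_def)
  qed
  moreover have KE: "K \<subseteq> E" by (auto simp: K_def)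
  ultimately have "compact K" using E(1) by (metis compact_Int_closed inf.absorb_iff2 inf_commute)
  define B where "B = \<bar>ln (2 * R)\<bar> + \<bar>ln \<delta>\<bar> + 1"
  \<comment> \<open>The barrier is multiplied by \<open>M / L\<close>: near \<open>K\<close> it then
    reaches M and outweighs g \<ge> -M, while its lower bound on U and its value at
    \<open>x0\<close> together cost at most \<epsilon>.\<close>
  define L where "L = M * B / \<epsilon>"
  have B: "1 \<le> B" by (simp add: B_def)
  have L: "0 < L" "M / L * B = \<epsilon>" using M(1) B \<epsilon> by (auto simp: L_def field_simps)
  have KR: "K \<subseteq> range complex_of_real" using KE E(2) by (rule subset_trans)
  have UK: "U \<inter> K = {}" "U \<union> K \<subseteq> cball ?x R" "ball ?x \<delta> \<inter> K = {}"
    using UE KE E_ball \<delta>(2) by (auto simp: U_def)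
  have "\<exists>w. w harmonic_on U \<and> (\<forall>z\<in>U. - \<bar>ln (2 * R)\<bar> \<le> w z) \<and> w ?x \<le> \<bar>ln \<delta>\<bar> \<and>
     (\<forall>\<zeta>\<in>K. \<forall>\<^sub>F z in at \<zeta> within U. L \<le> w z)"
    by (rule capacity_zero_barrier[OF \<open>compact K\<close> KR capK U UK(1,2) R xU UK(3) \<delta>(1)])
  then obtain w where w: "w harmonic_on U" "\<And>z. z \<in> U \<Longrightarrow> - \<bar>ln (2 * R)\<bar> \<le> w z" "w ?x \<le> \<bar>ln \<delta>\<bar>"
    "\<And>\<zeta>. \<zeta> \<in> K \<Longrightarrow> \<forall>\<^sub>F z in at \<zeta> within U. L \<le> w z"
    by blast
  have ratio_pos: "0 < M / L" using M(1) L(1) by simp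
  have Mw_ge: "- (M / L * \<bar>ln (2 * R)\<bar>) \<le> M / L * w z" if "z \<in> U" for z
    using mult_left_mono[OF w(2)[OF that], of "M / L"] ratio_pos by simp
  have Mw_small: "M / L * \<bar>ln (2 * R)\<bar> + M / L * \<bar>ln \<delta>\<bar> \<le> \<epsilon>"
  proof -
    have "M / L * (\<bar>ln (2 * R)\<bar> + \<bar>ln \<delta>\<bar>) \<le> M / L * B"
      using ratio_pos by (intro mult_left_mono) (auto simp: B_def)
    then show ?thesis using L(2) by (simp add: distrib_left)
  qed
  define h where "h z = g z + (q z + M / L * w z)" for z
  have gU: "g harmonic_on U" using harm U UE by (rule harmonic_on_subset)
  have wU: "(\<lambda>z. M / L * w z) harmonic_on U" using w(1) by (rule harmonic_on_cmult)
  have h_harm: "h harmonic_on U"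
    unfolding h_def[abs_def] by (intro harmonic_on_add gU q_harm wU)
  have evU: "\<forall>\<^sub>F z in at \<zeta> within U. z \<in> U" for \<zeta> by (simp add: eventually_at_filter)
  let ?m = "- \<epsilon> - M / L * \<bar>ln (2 * R)\<bar>"
  have "?m \<le> h ?x"
  proof (rule harmonic_minimum_principle[OF h_harm _ _ xU])
    show "bounded U" by (rule bounded_subset[OF bounded_ball[of ?x R]]) (auto simp: U_def)
    fix \<zeta> and \<kappa> :: real assume \<zeta>: "\<zeta> \<in> frontier U" and \<kappa>: "0 < \<kappa>"
    consider "\<zeta> \<in> K" | "\<zeta> \<in> E - K" | "\<zeta> \<notin> E" "dist ?x \<zeta> = R"
    proof -
      have "\<zeta> \<in> E \<union> sphere ?x R"
        using \<zeta> frontier_ball_diff_subset[OF closed, of ?x R] unfolding U_def by blast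
      then show ?thesis using that by (cases "\<zeta> \<in> E") auto
    qed
    then show "\<forall>\<^sub>F z in at \<zeta> within U. ?m - \<kappa> < h z"
    proof cases
      case 1
      have "\<forall>\<^sub>F z in at \<zeta> within U. - \<kappa> < q z"
        using q_cont q_E[of \<zeta>] 1 KE \<kappa> by (intro order_tendstoD(1)[OF q_cont]) (auto intro: less_le_trans)
      then show ?thesis using w(4)[OF 1] evU
      proof eventually_elim
        case (elim z)
        have "M \<le> M / L * w z" using mult_left_mono[OF elim(2), of "M / L"] ratio_pos L(1) by simp
        moreover have "- M \<le> g z" using M(2)[OF elim(3)] by simp
        moreover have "0 \<le> M / L * \<bar>ln (2 * R)\<bar>"
          by (rule mult_nonneg_nonneg[OF less_imp_le[OF ratio_pos] abs_ge_zero])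
        ultimately show ?case using elim(1) \<epsilon> by (simp add: h_def)
      qed
    next
      case 2
      have "\<forall>\<^sub>F z in at \<zeta> within U. - \<kappa> < q z"
        using q_E[of \<zeta>] 2 \<kappa> by (intro order_tendstoD(1)[OF q_cont]) (auto intro: less_le_trans)
      moreover have "\<forall>\<^sub>F z in at \<zeta> within - E. - \<epsilon> < g z" using 2 by (simp add: K_def)
      then have "\<forall>\<^sub>F z in at \<zeta> within U. - \<epsilon> < g z"
        using at_le[OF UE] by (rule filter_leD[rotated])
      ultimately show ?thesis using evU
      proof eventually_elim
        case (elim z)
        then show ?case using Mw_ge[of z] by (simp add: h_def)
      qed
    next
      case 3
      have "continuous (at \<zeta>) g"
        using harmonic_on_imp_continuous_on[OF harm] 3(1) closed by (simp add: continuous_on_eq_continuous_at open_Compl)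
      then have "(g \<longlongrightarrow> g \<zeta>) (at \<zeta> within U)" unfolding continuous_within by (rule tendsto_mono[OF at_le[OF subset_UNIV]])
      then have "\<forall>\<^sub>F z in at \<zeta> within U. 1 - \<kappa> < g z"
        using sphere[OF 3(2)] \<kappa> by (intro order_tendstoD(1)) auto
      then show ?thesis using evU
      proof eventually_elim
        case (elim z)
        then show ?case using Mw_ge[of z] q_ge[of z] \<epsilon> by (simp add: h_def)
      qed
    qed
  qed
  moreover have "q ?x = - (4 * \<epsilon>)" by (simp add: q_def \<epsilon>_def)
  moreover have "M / L * w ?x \<le> M / L * \<bar>ln \<delta>\<bar>" using w(3) ratio_pos by (intro mult_left_mono) auto
  ultimately show ?thesis using Mw_small \<epsilon> by (simp add: h_def)
qed

section \<open>Existence of the Green function\<close>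

text \<open>Write |1 + w|^2 = 1 + s with s = 2 Re w + |w|^2. The radius 1/6 gives |s| \<le> 1/2, the
  range of the real estimate for ln(1 + s).\<close>

lemma norm_ln_one_plus_minus_le:
  fixes w :: complex
  assumes "norm w \<le> 1 / 6"
  shows "\<bar>ln (norm (1 + w)) - Re w\<bar> \<le> 10 * (norm w)\<^sup>2"
proof -
  define s where "s = 2 * Re w + (norm w)\<^sup>2"
  have "1 + w \<noteq> 0"
  proof
    assume "1 + w = 0"
    then have "w = - 1" by (simp add: add_eq_0_iff)
    then show False using assms by simp
  qed
  have sq: "(norm (1 + w))\<^sup>2 = 1 + s"
    unfolding s_def cmod_power2 by (simp add: power2_eq_square algebra_simps)
  have "ln ((norm (1 + w))\<^sup>2) = 2 * ln (norm (1 + w))"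
    using \<open>1 + w \<noteq> 0\<close> by (simp add: ln_realpow)
  then have ln: "ln (1 + s) = 2 * ln (norm (1 + w))" unfolding sq .
  have "(norm w)\<^sup>2 \<le> norm w" using assms by (simp add: power2_eq_square mult_left_le)
  then have s: "\<bar>s\<bar> \<le> 3 * norm w" using abs_Re_le_cmod[of w] zero_le_power2[of "norm w"] unfolding s_def by linarith
  have "\<bar>ln (1 + s) - s\<bar> \<le> 2 * s\<^sup>2"
    using s assms by (intro abs_ln_one_plus_x_minus_x_bound) linarith
  moreover have "s\<^sup>2 \<le> 9 * (norm w)\<^sup>2"
    using power_mono[OF s, of 2] by (simp add: power_mult_distrib)
  ultimately have "\<bar>2 * ln (norm (1 + w)) - s\<bar> \<le> 18 * (norm w)\<^sup>2"
    unfolding ln by linarith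
  then show ?thesis unfolding s_def by (simp add: abs_le_iff)
qed

context equilibrium
begin

text \<open>Near \<open>E\<close> but off it this is C minus the shifted potential. Since capacity 1
  makes the minimal energy 0, it is itself the candidate for the Green function, with no constant to
  add.\<close>

definition lnpot :: "complex \<Rightarrow> real" where
  "lnpot z = (\<integral>w. ln (dist z w) \<partial>\<mu>)"

lemma dist_bounds:
  assumes "z \<notin> E"
  shows "\<exists>\<delta>>0. \<forall>w\<in>E. \<delta> \<le> dist z w"
  using separate_point_closed[OF compact_imp_closed[OF compact] assms] by blast

lemma bounded_E: "\<exists>B>0. \<forall>w\<in>E. norm w \<le> B"
  using compact_imp_bounded[OF compact] by (simp add: bounded_pos)

lemma integrable_bounded_on_E:
  fixes f :: "complex \<Rightarrow> 'b::{banach, second_countable_topology}"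
  assumes "f \<in> borel_measurable borel" "\<And>w. w \<in> E \<Longrightarrow> norm (f w) \<le> B"
  shows "integrable \<mu> f"
proof (rule integrable_const_bound)
  show "AE w in \<mu>. norm (f w) \<le> B" using AE_\<mu> by eventually_elim (rule assms(2))
qed (use assms(1) sets_\<mu> in \<open>simp cong: measurable_cong_sets\<close>)

lemma norm_integral_le_on_E:
  fixes f :: "complex \<Rightarrow> 'b::{banach, second_countable_topology}"
  assumes f: "f \<in> borel_measurable borel" and le: "\<And>w. w \<in> E \<Longrightarrow> norm (f w) \<le> B"
  shows "norm (\<integral>w. f w \<partial>\<mu>) \<le> B"
proof -
  have "norm (\<integral>w. f w \<partial>\<mu>) \<le> (\<integral>w. norm (f w) \<partial>\<mu>)" by (rule integral_norm_bound)
  also have "\<dots> \<le> (\<integral>w. B \<partial>\<mu>)"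
  proof (rule integral_mono_AE)
    show "integrable \<mu> (\<lambda>w. norm (f w))"
      by (rule integrable_norm, rule integrable_bounded_on_E[OF f le])
    show "AE w in \<mu>. norm (f w) \<le> B" using AE_\<mu> by eventually_elim (rule le)
  qed simp
  also have "\<dots> = B" by (simp add: prob_space)
  finally show ?thesis .
qed

lemma integrable_ln_dist:
  assumes "z \<notin> E"
  shows "integrable \<mu> (\<lambda>w. ln (dist z w))"
proof -
  obtain \<delta> where \<delta>: "0 < \<delta>" "\<And>w. w \<in> E \<Longrightarrow> \<delta> \<le> dist z w" using dist_bounds[OF assms] by blast
  obtain B where B: "0 < B" "\<And>w. w \<in> E \<Longrightarrow> norm w \<le> B" using bounded_E by blast
  show ?thesis
  proof (rule integrable_bounded_on_E)
    fix w assume w: "w \<in> E"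
    have "dist z w \<le> norm z + B" using B(2)[OF w] norm_triangle_ineq4[of z w] by (simp add: dist_norm)
    moreover have "0 < dist z w" using \<delta>(2)[OF w] \<delta>(1) by linarith
    ultimately have "ln (dist z w) \<le> ln (norm z + B)" "ln \<delta> \<le> ln (dist z w)"
      using \<delta>(2)[OF w] \<delta>(1) by (subst ln_le_cancel_iff; linarith)+
    then show "norm (ln (dist z w)) \<le> \<bar>ln (norm z + B)\<bar> + \<bar>ln \<delta>\<bar>" by simp
  qed measurable
qed

text \<open>Differentiation under the integral from a second-order Taylor bound uniform over
  \<open>E\<close>. It is used for the kernels 1/(z - w) and ln |z - w|.\<close>

lemma has_derivative_integral:
  fixes f :: "complex \<Rightarrow> complex \<Rightarrow> 'b::euclidean_space"
  assumes int: "\<And>z. z \<notin> E \<Longrightarrow> integrable \<mu> (f z)" and "z \<notin> E"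
    and lin: "bounded_linear (\<lambda>v. \<integral>w. f' w v \<partial>\<mu>)" and int': "\<And>v. integrable \<mu> (\<lambda>w. f' w v)"
    and [measurable]: "\<And>z. f z \<in> borel_measurable borel" "\<And>v. (\<lambda>w. f' w v) \<in> borel_measurable borel"
    and "0 < \<rho>" and taylor: "\<And>v w. w \<in> E \<Longrightarrow> norm v < \<rho> \<Longrightarrow> norm (f (z + v) w - f z w - f' w v) \<le> A * (norm v)\<^sup>2"
  shows "((\<lambda>z. \<integral>w. f z w \<partial>\<mu>) has_derivative (\<lambda>v. \<integral>w. f' w v \<partial>\<mu>)) (at z)"
proof -
  have "open (- E)" using compact by (simp add: open_Compl compact_imp_closed)
  then obtain d where d: "0 < d" "ball z d \<subseteq> - E" using \<open>z \<notin> E\<close> by (metis ComplI openE)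
  let ?F = "\<lambda>z. \<integral>w. f z w \<partial>\<mu>"
  have bound: "norm (?F (z + v) - ?F z - (\<integral>w. f' w v \<partial>\<mu>)) \<le> A * (norm v)\<^sup>2" if v: "norm v < min \<rho> d" for v
  proof -
    have "z + v \<in> ball z d" using v by (simp add: dist_norm)
    then have "z + v \<notin> E" using d by auto
    then have "?F (z + v) - ?F z - (\<integral>w. f' w v \<partial>\<mu>) = (\<integral>w. f (z + v) w - f z w - f' w v \<partial>\<mu>)"
      using int int' \<open>z \<notin> E\<close> by simp
    also have "norm \<dots> \<le> A * (norm v)\<^sup>2"
      by (rule norm_integral_le_on_E) (use taylor v in auto)
    finally show ?thesis .
  qed
  show ?thesis
    unfolding has_derivative_at
  proof (intro conjI lin)
    have "((\<lambda>v :: complex. A * norm v) \<longlongrightarrow> A * norm (0::complex)) (at 0)"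
      by (intro tendsto_mult_left tendsto_norm tendsto_ident_at)
    then have lim: "((\<lambda>v :: complex. A * norm v) \<longlongrightarrow> 0) (at 0)" by simp
    show "(\<lambda>v. norm (?F (z + v) - ?F z - (\<integral>w. f' w v \<partial>\<mu>)) / norm v) \<midarrow>0\<rightarrow> 0"
    proof (rule tendsto_sandwich[OF _ _ tendsto_const lim])
      have "\<forall>\<^sub>F v :: complex in at 0. norm v < min \<rho> d"
        using \<open>0 < \<rho>\<close> d(1) by (auto simp: eventually_at intro!: exI[of _ "min \<rho> d"])
      moreover have "\<forall>\<^sub>F v :: complex in at 0. v \<noteq> 0" by (simp add: eventually_at_filter)
      ultimately show "\<forall>\<^sub>F v in at 0. norm (?F (z + v) - ?F z - (\<integral>w. f' w v \<partial>\<mu>)) / norm v \<le> A * norm v"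
      proof eventually_elim
        case (elim v)
        then show ?case using bound[of v] by (simp add: divide_le_eq power2_eq_square mult.assoc)
      qed
    qed auto
  qed
qed

definition cauchy_transform :: "complex \<Rightarrow> complex" where
  "cauchy_transform z = (\<integral>w. 1 / (z - w) \<partial>\<mu>)"

lemma integrable_inverse_power:
  assumes "z \<notin> E"
  shows "integrable \<mu> (\<lambda>w. 1 / (z - w) ^ k)"
proof -
  obtain \<delta> where \<delta>: "0 < \<delta>" "\<And>w. w \<in> E \<Longrightarrow> \<delta> \<le> dist z w" using dist_bounds[OF assms] by blast
  show ?thesis
  proof (rule integrable_bounded_on_E)
    fix w assume w: "w \<in> E"
    have "\<delta> ^ k \<le> norm (z - w) ^ k" using \<delta> w by (intro power_mono) (auto simp: dist_norm)
    then show "norm (1 / (z - w) ^ k) \<le> 1 / \<delta> ^ k"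
      using \<delta>(1) by (simp add: norm_divide norm_power frac_le)
  qed measurable
qed

lemma holomorphic_cauchy_transform: "cauchy_transform holomorphic_on - E"
proof (rule holomorphic_onI)
  fix z assume "z \<in> - E"
  then have z: "z \<notin> E" by simp
  obtain \<delta> where \<delta>: "0 < \<delta>" "\<And>w. w \<in> E \<Longrightarrow> \<delta> \<le> dist z w" using dist_bounds[OF z] by blast
  have int2: "integrable \<mu> (\<lambda>w. 1 / (z - w)\<^sup>2)" using z by (rule integrable_inverse_power)
  then have int2': "integrable \<mu> (\<lambda>w. - (1 / (z - w)\<^sup>2))" by (rule Bochner_Integration.integrable_minus)
  have int_eq: "(\<integral>w. - (1 / (z - w)\<^sup>2) * v \<partial>\<mu>) = - (\<integral>w. 1 / (z - w)\<^sup>2 \<partial>\<mu>) * v" for v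
    using Bochner_Integration.integral_mult_left[OF int2', of v]
      Bochner_Integration.integral_minus[of \<mu> "\<lambda>w. 1 / (z - w)\<^sup>2"] by simp
  have "((\<lambda>z. \<integral>w. 1 / (z - w) \<partial>\<mu>) has_derivative (\<lambda>v. \<integral>w. - (1 / (z - w)\<^sup>2) * v \<partial>\<mu>)) (at z)"
  proof (rule has_derivative_integral[OF _ z, where \<rho> = "\<delta> / 2" and A = "2 / \<delta> ^ 3"])
    show "integrable \<mu> (\<lambda>w. 1 / (z - w))" if "z \<notin> E" for z
      using integrable_inverse_power[OF that, of 1] by simp
    show "integrable \<mu> (\<lambda>w. - (1 / (z - w)\<^sup>2) * v)" for v using int2' by (rule Bochner_Integration.integrable_mult_left)
    show "bounded_linear (\<lambda>v. \<integral>w. - (1 / (z - w)\<^sup>2) * v \<partial>\<mu>)"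
      unfolding int_eq by (rule bounded_linear_mult_right)
    fix v w :: complex assume w: "w \<in> E" and v: "norm v < \<delta> / 2"
    have a: "\<delta> \<le> norm (z - w)" using \<delta>(2)[OF w] by (simp add: dist_norm)
    have b: "\<delta> / 2 \<le> norm (z + v - w)"
      using norm_triangle_ineq4[of "z + v - w" v] a v by simp
    have ne: "z - w \<noteq> 0" "z + v - w \<noteq> 0" using a b \<delta>(1) by auto
    have "1 / (z + v - w) - 1 / (z - w) - - (1 / (z - w)\<^sup>2) * v = v\<^sup>2 / ((z + v - w) * (z - w)\<^sup>2)"
      using ne by (simp add: divide_simps power2_eq_square) (simp add: algebra_simps)
    then have "norm (1 / (z + v - w) - 1 / (z - w) - - (1 / (z - w)\<^sup>2) * v) =
        (norm v)\<^sup>2 / (norm (z + v - w) * (norm (z - w))\<^sup>2)"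
      by (simp add: norm_divide norm_mult norm_power)
    also have "\<dots> \<le> (norm v)\<^sup>2 / (\<delta> / 2 * \<delta>\<^sup>2)"
      using a b \<delta>(1) by (intro divide_left_mono mult_mono power_mono mult_pos_pos) auto
    also have "\<dots> = 2 / \<delta> ^ 3 * (norm v)\<^sup>2" by (simp add: power3_eq_cube power2_eq_square mult_ac)
    finally show "norm (1 / (z + v - w) - 1 / (z - w) - - (1 / (z - w)\<^sup>2) * v) \<le> 2 / \<delta> ^ 3 * (norm v)\<^sup>2" .
  qed (use \<delta>(1) in simp_all)
  then have "(cauchy_transform has_field_derivative - (\<integral>w. 1 / (z - w)\<^sup>2 \<partial>\<mu>)) (at z)"
    unfolding cauchy_transform_def[abs_def] has_field_derivative_def int_eq .
  then show "cauchy_transform field_differentiable at z within - E"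
    using field_differentiable_at_within field_differentiable_def by blast
qed

lemma harmonic_lnpot: "lnpot harmonic_on - E"
proof (rule harmonic_on_holomorphic_gradient[OF _ holomorphic_cauchy_transform])
  show "open (- E)" using compact by (simp add: open_Compl compact_imp_closed)
  fix z assume "z \<in> - E"
  then have z: "z \<notin> E" by simp
  obtain \<delta> where \<delta>: "0 < \<delta>" "\<And>w. w \<in> E \<Longrightarrow> \<delta> \<le> dist z w" using dist_bounds[OF z] by blast
  have int1: "integrable \<mu> (\<lambda>w. 1 / (z - w))" using integrable_inverse_power[OF z, of 1] by simp
  then have int1v: "integrable \<mu> (\<lambda>w. 1 / (z - w) * v)" for v by (rule Bochner_Integration.integrable_mult_left)
  have eq: "(\<integral>w. Re (1 / (z - w) * v) \<partial>\<mu>) = Re (cauchy_transform z * v)" for v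
    unfolding cauchy_transform_def
    by (subst integral_Re[OF int1v]) (simp only: Bochner_Integration.integral_mult_left[OF int1])
  have "((\<lambda>z. \<integral>w. ln (dist z w) \<partial>\<mu>) has_derivative (\<lambda>v. \<integral>w. Re (1 / (z - w) * v) \<partial>\<mu>)) (at z)"
  \<comment> \<open>With u = v/(z - w) the increment of the kernel is ln |1 + u|; the radius
    \<delta>/6 gives |u| \<le> 1/6, as \<open>norm_ln_one_plus_minus_le\<close> demands.\<close>
  proof (rule has_derivative_integral[OF _ z, where \<rho> = "\<delta> / 6" and A = "10 / \<delta>\<^sup>2"])
    show "integrable \<mu> (\<lambda>w. ln (dist z w))" if "z \<notin> E" for z using that by (rule integrable_ln_dist)
    show "integrable \<mu> (\<lambda>w. Re (1 / (z - w) * v))" for v using int1v by (rule integrable_Re)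
    show "bounded_linear (\<lambda>v. \<integral>w. Re (1 / (z - w) * v) \<partial>\<mu>)"
      unfolding eq by (intro bounded_linear_compose[OF bounded_linear_Re] bounded_linear_mult_right)
    fix v w :: complex assume w: "w \<in> E" and v: "norm v < \<delta> / 6"
    have a: "\<delta> \<le> norm (z - w)" using \<delta>(2)[OF w] by (simp add: dist_norm)
    then have ne: "z - w \<noteq> 0" using \<delta>(1) by auto
    define u where "u = v / (z - w)"
    have u: "norm u \<le> norm v / \<delta>"
      unfolding u_def norm_divide using a \<delta>(1) by (intro divide_left_mono mult_pos_pos) auto
    also have "\<dots> \<le> 1 / 6" using v \<delta>(1) by (simp add: field_simps)
    finally have u2: "norm u \<le> 1 / 6" .
    have u1: "0 < norm (1 + u)"
    proof -
      have "1 + u \<noteq> 0"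
      proof
        assume "1 + u = 0"
        then have "u = - 1" by (simp add: add_eq_0_iff)
        then show False using u2 by simp
      qed
      then show ?thesis by simp
    qed
    have "dist (z + v) w = norm (z - w) * norm (1 + u)"
    proof -
      have "z + v - w = (z - w) * (1 + u)" using ne by (simp add: u_def distrib_left)
      then show ?thesis by (simp add: dist_norm norm_mult)
    qed
    then have "ln (dist (z + v) w) - ln (dist z w) - Re (1 / (z - w) * v) = ln (norm (1 + u)) - Re u"
      using ne u1 by (simp add: ln_mult dist_norm u_def)
    also have "norm \<dots> \<le> 10 * (norm u)\<^sup>2" using norm_ln_one_plus_minus_le[OF u2] by simp
    also have "\<dots> \<le> 10 * (norm v / \<delta>)\<^sup>2" using u by (intro mult_left_mono power_mono) auto
    finally show "norm (ln (dist (z + v) w) - ln (dist z w) - Re (1 / (z - w) * v)) \<le> 10 / \<delta>\<^sup>2 * (norm v)\<^sup>2"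
      by (simp add: power_divide)
  qed (use \<delta>(1) in simp_all)
  then show "(lnpot has_derivative (\<lambda>v. Re (cauchy_transform z * v))) (at z)"
    unfolding eq lnpot_def[abs_def] .
qed

text \<open>All z are covered, including those in \<open>E\<close>, because the Laguerre zeros may
  lie anywhere. Finiteness of the potential excludes an atom at z, so the convention
  \<open>ln 0 = 0\<close> affects only a null set. Truncating C - ln at 0 can only enlarge its
  integral, so the bound C on the potential survives.\<close>

lemma integral_ln_dist_nonneg:
  shows "integrable \<mu> (\<lambda>w. ln (dist z w))" and "0 \<le> (\<integral>w. ln (dist z w) \<partial>\<mu>)"
    and "AE w in \<mu>. w \<noteq> z"
proof -
  obtain B where B: "0 < B" "\<And>w. w \<in> E \<Longrightarrow> norm w \<le> B" using bounded_E by blast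
  have fin: "(\<integral>\<^sup>+w. logker C z w \<partial>\<mu>) \<le> ennreal C"
    using logpot_le[of z] by (simp add: logpot_def)
  then have "(\<integral>\<^sup>+w. logker C z w \<partial>\<mu>) \<noteq> \<infinity>" by (auto simp: top_unique)
  then have "AE w in \<mu>. logker C z w \<noteq> \<infinity>" by (rule nn_integral_PInf_AE[rotated]) measurable
  then show ne: "AE w in \<mu>. w \<noteq> z" by eventually_elim (auto simp: logker_def)
  have pos: "(\<integral>\<^sup>+w. ennreal (C - ln (dist z w)) \<partial>\<mu>) \<le> ennreal C"
  proof -
    have "(\<integral>\<^sup>+w. ennreal (C - ln (dist z w)) \<partial>\<mu>) \<le> (\<integral>\<^sup>+w. logker C z w \<partial>\<mu>)"
      by (intro nn_integral_mono) (simp add: logker_def)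
    with fin show ?thesis by simp
  qed
  have neg: "(\<integral>\<^sup>+w. ennreal (- (C - ln (dist z w))) \<partial>\<mu>) \<le> ennreal \<bar>ln (norm z + B)\<bar>"
  proof -
    have "(\<integral>\<^sup>+w. ennreal (- (C - ln (dist z w))) \<partial>\<mu>) \<le> (\<integral>\<^sup>+w. ennreal \<bar>ln (norm z + B)\<bar> \<partial>\<mu>)"
    proof (rule nn_integral_mono_AE)
      show "AE w in \<mu>. ennreal (- (C - ln (dist z w))) \<le> ennreal \<bar>ln (norm z + B)\<bar>"
        using AE_\<mu> ne
      proof eventually_elim
        case (elim w)
        have "dist z w \<le> norm z + B" using B(2)[OF elim(1)] norm_triangle_ineq4[of z w] by (simp add: dist_norm)
        then have "ln (dist z w) \<le> ln (norm z + B)" using elim(2) by (subst ln_le_cancel_iff) (auto intro: add_nonneg_pos B(1))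
        then show ?case using C_nonneg by (intro ennreal_leI) simp
      qed
    qed
    then show ?thesis by (simp add: emeasure_space_1)
  qed
  have int: "integrable \<mu> (\<lambda>w. C - ln (dist z w))"
    unfolding real_integrable_def using pos neg by (auto simp: top_unique)
  have "integrable \<mu> (\<lambda>w. C - (C - ln (dist z w)))" by (rule Bochner_Integration.integrable_diff[OF _ int]) simp
  then show "integrable \<mu> (\<lambda>w. ln (dist z w))" by simp
  have "(\<integral>w. C - ln (dist z w) \<partial>\<mu>) = C - (\<integral>w. ln (dist z w) \<partial>\<mu>)"
    using \<open>integrable \<mu> (\<lambda>w. ln (dist z w))\<close> by (simp add: prob_space)
  moreover have "(\<integral>w. C - ln (dist z w) \<partial>\<mu>) \<le> C"
  proof -
    have "ennreal (\<integral>w. C - ln (dist z w) \<partial>\<mu>) \<le> ennreal (\<integral>w. max 0 (C - ln (dist z w)) \<partial>\<mu>)"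
      using int by (intro ennreal_leI integral_mono integrable_max) auto
    also have "\<dots> = (\<integral>\<^sup>+w. ennreal (max 0 (C - ln (dist z w))) \<partial>\<mu>)"
      using int by (intro nn_integral_eq_integral[symmetric] integrable_max) auto
    also have "\<dots> = (\<integral>\<^sup>+w. ennreal (C - ln (dist z w)) \<partial>\<mu>)"
      by (intro nn_integral_cong) (auto simp: max_def ennreal_neg)
    also note pos
    finally show ?thesis using C_nonneg by (simp add: ennreal_le_iff)
  qed
  ultimately show "0 \<le> (\<integral>w. ln (dist z w) \<partial>\<mu>)" by simp
qed

end

context equilibrium
begin

section \<open>The logarithmic potential as Green function\<close>

lemma outside_E: "outside E = - E"
  using compact real by (rule outside_compact_real)

lemma lnpot_nonneg: "0 \<le> lnpot z"
  unfolding lnpot_def by (rule integral_ln_dist_nonneg)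

lemma logpot_eq_lnpot:
  assumes "z \<notin> E" "\<And>w. w \<in> E \<Longrightarrow> dist z w \<le> exp C"
  shows "logpot C \<mu> z = ennreal (C - lnpot z)"
proof -
  have int: "integrable \<mu> (\<lambda>w. ln (dist z w))" using assms(1) by (rule integrable_ln_dist)
  have le: "AE w in \<mu>. 0 \<le> C - ln (dist z w)"
    using AE_\<mu>
  proof eventually_elim
    case (elim w)
    then have "0 < dist z w" using assms(1) by auto
    then have "ln (dist z w) \<le> ln (exp C)" using assms(2)[OF elim] by (subst ln_le_cancel_iff) auto
    then show ?case by simp
  qed
  have "logpot C \<mu> z = (\<integral>\<^sup>+w. ennreal (C - ln (dist z w)) \<partial>\<mu>)"
    unfolding logpot_def
  proof (rule nn_integral_cong_AE)
    show "AE w in \<mu>. logker C z w = ennreal (C - ln (dist z w))"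
      using AE_\<mu> by eventually_elim (use assms(1) in \<open>auto simp: logker_def\<close>)
  qed
  also have "\<dots> = ennreal (\<integral>w. C - ln (dist z w) \<partial>\<mu>)"
    using int le by (intro nn_integral_eq_integral) auto
  also have "(\<integral>w. C - ln (dist z w) \<partial>\<mu>) = C - lnpot z"
    unfolding lnpot_def using int by (simp add: prob_space)
  finally show ?thesis .
qed

lemma lnpot_le:
  assumes "z \<notin> E" "0 < b" "\<And>w. w \<in> E \<Longrightarrow> dist z w \<le> b"
  shows "lnpot z \<le> ln b"
proof -
  have "lnpot z \<le> (\<integral>w. ln b \<partial>\<mu>)"
    unfolding lnpot_def
  proof (rule integral_mono_AE)
    show "AE w in \<mu>. ln (dist z w) \<le> ln b"
      using AE_\<mu>
    proof eventually_elim
      case (elim w)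
      then have "0 < dist z w" using assms(1) by auto
      then show ?case using assms(2,3) elim by (subst ln_le_cancel_iff) auto
    qed
  qed (use integrable_ln_dist[OF assms(1)] in auto)
  then show ?thesis by (simp add: prob_space)
qed

lemma lnpot_minus_ln_bounded: "(\<lambda>z. lnpot z - ln (norm z)) \<in> O[at_infinity](\<lambda>_. 1)"
proof -
  obtain B where B: "0 < B" "\<And>w. w \<in> E \<Longrightarrow> norm w \<le> B" using bounded_E by blast
  have bound: "norm (lnpot z - ln (norm z)) \<le> ln 2" if z: "2 * B \<le> norm z" for z
  proof -
    have "z \<notin> E" using B z by force
    then have int: "integrable \<mu> (\<lambda>w. ln (dist z w))" by (rule integrable_ln_dist)
    have "lnpot z - ln (norm z) = (\<integral>w. ln (dist z w) - ln (norm z) \<partial>\<mu>)"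
      unfolding lnpot_def using int by (simp add: prob_space)
    also have "norm \<dots> \<le> ln 2"
    proof (rule norm_integral_le_on_E)
      fix w assume w: "w \<in> E"
      have pos: "0 < norm z" using B(1) z by linarith
      have "norm z / 2 \<le> dist z w" "dist z w \<le> norm z * 2"
        using B(2)[OF w] z norm_triangle_ineq2[of z w] norm_triangle_ineq4[of z w] by (auto simp: dist_norm)
      moreover from this have "0 < dist z w" using pos by linarith
      ultimately have "ln (norm z / 2) \<le> ln (dist z w)" "ln (dist z w) \<le> ln (norm z * 2)"
        using pos by (subst ln_le_cancel_iff; linarith)+
      then show "norm (ln (dist z w) - ln (norm z)) \<le> ln 2"
        using pos by (simp add: ln_div ln_mult)
    qed measurable
    finally show ?thesis .
  qed
  show ?thesis
  proof (rule landau_o.bigI[of "ln 2"])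
    show "\<forall>\<^sub>F z in at_infinity. norm (lnpot z - ln (norm z)) \<le> ln 2 * norm (1 :: real)"
      using bound by (auto simp: eventually_at_infinity)
  qed simp
qed

text \<open>Boundary values come from two sides: the potential never exceeds C, and at a boundary
  point where it equals C lower semicontinuity keeps it above C - a nearby.\<close>

lemma is_green_function_lnpot: "is_green_function E lnpot"
  unfolding is_green_function_def outside_E
proof (intro conjI allI)
  show "lnpot harmonic_on - E" by (rule harmonic_lnpot)
  show "(\<lambda>z. lnpot z - ln (norm z)) \<in> O[at_infinity](\<lambda>_. 1)" by (rule lnpot_minus_ln_bounded)
  obtain B where B: "0 < B" "\<And>w. w \<in> E \<Longrightarrow> norm w \<le> B" using bounded_E by blast
  show "bounded (lnpot ` (- E \<inter> ball 0 R))" for R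
  proof (rule boundedI)
    fix y assume "y \<in> lnpot ` (- E \<inter> ball 0 R)"
    then obtain z where z: "z \<notin> E" "norm z < R" "y = lnpot z" by auto
    have "lnpot z \<le> ln (R + B)"
    proof (rule lnpot_le[OF z(1)])
      have "0 < R" using z(2) by (rule le_less_trans[OF norm_ge_zero])
      then show "0 < R + B" using B(1) by simp
      fix w assume "w \<in> E"
      then show "dist z w \<le> R + B"
        using B(2) z(2) norm_triangle_ineq4[of z w] by (fastforce simp: dist_norm)
    qed
    then show "norm y \<le> ln (R + B)" using lnpot_nonneg z(3) by simp
  qed
  let ?N = "{z \<in> E. logpot C \<mu> z < ennreal C}"
  have [measurable]: "E \<in> sets borel" using compact by (simp add: borel_closed compact_imp_closed)
  show "\<exists>N\<in>sets borel. log_capacity N = 0 \<and> (\<forall>\<zeta>\<in>frontier (- E) - N. (lnpot \<longlongrightarrow> 0) (at \<zeta> within - E))"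
  proof (rule bexI[of _ ?N], intro conjI ballI)
    show "?N \<in> sets borel" by measurable
    show "log_capacity ?N = 0" by (rule log_capacity_logpot_less)
    fix \<zeta> assume \<zeta>: "\<zeta> \<in> frontier (- E) - ?N"
    have "frontier (- E) \<subseteq> E"
      using compact by (simp add: frontier_complement frontier_subset_eq compact_imp_closed)
    then have \<zeta>E: "\<zeta> \<in> E" and ge: "ennreal C \<le> logpot C \<mu> \<zeta>" using \<zeta> by (auto simp: not_less)
    show "(lnpot \<longlongrightarrow> 0) (at \<zeta> within - E)"
    proof (rule order_tendstoI)
      fix a :: real assume "a < 0"
      then show "\<forall>\<^sub>F z in at \<zeta> within - E. a < lnpot z"
        using lnpot_nonneg by (intro always_eventually allI) (rule less_le_trans)
    next
      fix a :: real assume "0 < a"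
      \<comment> \<open>The unit ball, together with \<open>diam_add_1\<close>, keeps distances to
        \<open>E\<close> below \<open>exp C\<close>, so the kernel is not truncated there.\<close>
      let ?S = "- {z. logpot C \<mu> z \<le> ennreal (C - a)} \<inter> ball \<zeta> 1"
      have "open ?S"
        using closed_logpot_le[OF prob_space_axioms sets_\<mu>] by (intro open_Int) auto
      moreover have "ennreal (C - a) < ennreal C" using \<open>0 < a\<close> C_pos by (intro ennreal_lessI) auto
      then have "\<zeta> \<in> ?S" using ge by (auto simp: not_le)
      ultimately have "\<forall>\<^sub>F z in at \<zeta> within - E. z \<in> ?S" by (intro eventually_at_topological[THEN iffD2]) blast
      moreover have "\<forall>\<^sub>F z in at \<zeta> within - E. z \<in> - E" by (simp add: eventually_at_filter)
      ultimately show "\<forall>\<^sub>F z in at \<zeta> within - E. lnpot z < a"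
      proof eventually_elim
        case (elim z)
        have "logpot C \<mu> z = ennreal (C - lnpot z)"
        proof (rule logpot_eq_lnpot)
          fix w assume "w \<in> E"
          then have "dist \<zeta> w + 1 \<le> exp C" using \<zeta>E by (rule diam_add_1[rotated])
          moreover have "dist z w \<le> dist z \<zeta> + dist \<zeta> w" by (rule dist_triangle)
          moreover have "dist z \<zeta> < 1" using elim by (simp add: dist_commute)
          ultimately show "dist z w \<le> exp C" by linarith
        qed (use elim in simp)
        then have less: "ennreal (C - a) < ennreal (C - lnpot z)" using elim by (simp add: not_le)
        show ?case
        proof (rule ccontr)
          assume "\<not> lnpot z < a"
          then have "ennreal (C - lnpot z) \<le> ennreal (C - a)" by (intro ennreal_leI) simp
          with less show False by simp
        qed
      qed
    qed
  qed
qed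

end

text \<open>A minimizing sequence on a compact set is tight, and lower semicontinuity of the energy
  makes its weak limit a minimizer.\<close>

lemma equilibrium_exists:
  assumes E: "compact E" "E \<subseteq> range complex_of_real" and cap: "log_capacity E = 1"
    and diam1: "\<And>z w. z \<in> E \<Longrightarrow> w \<in> E \<Longrightarrow> dist z w + 1 \<le> exp C" and C: "0 < C"
  shows "\<exists>\<mu>. equilibrium E C \<mu>"
proof -
  have diam: "dist z w \<le> exp C" if "z \<in> E" "w \<in> E" for z w using diam1[OF that] by simp
  note cap1 = log_capacity_eq_1D[OF cap diam less_imp_le[OF C]]
  have "\<forall>i. \<exists>\<nu>. \<nu> \<in> prob_measures_on E \<and> shifted_energy C \<nu> \<le> ennreal (C + 1 / real (Suc i))"
    using cap1(2)[of "1 / real (Suc i)" for i] by (auto simp del: of_nat_Suc)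
  from choice[OF this] obtain \<nu> where
    \<nu>_all: "\<forall>i :: nat. \<nu> i \<in> prob_measures_on E \<and> shifted_energy C (\<nu> i) \<le> ennreal (C + 1 / real (Suc i))" ..
  then have \<nu>: "\<nu> i \<in> prob_measures_on E"
    and \<nu>_energy: "shifted_energy C (\<nu> i) \<le> ennreal (C + 1 / real (Suc i))" for i
    by blast+
  define T where "T = Re ` E"
  have ET: "E = of_real ` T" using E(2) by (force simp: T_def)
  have T: "compact T" using E(1) by (auto simp: T_def intro!: compact_continuous_image continuous_intros)
  have [measurable]: "T \<in> sets borel" using T by (simp add: borel_closed compact_imp_closed)
  obtain D where D: "\<And>s. s \<in> T \<Longrightarrow> \<bar>s\<bar> \<le> D"
    using compact_imp_bounded[OF T] by (auto simp: bounded_iff)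
  \<comment> \<open>The measures live on the real axis, so they are carried to the line to extract a
    limit; \<open>\<nu>_eq\<close> carries the representatives back.\<close>
  define \<rho> where "\<rho> i = distr (\<nu> i) borel Re" for i
  have Re_meas: "Re \<in> borel_measurable (\<nu> i)" for i
    using prob_measures_onD(2)[OF \<nu>, of i] by (simp cong: measurable_cong_sets)
  have AE_T: "AE t in \<rho> i. t \<in> T" for i
  proof -
    have "AE z in \<nu> i. Re z \<in> T"
      using prob_measures_onD(3)[OF \<nu>[of i]] by eventually_elim (simp add: T_def)
    then show ?thesis unfolding \<rho>_def using Re_meas by (subst AE_distr_iff) auto
  qed
  have "tight \<rho>"
  proof (rule tight_AE_bounded)
    show "real_distribution (\<rho> i)" for i
    proof -
      interpret prob_space "\<nu> i" using \<nu> by (rule prob_measures_onD)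
      have "prob_space (\<rho> i)" unfolding \<rho>_def using Re_meas by (rule prob_space_distr)
      then show ?thesis by (simp add: real_distribution_def real_distribution_axioms_def \<rho>_def)
    qed
    show "AE t in \<rho> i. \<bar>t\<bar> \<le> D" for i using AE_T[of i] by eventually_elim (rule D)
  qed
  then obtain s and \<Omega> :: "real measure" and Y_seq Y where s: "strict_mono s" and \<Omega>: "prob_space \<Omega>"
    and Y_seq[measurable]: "\<And>i. Y_seq i \<in> borel_measurable \<Omega>" and Y[measurable]: "Y \<in> borel_measurable \<Omega>"
    and distr: "\<And>i. distr \<Omega> borel (Y_seq i) = \<rho> (s i)"
    and lim: "\<And>x. x \<in> space \<Omega> \<Longrightarrow> (\<lambda>n. Y_seq n x) \<longlonglongrightarrow> Y x"
    using tight_subsequence_Skorohod[of \<rho>] by blast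
  interpret prob_space \<Omega> by fact
  have \<nu>_eq: "distr \<Omega> borel (\<lambda>x. complex_of_real (Y_seq i x)) = \<nu> (s i)" for i
  proof -
    have sets: "sets (\<nu> (s i)) = sets borel" using \<nu> by (rule prob_measures_onD)
    have "distr \<Omega> borel (\<lambda>x. complex_of_real (Y_seq i x)) = distr (distr \<Omega> borel (Y_seq i)) borel complex_of_real"
      by (subst distr_distr) (auto simp: comp_def)
    also have "\<dots> = distr (\<nu> (s i)) borel (\<lambda>z. complex_of_real (Re z))"
      unfolding distr \<rho>_def using Re_meas by (subst distr_distr) (auto simp: comp_def)
    also have "\<dots> = distr (\<nu> (s i)) borel (\<lambda>z. z)"
    proof (rule distr_cong_AE)
      show "AE z in \<nu> (s i). complex_of_real (Re z) = z"
        using prob_measures_onD(3)[OF \<nu>[of "s i"]] by eventually_elim (use E(2) in auto)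
    qed (use sets Re_meas in \<open>auto cong: measurable_cong_sets\<close>)
    also have "\<dots> = \<nu> (s i)" using sets by (simp add: distr_id2)
    finally show ?thesis .
  qed
  define \<mu> where "\<mu> = distr \<Omega> borel (\<lambda>x. complex_of_real (Y x))"
  have "shifted_energy C \<mu> = (\<integral>\<^sup>+x. \<integral>\<^sup>+y. logker C (of_real (Y x)) (of_real (Y y)) \<partial>\<Omega> \<partial>\<Omega>)"
    unfolding \<mu>_def by (rule shifted_energy_distr) (use \<Omega> in auto)
  also have "\<dots> \<le> liminf (\<lambda>n. \<integral>\<^sup>+x. \<integral>\<^sup>+y. min (logker C (of_real (Y_seq n x)) (of_real (Y_seq n y))) \<infinity> \<partial>\<Omega> \<partial>\<Omega>)"
    by (rule energy_le_liminf_truncated[OF \<Omega> Y_seq Y lim tendsto_const])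
  also have "\<dots> = liminf (\<lambda>n. shifted_energy C (\<nu> (s n)))"
    unfolding \<nu>_eq[symmetric] using \<Omega> by (subst shifted_energy_distr) auto
  also have "\<dots> \<le> liminf (\<lambda>n. ennreal (C + 1 / real (Suc (s n))))"
    using \<nu>_energy by (intro Liminf_mono always_eventually) auto
  also have "(\<lambda>n. ennreal (C + 1 / real (Suc (s n)))) \<longlonglongrightarrow> ennreal (C + 0)"
    using LIMSEQ_subseq_LIMSEQ[OF LIMSEQ_Suc[OF lim_1_over_n] s]
    by (intro tendsto_ennrealI tendsto_add tendsto_const) (simp add: comp_def)
  then have "liminf (\<lambda>n. ennreal (C + 1 / real (Suc (s n)))) = ennreal C"
    by (simp add: lim_imp_Liminf)
  finally have energy: "shifted_energy C \<mu> \<le> ennreal C" .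
  have "AE \<omega> in \<Omega>. Y \<omega> \<in> T"
  proof (rule AE_limit_in_closed[OF \<Omega> Y_seq Y lim])
    show "AE t in distr \<Omega> borel (Y_seq i). t \<in> T" for i unfolding distr by (rule AE_T)
  qed (use T in \<open>auto simp: compact_imp_closed\<close>)
  then have "AE \<omega> in \<Omega>. complex_of_real (Y \<omega>) \<in> E" by eventually_elim (simp add: ET)
  then have "\<mu> \<in> prob_measures_on E"
    unfolding prob_measures_on_compact_iff[OF E(1)] \<mu>_def
    using E(1) by (auto intro!: prob_space_distr simp: AE_distr_iff borel_closed compact_imp_closed)
  then have "equilibrium E C \<mu>"
    using E diam1 C cap1(1) energy by unfold_locales auto
  then show ?thesis ..
qed

section \<open>Limits of zero-counting measures\<close>

lemma (in equilibrium) expectation_Re_ge_2: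
  assumes nonneg: "E \<subseteq> complex_of_real ` {0..}"
  shows "2 \<le> (\<integral>w. Re w \<partial>\<mu>)"
proof -
  obtain B where B: "\<And>w. w \<in> E \<Longrightarrow> norm w \<le> B" using bounded_E by blast
  have int_Re: "integrable \<mu> Re"
  proof (rule integrable_bounded_on_E)
    show "norm (Re w) \<le> B" if "w \<in> E" for w using B[OF that] abs_Re_le_cmod[of w] by simp
  qed measurable
  have bound: "0 \<le> (\<integral>w. Re w \<partial>\<mu>) / 2 - 1 + (1 + ln (real n)) / real n" if n: "1 \<le> n" for n :: nat
  proof -
    obtain z :: "nat \<Rightarrow> complex" where z: "\<forall>s\<ge>0. (\<forall>j<n. of_real s \<noteq> z j) \<longrightarrow>
       (\<Sum>j<n. ln (dist (of_real s) (z j))) / real n \<le> s / 2 - 1 + (1 + ln (real n)) / real n"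
      using exponential_majorant[OF n] ..
    have int: "integrable \<mu> (\<lambda>w. \<Sum>j<n. ln (dist (z j) w))"
      using integral_ln_dist_nonneg(1) by (rule Bochner_Integration.integrable_sum)
    \<comment> \<open>The potential of \<mu> is finite at every \<open>z j\<close>, so \<mu> does
      not charge these points and the majorant is available almost everywhere.\<close>
    have ne: "AE w in \<mu>. \<forall>j<n. w \<noteq> z j"
      using integral_ln_dist_nonneg(3) by (simp add: AE_all_countable)
    have "0 \<le> (\<Sum>j<n. (\<integral>w. ln (dist (z j) w) \<partial>\<mu>))"
      using integral_ln_dist_nonneg(2) by (intro sum_nonneg) auto
    also have "\<dots> = (\<integral>w. (\<Sum>j<n. ln (dist (z j) w)) \<partial>\<mu>)"
      using integral_ln_dist_nonneg(1) by (rule Bochner_Integration.integral_sum[symmetric])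
    finally have "0 \<le> (\<integral>w. (\<Sum>j<n. ln (dist (z j) w)) \<partial>\<mu>) / real n" by simp
    also have "\<dots> = (\<integral>w. (\<Sum>j<n. ln (dist (z j) w)) / real n \<partial>\<mu>)" by simp
    also have "\<dots> \<le> (\<integral>w. Re w / 2 - 1 + (1 + ln (real n)) / real n \<partial>\<mu>)"
    proof (rule integral_mono_AE)
      show "AE w in \<mu>. (\<Sum>j<n. ln (dist (z j) w)) / real n \<le> Re w / 2 - 1 + (1 + ln (real n)) / real n"
        using AE_\<mu> ne
      proof eventually_elim
        case (elim w)
        then obtain s where "0 \<le> s" "w = of_real s" using nonneg by auto
        moreover have "\<forall>j<n. of_real s \<noteq> z j" using elim(2) \<open>w = of_real s\<close> by simp
        ultimately have "(\<Sum>j<n. ln (dist (of_real s) (z j))) / real n \<le> s / 2 - 1 + (1 + ln (real n)) / real n"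
          using z by blast
        then show ?case using \<open>w = of_real s\<close> by (simp add: dist_commute[of "complex_of_real s"])
      qed
    qed (use int int_Re in auto)
    also have "\<dots> = (\<integral>w. Re w \<partial>\<mu>) / 2 - 1 + (1 + ln (real n)) / real n"
      using int_Re by (simp add: prob_space)
    finally show ?thesis .
  qed
  have "(\<lambda>n. (1 + ln (real n)) / real n) \<longlonglongrightarrow> 0" by real_asymp
  then have "(\<lambda>n. (\<integral>w. Re w \<partial>\<mu>) / 2 - 1 + (1 + ln (real n)) / real n) \<longlonglongrightarrow> (\<integral>w. Re w \<partial>\<mu>) / 2 - 1 + 0"
    by (intro tendsto_add tendsto_const)
  then have "0 \<le> (\<integral>w. Re w \<partial>\<mu>) / 2 - 1 + 0"
    by (rule LIMSEQ_le_const) (use bound in blast)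
  then show ?thesis by simp
qed

section \<open>Mahler measure, discriminant and tightness in terms of the zeros\<close>

lemma proots_prod_linear:
  fixes x :: "'b \<Rightarrow> 'a::idom"
  assumes "finite A"
  shows "proots (\<Prod>k\<in>A. [:- x k, 1:]) = image_mset x (mset_set A)"
  using assms
proof (induction A rule: finite_induct)
  case (insert k A)
  have "(\<Prod>k\<in>A. [:- x k, 1:]) \<noteq> 0" using insert.hyps(1) by simp
  then have "proots (\<Prod>k\<in>insert k A. [:- x k, 1:]) = proots [:- x k, 1:] + proots (\<Prod>k\<in>A. [:- x k, 1:])"
    unfolding prod.insert[OF insert.hyps] by (rule proots_mult[rotated]) simp
  also have "\<dots> = image_mset x (mset_set (insert k A))"
    using insert by (simp add: proots_linear_factor)
  finally show ?case .
qed simp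

lemma sum_mset_filter:
  "(\<Sum>x\<in>#filter_mset Q M. f x) = (\<Sum>x\<in>#M. if Q x then f x else (0 :: 'b::comm_monoid_add))"
  by (induction M) simp_all

lemma mahler_measure_eq:
  fixes x :: "nat \<Rightarrow> complex"
  assumes "p = smult a (\<Prod>k=1..n. [:- x k, 1:])" "a \<noteq> 0"
  shows "mahler_measure E p = norm a *
    exp (\<Sum>k=1..n. if x k \<in> outside E then green_function E (x k) else 0)"
proof -
  have "proots p = image_mset x (mset_set {1..n})"
    using assms proots_prod_linear[of "{1..n}" x] by (simp add: proots_smult)
  moreover have "lead_coeff p = a" using assms by (simp add: lead_coeff_prod)
  ultimately show ?thesis
    unfolding mahler_measure_def sum_mset_filter by (simp add: sum_unfold_sum_mset image_mset.compositionality comp_def)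
qed

lemma sum_ln_differences_ge:
  fixes x :: "nat \<Rightarrow> real" and a :: complex
  assumes p: "p = smult a (\<Prod>k=1..n. [:- complex_of_real (x k), 1:])" and "a \<noteq> 0"
    and int: "\<And>i. coeff p i \<in> \<int>" and inj: "inj_on x {1..n}"
  shows "- (2 * real n * ln (norm a)) \<le> (\<Sum>j=1..n. \<Sum>k\<in>{1..n} - {j}. ln \<bar>x j - x k\<bar>)"
proof -
  let ?z = "\<lambda>i. complex_of_real (x (Suc i))"
  have ne: "x (Suc i) \<noteq> x (Suc j)" if "i < n" "j < n" "i \<noteq> j" for i j
    using inj_onD[OF inj, of "Suc i" "Suc j"] that by auto
  have pos: "0 < (\<Prod>i<n. \<Prod>j\<in>{..<n} - {i}. norm (?z i - ?z j))"
    using ne by (intro prod_pos ballI) auto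
  have "1 \<le> norm a ^ (2 * n) * (\<Prod>i<n. \<Prod>j\<in>{..<n} - {i}. norm (?z i - ?z j))"
  proof (rule discriminant_bound[OF _ \<open>a \<noteq> 0\<close> int])
    show "p = smult a (\<Prod>i<n. [:- ?z i, 1:])"
      unfolding p by (simp add: prod.atLeast1_atMost_eq)
    show "inj_on ?z {..<n}"
    proof (rule inj_onI)
      fix i j assume "i \<in> {..<n}" "j \<in> {..<n}" "?z i = ?z j"
      then show "i = j" using ne[of i j] by auto
    qed
  qed
  then have "0 \<le> ln (norm a ^ (2 * n) * (\<Prod>i<n. \<Prod>j\<in>{..<n} - {i}. norm (?z i - ?z j)))"
    by (rule ln_ge_zero)
  also have "\<dots> = 2 * real n * ln (norm a) + ln (\<Prod>i<n. \<Prod>j\<in>{..<n} - {i}. norm (?z i - ?z j))"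
  proof -
    have "ln (norm a ^ (2 * n) * Q) = 2 * real n * ln (norm a) + ln Q" if "0 < Q" for Q
      using \<open>a \<noteq> 0\<close> that by (simp add: ln_mult ln_realpow)
    then show ?thesis using pos .
  qed
  also have "ln (\<Prod>i<n. \<Prod>j\<in>{..<n} - {i}. norm (?z i - ?z j)) =
      (\<Sum>i<n. \<Sum>j\<in>{..<n} - {i}. ln (norm (?z i - ?z j)))"
  proof -
    have "ln (\<Prod>i<n. \<Prod>j\<in>{..<n} - {i}. norm (?z i - ?z j)) = (\<Sum>i<n. ln (\<Prod>j\<in>{..<n} - {i}. norm (?z i - ?z j)))"
      using ne by (intro ln_prod prod_pos) (auto intro!: prod_pos)
    also have "\<dots> = (\<Sum>i<n. \<Sum>j\<in>{..<n} - {i}. ln (norm (?z i - ?z j)))"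
      using ne by (intro sum.cong refl ln_prod) auto
    finally show ?thesis .
  qed
  also have "\<dots> = (\<Sum>i<n. \<Sum>j\<in>{..<n} - {i}. ln \<bar>x (Suc i) - x (Suc j)\<bar>)"
    by (simp only: of_real_diff[symmetric] norm_of_real)
  also have "\<dots> = (\<Sum>j=1..n. \<Sum>k\<in>{1..n} - {j}. ln \<bar>x j - x k\<bar>)"
  proof -
    have "(\<Sum>j\<in>{..<n} - {i}. ln \<bar>x (Suc i) - x (Suc j)\<bar>) = (\<Sum>k\<in>{1..n} - {Suc i}. ln \<bar>x (Suc i) - x k\<bar>)" for i
      by (rule sum.reindex_bij_witness[where i = "\<lambda>k. k - 1" and j = Suc]) auto
    then show ?thesis by (simp add: sum.atLeast1_atMost_eq)
  qed
  finally show ?thesis by simp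
qed

text \<open>Markov's inequality for ln(1 + x) under the counting measure.\<close>

lemma tight_counting_distr:
  assumes n: "\<And>i. 1 \<le> n i" and nonneg: "\<And>i k. k \<in> {1..n i} \<Longrightarrow> 0 \<le> x i k"
    and le: "\<And>i. (\<Sum>k=1..n i. ln (1 + x i k)) \<le> real (n i) * A"
  shows "tight (\<lambda>i. counting_distr (n i) (x i))"
  unfolding tight_def
proof (intro conjI allI impI)
  show "real_distribution (counting_distr (n i) (x i))" for i by (rule real_distribution_counting_distr)
  fix \<epsilon> :: real assume "0 < \<epsilon>"
  have "0 \<le> (\<Sum>k=1..n 0. ln (1 + x 0 k))"
    using nonneg[of _ 0] by (intro sum_nonneg ln_ge_zero) simp
  with le[of 0] have "0 \<le> real (n 0) * A" by (rule order_trans[rotated])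
  then have "0 \<le> A" using n[of 0] by (simp add: zero_le_mult_iff)
  \<comment> \<open>Each point beyond b contributes at least A/\<epsilon> + 1 to the sum of
    logarithms, so fewer than an \<epsilon>-fraction of the points lie there; the +1 makes this
    strict also for A = 0.\<close>
  define b where "b = exp (A / \<epsilon> + 1)"
  have b: "0 < b" by (simp add: b_def)
  have "1 - \<epsilon> < measure (counting_distr (n i) (x i)) {-1<..b}" for i
  proof -
    let ?S = "{k \<in> {1..n i}. b < x i k}"
    have "real (card ?S) * (A / \<epsilon> + 1) = (\<Sum>k\<in>?S. ln b)" by (simp add: b_def)
    also have "\<dots> \<le> (\<Sum>k\<in>?S. ln (1 + x i k))"
      using b by (intro sum_mono) auto
    also have "\<dots> \<le> (\<Sum>k=1..n i. ln (1 + x i k))"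
      using nonneg by (intro sum_mono2) auto
    also have "\<dots> \<le> real (n i) * A" by (rule le)
    finally have "real (card ?S) * (A + \<epsilon>) \<le> real (n i) * A * \<epsilon>"
      using \<open>0 < \<epsilon>\<close> by (simp add: field_simps)
    also have "\<dots> < real (n i) * (A + \<epsilon>) * \<epsilon>"
      using n[of i] \<open>0 < \<epsilon>\<close> by (intro mult_strict_right_mono) auto
    finally have "(A + \<epsilon>) * real (card ?S) < (A + \<epsilon>) * (real (n i) * \<epsilon>)" by (simp add: mult_ac)
    then have S: "real (card ?S) < real (n i) * \<epsilon>"
      using \<open>0 \<le> A\<close> \<open>0 < \<epsilon>\<close> by (simp add: mult_less_cancel_left)
    have eq: "{1..n i} \<inter> x i -` {-1<..b} = {1..n i} - ?S"
      using nonneg[of _ i] by fastforce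
    have "measure (counting_distr (n i) (x i)) {-1<..b} = measure (measure_pmf (pmf_of_set {1..n i})) (x i -` {-1<..b})"
      unfolding counting_distr_def by (subst measure_distr) auto
    also have "\<dots> = real (card ({1..n i} \<inter> x i -` {-1<..b})) / real (card {1..n i})"
      by (rule measure_pmf_of_set) (use n[of i] in auto)
    also have "\<dots> = real (card ({1..n i} - ?S)) / real (n i)"
      unfolding eq by simp
    also have "card ({1..n i} - ?S) = n i - card ?S" by (subst card_Diff_subset) auto
    also have "real (n i - card ?S) = real (n i) - real (card ?S)"
    proof (rule of_nat_diff)
      have "card ?S \<le> card {1..n i}" by (rule card_mono) auto
      then show "card ?S \<le> n i" by simp
    qed
    finally have "measure (counting_distr (n i) (x i)) {-1<..b} = 1 - real (card ?S) / real (n i)"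
      using n[of i] by (simp add: diff_divide_distrib)
    moreover have "real (card ?S) / real (n i) < \<epsilon>"
      using S n[of i] by (simp add: pos_divide_less_eq mult.commute)
    ultimately show ?thesis by linarith
  qed
  then show "\<exists>a b. a < b \<and> (\<forall>i. 1 - \<epsilon> < measure (counting_distr (n i) (x i)) {a<..b})"
    using b by (intro exI[of _ "-1"] exI[of _ b]) auto
qed

section \<open>The Green function on the half-line\<close>

text \<open>The value 0 on \<open>E\<close> drops the zeros in \<open>E\<close> from sums, as the
  filter in \<open>mahler_measure\<close> does. It also makes the function lower semicontinuous,
  since it is nonnegative everywhere and continuous off \<open>E\<close>.\<close>

definition green_on_line :: "complex set \<Rightarrow> real \<Rightarrow> real" where
  "green_on_line E x = (if complex_of_real x \<in> E then 0 else green_function E (of_real x))"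

text \<open>The existence proof turns the choice by \<open>SOME\<close> into a function with the
  defining clauses, which later proofs then use.\<close>

lemma (in equilibrium) is_green_function_green_function: "is_green_function E (green_function E)"
  unfolding green_function_def by (rule someI[of "is_green_function E", OF is_green_function_lnpot])

lemma green_on_line_continuous:
  assumes E: "compact E" "E \<subseteq> range complex_of_real" and green: "is_green_function E (green_function E)"
    and x: "complex_of_real x \<notin> E"
  shows "isCont (green_on_line E) x"
proof -
  have op: "open (- E)" using E(1) by (simp add: open_Compl compact_imp_closed)
  have "green_function E harmonic_on - E"
    using green unfolding is_green_function_def outside_compact_real[OF E] by blast
  then have "continuous_on (- E) (green_function E)" by (rule harmonic_on_imp_continuous_on)
  then have "isCont (green_function E) (of_real x)"
    using op x by (simp add: continuous_on_eq_continuous_at)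
  then have cont: "isCont (\<lambda>y. green_function E (complex_of_real y)) x"
    by (rule isCont_o2[rotated]) (intro continuous_intros)
  have "open (of_real -` (- E) :: real set)"
    by (intro open_vimage op continuous_intros)
  then have "\<forall>\<^sub>F y in nhds x. y \<in> of_real -` (- E)" using x by (intro eventually_nhds_in_open) auto
  then have "\<forall>\<^sub>F y in nhds x. green_on_line E y = green_function E (of_real y)"
    by eventually_elim (simp add: green_on_line_def)
  from isCont_cong[OF this] show ?thesis using cont by simp
qed

lemma measurable_green_on_line:
  assumes E: "compact E" "E \<subseteq> range complex_of_real" and green: "is_green_function E (green_function E)"
  shows "green_on_line E \<in> borel_measurable borel"
proof -
  let ?A = "of_real -` (- E) :: real set"
  have op: "open (- E)" using E(1) by (simp add: open_Compl compact_imp_closed)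
  have "open ?A" by (intro open_vimage op continuous_intros)
  then have A: "?A \<in> sets borel" by (rule borel_open)
  have "continuous_on ?A (green_on_line E)"
    using green_on_line_continuous[OF E green] by (intro continuous_at_imp_continuous_on) auto
  then have "(\<lambda>x. indicator ?A x *\<^sub>R green_on_line E x) \<in> borel_measurable borel"
    using A by (intro borel_measurable_continuous_on_indicator)
  moreover have "indicator ?A x *\<^sub>R green_on_line E x = green_on_line E x" for x
    by (simp add: green_on_line_def indicator_def)
  ultimately show ?thesis by (simp only:)
qed

lemma green_on_line_nonneg:
  assumes "compact E" "E \<subseteq> range complex_of_real" "is_green_function E (green_function E)"
  shows "0 \<le> green_on_line E x"
  using green_function_pos[OF assms, of x] by (auto simp: green_on_line_def)

text \<open>The pole at infinity gives the bound for large x, and nonnegativity absorbs the bounded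
  range. The inequality yields tightness and compensates for far-away zeros in the energy.\<close>

lemma ln_le_green_on_line:
  assumes E: "compact E" "E \<subseteq> range complex_of_real" and green: "is_green_function E (green_function E)"
  shows "\<exists>c0. \<forall>x\<ge>0. ln (1 + x) \<le> green_on_line E x + c0"
proof -
  let ?g = "green_function E"
  have "(\<lambda>z. ?g z - ln (norm z)) \<in> O[at_infinity](\<lambda>_. 1)"
    using green unfolding is_green_function_def by blast
  then obtain c where "\<forall>\<^sub>F z in at_infinity. norm (?g z - ln (norm z)) \<le> c * norm (1 :: real)"
    by (rule landau_o.bigE)
  then obtain b where b: "\<And>z. b \<le> norm z \<Longrightarrow> \<bar>?g z - ln (norm z)\<bar> \<le> c"
    by (auto simp: eventually_at_infinity)
  obtain D where D: "\<And>z. z \<in> E \<Longrightarrow> norm z \<le> D"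
    using compact_imp_bounded[OF E(1)] by (auto simp: bounded_iff)
  define r where "r = \<bar>b\<bar> + \<bar>D\<bar> + 1"
  have "ln (1 + x) \<le> green_on_line E x + (ln (1 + r) + \<bar>c\<bar> + ln 2)" if x: "0 \<le> x" for x
  proof (cases "x \<le> r")
    case True
    then have "ln (1 + x) \<le> ln (1 + r)" using x by (subst ln_le_cancel_iff) auto
    moreover have "0 \<le> ln (2 :: real)" by simp
    ultimately show ?thesis using green_on_line_nonneg[OF E green, of x] by linarith
  next
    case False
    then have big: "r < x" by simp
    then have "complex_of_real x \<notin> E" using D[of "of_real x"] x by (auto simp: r_def)
    then have "green_on_line E x = ?g (of_real x)" by (simp add: green_on_line_def)
    moreover have "b \<le> norm (complex_of_real x)" using big x by (simp add: r_def)
    from b[OF this] have "\<bar>?g (of_real x) - ln x\<bar> \<le> c" using x by simp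
    moreover have "ln (1 + x) \<le> ln (2 * x)" using big by (subst ln_le_cancel_iff) (auto simp: r_def)
    moreover have "ln (2 * x) = ln 2 + ln x" using big by (subst ln_mult) (auto simp: r_def)
    moreover have "0 \<le> ln (1 + r)" by (simp add: r_def)
    ultimately show ?thesis by linarith
  qed
  then show ?thesis by blast
qed

section \<open>Passage to the limit along a sequence of polynomials\<close>

text \<open>The discriminant bound and the Green function terms add up exactly to
  \<open>2 * v i * n^2\<close>, where \<open>v i\<close> is the logarithm of the n-th root of the
  Mahler measure and tends to 0. The weak limit thus has shifted energy at most C, the minimum; once
  it is known to live on \<open>E\<close>, it is an equilibrium measure and its mean is at least
  2.\<close>

lemma zero_limit_expectation:
  fixes n :: "nat \<Rightarrow> nat" and x :: "nat \<Rightarrow> nat \<Rightarrow> real" and l :: "nat \<Rightarrow> real"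
  assumes E: "compact E" "E \<subseteq> complex_of_real ` {0..}" and cap: "log_capacity E = 1"
    and n: "filterlim n at_top sequentially" "\<And>i. 1 \<le> n i"
    and nonneg: "\<And>i k. k \<in> {1..n i} \<Longrightarrow> 0 \<le> x i k"
    and inj: "\<And>i. inj_on (x i) {1..n i}"
    and l: "\<And>i. 0 \<le> l i"
    and disc: "\<And>i. - (2 * real (n i) * l i) \<le> (\<Sum>j=1..n i. \<Sum>k\<in>{1..n i} - {j}. ln \<bar>x i j - x i k\<bar>)"
    and mahler: "(\<lambda>i. (l i + (\<Sum>k=1..n i. green_on_line E (x i k))) / real (n i)) \<longlonglongrightarrow> 0"
    and mahler_le: "\<And>i. (l i + (\<Sum>k=1..n i. green_on_line E (x i k))) / real (n i) \<le> 1"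
    and R: "E \<subseteq> cball 0 R" and c: "\<And>i. (\<Sum>k=1..n i. min (x i k) R) / real (n i) \<le> c"
  shows "2 \<le> c"
proof -
  have Er: "E \<subseteq> range complex_of_real" using E(2) by auto
  define G where "G = green_on_line E"
  define v where "v i = (l i + (\<Sum>k=1..n i. G (x i k))) / real (n i)" for i
  have v0: "v \<longlonglongrightarrow> 0" and v1: "v i \<le> 1" for i using mahler mahler_le by (simp_all add: v_def[abs_def] G_def)
  obtain c1 where "0 < c1" "\<And>z w. z \<in> E \<Longrightarrow> w \<in> E \<Longrightarrow> dist z w + 1 \<le> exp (2 * c1)"
    "is_green_function E (green_function E)" "\<And>x. 0 \<le> x \<Longrightarrow> ln (1 + x) \<le> G x + c1"
  proof -
    define C0 where "C0 = ln (2 * \<bar>R\<bar> + 2)"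
    have C0: "0 < C0" "exp C0 = 2 * \<bar>R\<bar> + 2" by (auto simp: C0_def)
    have diam0: "dist z w + 1 \<le> exp C0" if "z \<in> E" "w \<in> E" for z w
    proof -
      have "norm z \<le> R" "norm w \<le> R" using that R by auto
      then have "dist z w \<le> 2 * R" using norm_triangle_ineq4[of z w] by (simp add: dist_norm)
      then show ?thesis using C0 by simp
    qed
    \<comment> \<open>This measure only secures the Green function; the equilibrium measure used for
      the mean is the limit of the zeros, built below with a possibly larger constant.\<close>
    obtain \<mu> where "equilibrium E C0 \<mu>"
      using equilibrium_exists[OF E(1) Er cap diam0 C0(1)] by blast
    then have green: "is_green_function E (green_function E)"
      by (rule equilibrium.is_green_function_green_function)
    obtain c0 where c0: "\<And>x. 0 \<le> x \<Longrightarrow> ln (1 + x) \<le> G x + c0"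
      using ln_le_green_on_line[OF E(1) Er green] unfolding G_def by blast
    show ?thesis
    \<comment> \<open>One constant serves twice: it is the additive error in \<open>ln_G\<close>,
      and its double is the shift C, so that each of the two arguments of the kernel can carry half
      of C.\<close>
    proof (rule that[of "\<bar>c0\<bar> + C0"])
      have "exp C0 \<le> exp (2 * (\<bar>c0\<bar> + C0))" using C0(1) by simp
      then show "dist z w + 1 \<le> exp (2 * (\<bar>c0\<bar> + C0))" if "z \<in> E" "w \<in> E" for z w
        using diam0[OF that] by linarith
      show "ln (1 + x) \<le> G x + (\<bar>c0\<bar> + C0)" if "0 \<le> x" for x using c0[OF that] C0(1) by linarith
    qed (use C0 green in auto)
  qed
  note c1 = this(1) and diam = this(2) and green = this(3) and ln_G = this(4)
  define C where "C = 2 * c1"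
  have C: "0 < C" using c1 by (simp add: C_def)
  have G_nonneg: "0 \<le> G x" for x unfolding G_def by (rule green_on_line_nonneg[OF E(1) Er green])
  have v_nonneg: "0 \<le> v i" for i
    unfolding v_def using l G_nonneg by (intro divide_nonneg_nonneg add_nonneg_nonneg sum_nonneg) auto
  have nv: "real (n i) * v i = l i + (\<Sum>k=1..n i. G (x i k))" for i
    using n(2)[of i] by (simp add: v_def)
  have sum_G: "(\<Sum>k=1..n i. G (x i k)) \<le> real (n i) * v i" for i
    using l[of i] by (simp add: nv)
  have tight: "tight (\<lambda>i. counting_distr (n i) (x i))"
  proof (rule tight_counting_distr[OF n(2) nonneg])
    fix i
    have "(\<Sum>k=1..n i. ln (1 + x i k)) \<le> (\<Sum>k=1..n i. G (x i k) + c1)"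
      using nonneg by (intro sum_mono ln_G) auto
    also have "\<dots> = (\<Sum>k=1..n i. G (x i k)) + real (n i) * c1" by (simp add: sum.distrib)
    also have "\<dots> \<le> real (n i) * v i + real (n i) * c1" using sum_G by simp
    also have "\<dots> \<le> real (n i) * (1 + c1)"
      using v1[of i] by (simp add: distrib_left mult_left_le)
    finally show "(\<Sum>k=1..n i. ln (1 + x i k)) \<le> real (n i) * (1 + c1)" .
  qed
  have energy: "(\<Sum>j=1..n i. \<Sum>k\<in>{1..n i} - {j}. logker C (of_real (x i j)) (of_real (x i k))) \<le>
      ennreal ((C + 2 * v i) * real (n i) ^ 2)" for i
  proof -
    let ?I = "{1..n i}" and ?x = "x i"
    \<comment> \<open>For nonnegative reals |x - y| \<le> (1 + x)(1 + y), and \<open>ln_G\<close>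
      bounds ln of each factor by c1 + G. The sum is therefore nonnegative however far the zeros
      spread, and it still dominates the kernel.\<close>
    let ?f = "\<lambda>j k. (c1 + G (?x j)) + (c1 + G (?x k)) - ln \<bar>?x j - ?x k\<bar>"
    have ne: "?x j \<noteq> ?x k" if "j \<in> ?I" "k \<in> ?I - {j}" for j k
      using inj_onD[OF inj[of i], of j k] that by auto
    have f: "0 \<le> ?f j k" if jk: "j \<in> ?I" "k \<in> ?I - {j}" for j k
    proof -
      have xj: "0 \<le> ?x j" and xk: "0 \<le> ?x k" using nonneg jk by auto
      have "\<bar>?x j - ?x k\<bar> \<le> (1 + ?x j) * (1 + ?x k)"
        using xj xk mult_nonneg_nonneg[OF xj xk] by (simp add: algebra_simps abs_le_iff)
      then have "ln \<bar>?x j - ?x k\<bar> \<le> ln ((1 + ?x j) * (1 + ?x k))"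
        using ne[OF jk] xj xk by (subst ln_le_cancel_iff) (auto intro!: mult_pos_pos)
      also have "\<dots> = ln (1 + ?x j) + ln (1 + ?x k)" using xj xk by (subst ln_mult) auto
      finally show ?thesis using ln_G[OF xj] ln_G[OF xk] by linarith
    qed
    have "(\<Sum>j\<in>?I. \<Sum>k\<in>?I - {j}. logker C (of_real (?x j)) (of_real (?x k))) \<le> (\<Sum>j\<in>?I. \<Sum>k\<in>?I - {j}. ennreal (?f j k))"
    proof (intro sum_mono)
      fix j k assume jk: "j \<in> ?I" "k \<in> ?I - {j}"
      have "C - ln \<bar>?x j - ?x k\<bar> \<le> ?f j k"
        using G_nonneg[of "?x j"] G_nonneg[of "?x k"] by (simp add: C_def)
      then show "logker C (of_real (?x j)) (of_real (?x k)) \<le> ennreal (?f j k)"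
        using ne[OF jk] by (simp add: logker_def dist_real_def ennreal_leI)
    qed
    also have "\<dots> = (\<Sum>j\<in>?I. ennreal (\<Sum>k\<in>?I - {j}. ?f j k))"
      by (rule sum.cong[OF refl], rule sum_ennreal, rule f)
    also have "\<dots> = ennreal (\<Sum>j\<in>?I. \<Sum>k\<in>?I - {j}. ?f j k)"
      by (rule sum_ennreal, rule sum_nonneg, rule f)
    also have "\<dots> \<le> ennreal ((C + 2 * v i) * real (n i) ^ 2)"
    proof (rule ennreal_leI)
      have "(\<Sum>j\<in>?I. \<Sum>k\<in>?I - {j}. ?f j k) =
          (\<Sum>j\<in>?I. \<Sum>k\<in>?I - {j}. (c1 + G (?x j)) + (c1 + G (?x k))) - (\<Sum>j\<in>?I. \<Sum>k\<in>?I - {j}. ln \<bar>?x j - ?x k\<bar>)"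
        by (simp only: sum_subtractf)
      also have "(\<Sum>j\<in>?I. \<Sum>k\<in>?I - {j}. (c1 + G (?x j)) + (c1 + G (?x k))) \<le>
          (\<Sum>j\<in>?I. \<Sum>k\<in>?I. (c1 + G (?x j)) + (c1 + G (?x k)))"
        using c1 G_nonneg by (intro sum_mono sum_mono2) (auto intro!: add_nonneg_nonneg)
      also have "\<dots> = real (n i) ^ 2 * C + 2 * real (n i) * (\<Sum>k\<in>?I. G (?x k))"
        by (simp add: sum.distrib C_def power2_eq_square algebra_simps sum_distrib_left)
      finally have "(\<Sum>j\<in>?I. \<Sum>k\<in>?I - {j}. ?f j k) \<le>
          real (n i) ^ 2 * C + 2 * real (n i) * (\<Sum>k\<in>?I. G (?x k)) + 2 * real (n i) * l i"
        using disc[of i] by linarith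
      also have "\<dots> = real (n i) ^ 2 * C + 2 * real (n i) * (real (n i) * v i)"
        unfolding nv by (simp add: algebra_simps)
      also have "\<dots> = (C + 2 * v i) * real (n i) ^ 2" by (simp add: power2_eq_square algebra_simps)
      finally show "(\<Sum>j\<in>?I. \<Sum>k\<in>?I - {j}. ?f j k) \<le> (C + 2 * v i) * real (n i) ^ 2" .
    qed
    finally show ?thesis .
  qed
  have "(\<lambda>i. C + 2 * v i) \<longlonglongrightarrow> C + 2 * 0" by (intro tendsto_intros v0)
  then have D: "(\<lambda>i. C + 2 * v i) \<longlonglongrightarrow> C" by simp
  have D0: "0 \<le> C + 2 * v i" for i using C v_nonneg[of i] by linarith
  obtain s and \<Omega> :: "real measure" and Y_seq Y where s: "strict_mono s" and \<Omega>: "prob_space \<Omega>"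
    and Y_seq: "\<forall>i. Y_seq i \<in> borel_measurable \<Omega> \<and> distr \<Omega> borel (Y_seq i) = counting_distr (n (s i)) (x (s i))"
    and Y[measurable]: "Y \<in> borel_measurable \<Omega>" and lim: "\<forall>\<omega>\<in>space \<Omega>. (\<lambda>i. Y_seq i \<omega>) \<longlonglongrightarrow> Y \<omega>"
    and limit_energy: "shifted_energy C (distr \<Omega> borel (\<lambda>\<omega>. complex_of_real (Y \<omega>))) \<le> ennreal C"
    using discrete_energy_limit[OF n tight energy D D0] by blast
  interpret prob_space \<Omega> by fact
  have Ym[measurable]: "Y_seq i \<in> borel_measurable \<Omega>" for i using Y_seq by blast
  have integral_Y_seq: "(\<integral>\<^sup>+\<omega>. ennreal (h (Y_seq i \<omega>)) \<partial>\<Omega>) = ennreal ((\<Sum>k=1..n (s i). h (x (s i) k)) / real (n (s i)))"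
    if h[measurable]: "h \<in> borel_measurable borel" and pos: "\<And>k. k \<in> {1..n (s i)} \<Longrightarrow> 0 \<le> h (x (s i) k)" for h :: "real \<Rightarrow> real" and i
  proof -
    have "(\<integral>\<^sup>+\<omega>. ennreal (h (Y_seq i \<omega>)) \<partial>\<Omega>) = (\<integral>\<^sup>+y. ennreal (h y) \<partial>distr \<Omega> borel (Y_seq i))"
      by (subst nn_integral_distr) auto
    also have "\<dots> = (\<Sum>k=1..n (s i). ennreal (h (x (s i) k))) / of_nat (n (s i))"
      using Y_seq n(2)[of "s i"] by (simp add: nn_integral_counting_distr)
    also have "\<dots> = ennreal (\<Sum>k=1..n (s i). h (x (s i) k)) / ennreal (real (n (s i)))"
    proof -
      have "(\<Sum>k=1..n (s i). ennreal (h (x (s i) k))) = ennreal (\<Sum>k=1..n (s i). h (x (s i) k))"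
        by (rule sum_ennreal) (rule pos)
      then show ?thesis by (simp only: ennreal_of_nat_eq_real_of_nat)
    qed
    also have "\<dots> = ennreal ((\<Sum>k=1..n (s i). h (x (s i) k)) / real (n (s i)))"
      using n(2)[of "s i"] pos by (intro divide_ennreal sum_nonneg) auto
    finally show ?thesis .
  qed
  have G_meas[measurable]: "G \<in> borel_measurable borel"
    unfolding G_def by (rule measurable_green_on_line[OF E(1) Er green])
  \<comment> \<open>Lower semicontinuity of \<open>G\<close> and Fatou's lemma force its integral
    against the limit to be 0; as \<open>G\<close> is strictly positive off \<open>E\<close>, the
    limit lies in \<open>E\<close> almost surely.\<close>
  have "(\<integral>\<^sup>+\<omega>. ennreal (G (Y \<omega>)) \<partial>\<Omega>) \<le> (\<integral>\<^sup>+\<omega>. liminf (\<lambda>i. ennreal (G (Y_seq i \<omega>))) \<partial>\<Omega>)"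
  proof (rule nn_integral_mono)
    fix \<omega> assume \<omega>: "\<omega> \<in> space \<Omega>"
    show "ennreal (G (Y \<omega>)) \<le> liminf (\<lambda>i. ennreal (G (Y_seq i \<omega>)))"
    proof (cases "complex_of_real (Y \<omega>) \<in> E")
      case False
      then have "isCont G (Y \<omega>)" unfolding G_def by (rule green_on_line_continuous[OF E(1) Er green])
      then have "(\<lambda>i. G (Y_seq i \<omega>)) \<longlonglongrightarrow> G (Y \<omega>)" by (rule isCont_tendsto_compose[OF _ bspec[OF lim \<omega>]])
      then have "(\<lambda>i. ennreal (G (Y_seq i \<omega>))) \<longlonglongrightarrow> ennreal (G (Y \<omega>))" by (rule tendsto_ennrealI)
      then show ?thesis by (simp add: lim_imp_Liminf)
    qed (simp add: G_def green_on_line_def)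
  qed
  also have "\<dots> \<le> liminf (\<lambda>i. \<integral>\<^sup>+\<omega>. ennreal (G (Y_seq i \<omega>)) \<partial>\<Omega>)"
    by (rule nn_integral_liminf) measurable
  also have "\<dots> \<le> liminf (\<lambda>i. ennreal (v (s i)))"
  proof (intro Liminf_mono always_eventually allI)
    fix i
    have "(\<Sum>k=1..n (s i). G (x (s i) k)) / real (n (s i)) \<le> v (s i)"
      using l[of "s i"] by (simp add: v_def divide_right_mono)
    then show "(\<integral>\<^sup>+\<omega>. ennreal (G (Y_seq i \<omega>)) \<partial>\<Omega>) \<le> ennreal (v (s i))"
      using G_nonneg by (subst integral_Y_seq[OF G_meas]) (auto intro: ennreal_leI)
  qed
  also have "liminf (\<lambda>i. ennreal (v (s i))) = 0"
  proof -
    have "(\<lambda>i. ennreal (v (s i))) \<longlonglongrightarrow> ennreal 0"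
      using LIMSEQ_subseq_LIMSEQ[OF v0 s] by (intro tendsto_ennrealI) (simp add: comp_def)
    then show ?thesis by (simp add: lim_imp_Liminf)
  qed
  finally have "(\<integral>\<^sup>+\<omega>. ennreal (G (Y \<omega>)) \<partial>\<Omega>) = 0" by simp
  then have "AE \<omega> in \<Omega>. ennreal (G (Y \<omega>)) = 0" by (subst (asm) nn_integral_0_iff_AE) auto
  then have AE_E: "AE \<omega> in \<Omega>. complex_of_real (Y \<omega>) \<in> E"
  proof eventually_elim
    case (elim \<omega>)
    show ?case
    proof (rule ccontr)
      assume "complex_of_real (Y \<omega>) \<notin> E"
      then have "0 < G (Y \<omega>)"
        using green_function_pos[OF E(1) Er green] by (simp add: G_def green_on_line_def)
      then show False using elim by (simp add: ennreal_eq_0_iff)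
    qed
  qed
  define \<mu> where "\<mu> = distr \<Omega> borel (\<lambda>\<omega>. complex_of_real (Y \<omega>))"
  have "\<mu> \<in> prob_measures_on E"
    unfolding prob_measures_on_compact_iff[OF E(1)] \<mu>_def
    using E(1) AE_E by (auto intro!: prob_space_distr simp: AE_distr_iff borel_closed compact_imp_closed)
  moreover have "ennreal C \<le> shifted_energy C \<sigma>" if "\<sigma> \<in> prob_measures_on E" for \<sigma>
  proof (rule log_capacity_eq_1D(1)[OF cap _ _ that])
    show "dist z w \<le> exp C" if "z \<in> E" "w \<in> E" for z w using diam[OF that] by (simp add: C_def)
  qed (use C in simp)
  ultimately have "equilibrium E C \<mu>"
    using E(1) Er diam C limit_energy unfolding \<mu>_def C_def by unfold_locales auto
  then have "2 \<le> (\<integral>w. Re w \<partial>\<mu>)" using E(2) by (rule equilibrium.expectation_Re_ge_2)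
  also have "(\<integral>w. Re w \<partial>\<mu>) = (\<integral>\<omega>. Y \<omega> \<partial>\<Omega>)"
    unfolding \<mu>_def by (subst integral_distr) auto
  finally have mean: "2 \<le> (\<integral>\<omega>. Y \<omega> \<partial>\<Omega>)" .
  have Y_bounds: "AE \<omega> in \<Omega>. 0 \<le> Y \<omega> \<and> Y \<omega> \<le> R"
    using AE_E
  proof eventually_elim
    case (elim \<omega>)
    then have "complex_of_real (Y \<omega>) \<in> cball 0 R" "complex_of_real (Y \<omega>) \<in> complex_of_real ` {0..}"
      using E(2) R by auto
    then show ?case by auto
  qed
  have int_Y: "integrable \<Omega> Y"
    by (rule integrable_const_bound[where B = R]) (use Y_bounds in eventually_elim, auto)
  have min_meas: "(\<lambda>y :: real. min y R) \<in> borel_measurable borel" by measurable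
  \<comment> \<open>The limit takes values in [0, R], so truncation at R leaves its mean unchanged,
    although means of untruncated zeros need not converge to it.\<close>
  have "ennreal 2 \<le> ennreal (\<integral>\<omega>. Y \<omega> \<partial>\<Omega>)" using mean by (rule ennreal_leI)
  also have "\<dots> = (\<integral>\<^sup>+\<omega>. ennreal (Y \<omega>) \<partial>\<Omega>)"
    using int_Y Y_bounds by (intro nn_integral_eq_integral[symmetric]) (auto elim: eventually_mono)
  also have "\<dots> = (\<integral>\<^sup>+\<omega>. liminf (\<lambda>i. ennreal (min (Y_seq i \<omega>) R)) \<partial>\<Omega>)"
  proof (rule nn_integral_cong_AE)
    show "AE \<omega> in \<Omega>. ennreal (Y \<omega>) = liminf (\<lambda>i. ennreal (min (Y_seq i \<omega>) R))"
      using Y_bounds AE_space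
    proof eventually_elim
      case (elim \<omega>)
      have "(\<lambda>i. ennreal (min (Y_seq i \<omega>) R)) \<longlonglongrightarrow> ennreal (min (Y \<omega>) R)"
        using lim elim by (intro tendsto_ennrealI tendsto_min tendsto_const) auto
      then show ?case using elim by (simp add: lim_imp_Liminf)
    qed
  qed
  also have "\<dots> \<le> liminf (\<lambda>i. \<integral>\<^sup>+\<omega>. ennreal (min (Y_seq i \<omega>) R) \<partial>\<Omega>)"
    by (rule nn_integral_liminf) measurable
  also have "\<dots> \<le> liminf (\<lambda>i. ennreal c)"
  proof (intro Liminf_mono always_eventually allI)
    fix i
    have "0 \<le> R"
    proof (rule ccontr)
      assume "\<not> 0 \<le> R"
      from Y_bounds have "AE \<omega> in \<Omega>. False"
        by eventually_elim (use \<open>\<not> 0 \<le> R\<close> in linarith)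
      then show False by simp
    qed
    then show "(\<integral>\<^sup>+\<omega>. ennreal (min (Y_seq i \<omega>) R) \<partial>\<Omega>) \<le> ennreal c"
      using nonneg c by (subst integral_Y_seq[OF min_meas]) (auto intro: ennreal_leI)
  qed
  also have "\<dots> = ennreal c" by (simp add: Liminf_const)
  finally show "2 \<le> c" by (cases "0 \<le> c") (auto simp: ennreal_neg)
qed

text \<open>If the bound fails infinitely often, enumerating the bad degrees gives a sequence to
  which \<open>zero_limit_expectation\<close> applies, and c \<ge> 2 follows.\<close>

lemma truncated_mean_eventually_ge:
  fixes N :: "nat set" and E :: "complex set" and P :: "nat \<Rightarrow> complex poly"
    and a :: "nat \<Rightarrow> complex" and \<alpha> :: "nat \<Rightarrow> nat \<Rightarrow> real"
  assumes "N \<subseteq> {1..}"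
    and E: "compact E" "E \<subseteq> complex_of_real ` {0..}" and cap: "log_capacity E = 1"
    and P: "\<And>n. n \<in> N \<Longrightarrow> P n = smult (a n) (\<Prod>k=1..n. [:- complex_of_real (\<alpha> k n), 1:])"
    and a: "\<And>n. n \<in> N \<Longrightarrow> a n \<noteq> 0" and int: "\<And>n i. n \<in> N \<Longrightarrow> coeff (P n) i \<in> \<int>"
    and nonneg: "\<And>n k. n \<in> N \<Longrightarrow> k \<in> {1..n} \<Longrightarrow> 0 \<le> \<alpha> k n"
    and inj: "\<And>n. n \<in> N \<Longrightarrow> inj_on (\<lambda>k. \<alpha> k n) {1..n}"
    and lim: "((\<lambda>n. mahler_measure E (P n) powr (1 / real n)) \<longlongrightarrow> 1) (inf sequentially (principal N))"
    and R: "E \<subseteq> cball 0 R" and "c < 2"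
  shows "\<forall>\<^sub>F n in inf sequentially (principal N). c \<le> (\<Sum>k=1..n. min (\<alpha> k n) R) / real n"
proof (rule ccontr)
  let ?F = "inf sequentially (principal N)"
  let ?mean = "\<lambda>n. (\<Sum>k=1..n. min (\<alpha> k n) R) / real n"
  assume not: "\<not> (\<forall>\<^sub>F n in ?F. c \<le> ?mean n)"
  have N1: "1 \<le> n" if "n \<in> N" for n using that \<open>N \<subseteq> {1..}\<close> by auto
  have Er: "E \<subseteq> range complex_of_real" using E(2) by auto
  define v where "v n = (ln (norm (a n)) + (\<Sum>k=1..n. green_on_line E (\<alpha> k n))) / real n" for n
  have measure_eq: "mahler_measure E (P n) powr (1 / real n) = exp (v n)" if n: "n \<in> N" for n
  proof -
    have "mahler_measure E (P n) = norm (a n) * exp (\<Sum>k=1..n. green_on_line E (\<alpha> k n))"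
    proof -
      have eq: "(if complex_of_real x \<in> - E then green_function E (of_real x) else 0) = green_on_line E x" for x
        by (simp add: green_on_line_def)
      show ?thesis
        unfolding mahler_measure_eq[OF P[OF n] a[OF n]] outside_compact_real[OF E(1) Er] eq ..
    qed
    also have "\<dots> = exp (ln (norm (a n)) + (\<Sum>k=1..n. green_on_line E (\<alpha> k n)))"
      using a[OF n] by (simp add: exp_add)
    finally show ?thesis by (simp add: powr_def v_def)
  qed
  have "\<forall>\<^sub>F n in ?F. n \<in> N" by (simp add: eventually_inf_principal)
  then have "\<forall>\<^sub>F n in ?F. mahler_measure E (P n) powr (1 / real n) = exp (v n)"
    by eventually_elim (rule measure_eq)
  from tendsto_cong[OF this] lim have "((\<lambda>n. exp (v n)) \<longlongrightarrow> 1) ?F" by simp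
  then have "((\<lambda>n. ln (exp (v n))) \<longlongrightarrow> ln 1) ?F" by (intro tendsto_ln) auto
  then have v0: "(v \<longlongrightarrow> 0) ?F" by simp
  then have v1: "\<forall>\<^sub>F n in ?F. v n < 1" by (rule order_tendstoD) simp
  \<comment> \<open>The condition v n \<le> 1 holds eventually in N; building it into
    \<open>A\<close> makes it available at every index of the subsequence, where tightness asks for
    it.\<close>
  define A where "A = {n \<in> N. ?mean n < c \<and> v n \<le> 1}"
  have "infinite A"
  proof
    assume "finite A"
    then have "\<forall>\<^sub>F n in sequentially. n \<notin> A"
      by (simp add: eventually_cofinite flip: cofinite_eq_sequentially)
    then have "\<forall>\<^sub>F n in ?F. n \<notin> A" by (rule filter_leD[OF inf_le1])
    with v1 \<open>\<forall>\<^sub>F n in ?F. n \<in> N\<close> have "\<forall>\<^sub>F n in ?F. c \<le> ?mean n"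
      by eventually_elim (auto simp: A_def)
    then show False using not by blast
  qed
  define r where "r = enumerate A"
  have r: "strict_mono r" using \<open>infinite A\<close> by (simp add: r_def strict_mono_enumerate)
  have rA: "r i \<in> A" for i using \<open>infinite A\<close> by (simp add: r_def enumerate_in_set)
  then have rN: "r i \<in> N" and mean: "?mean (r i) \<le> c" and vr: "v (r i) \<le> 1" for i
    by (auto simp: A_def less_imp_le)
  have r_top: "filterlim r at_top sequentially" using r by (rule filterlim_subseq)
  have "filterlim r ?F sequentially"
    unfolding filterlim_inf filterlim_principal using r_top rN by simp
  with v0 have v_r: "(\<lambda>i. v (r i)) \<longlonglongrightarrow> 0" by (rule filterlim_compose)
  \<comment> \<open>The leading coefficient is a nonzero integer. Hence both parts of v are
    nonnegative, and each is o(n) before division by n.\<close>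
  have l: "0 \<le> ln (norm (a (r i)))" for i
  proof -
    have "a (r i) = lead_coeff (P (r i))"
      unfolding P[OF rN] using a[OF rN, of i] by (simp add: lead_coeff_prod)
    then obtain u where "a (r i) = of_int u" using int[OF rN] by (metis Ints_cases)
    with a[OF rN, of i] have "1 \<le> norm (a (r i))" by simp
    then show ?thesis by simp
  qed
  have "2 \<le> c"
  proof (rule zero_limit_expectation[OF E cap r_top, where x = "\<lambda>i k. \<alpha> k (r i)" and l = "\<lambda>i. ln (norm (a (r i)))" and R = R])
    show "1 \<le> r i" for i using N1 rN by blast
    show "0 \<le> \<alpha> k (r i)" if "k \<in> {1..r i}" for i k using nonneg[OF rN that] .
    show "inj_on (\<lambda>k. \<alpha> k (r i)) {1..r i}" for i using inj[OF rN] .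
    show "- (2 * real (r i) * ln (norm (a (r i)))) \<le> (\<Sum>j=1..r i. \<Sum>k\<in>{1..r i} - {j}. ln \<bar>\<alpha> j (r i) - \<alpha> k (r i)\<bar>)" for i
      by (rule sum_ln_differences_ge[OF P[OF rN] a[OF rN] int[OF rN] inj[OF rN]])
    show "(\<lambda>i. (ln (norm (a (r i))) + (\<Sum>k=1..r i. green_on_line E (\<alpha> k (r i)))) / real (r i)) \<longlonglongrightarrow> 0"
      using v_r by (simp add: v_def)
    show "(ln (norm (a (r i))) + (\<Sum>k=1..r i. green_on_line E (\<alpha> k (r i)))) / real (r i) \<le> 1" for i
      using vr[of i] by (simp add: v_def)
  qed (use l mean R in auto)
  then show False using \<open>c < 2\<close> by simp
qed

theorem theorem2p6:
  fixes N :: "nat set"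
  assumes "infinite N" and "N \<subseteq> {1..}"
  shows
    "(\<forall>(E :: complex set) (P :: nat \<Rightarrow> complex poly) (a :: nat \<Rightarrow> complex) (\<alpha> :: nat \<Rightarrow> nat \<Rightarrow> real).
        compact E \<and> E \<subseteq> complex_of_real ` {0..} \<and> log_capacity E = 1 \<and>
        (\<forall>n\<in>N. P n = smult (a n) (\<Prod>k=1..n. [:- complex_of_real (\<alpha> k n), 1:]) \<and>
               a n \<noteq> 0 \<and>
               (\<forall>i. coeff (P n) i \<in> \<int>) \<and>
               (\<forall>k\<in>{1..n}. \<alpha> k n \<ge> 0) \<and>
               inj_on (\<lambda>k. \<alpha> k n) {1..n}) \<and>
        ((\<lambda>n. mahler_measure E (P n) powr (1 / real n)) \<longlongrightarrow> 1) (inf sequentially (principal N))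
        \<longrightarrow> (\<forall>m\<ge>1. Liminf (inf sequentially (principal N))
                       (\<lambda>n. ereal (symmetric_mean m n (\<lambda>k. \<alpha> k n))) \<ge> ereal (2 ^ m)))
     \<and> (\<forall>\<alpha> :: nat \<Rightarrow> nat \<Rightarrow> real.
        (\<forall>n\<in>N. proots (cheb04 n) = image_mset (\<lambda>k. \<alpha> k n) (mset_set {1..n}))
        \<longrightarrow> (\<forall>m\<ge>1. Liminf (inf sequentially (principal N))
                       (\<lambda>n. ereal (symmetric_mean m n (\<lambda>k. \<alpha> k n))) = ereal (2 ^ m)))"
proof (intro conjI allI impI)
  fix E :: "complex set" and P :: "nat \<Rightarrow> complex poly" and a :: "nat \<Rightarrow> complex"
    and \<alpha> :: "nat \<Rightarrow> nat \<Rightarrow> real" and m :: nat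
  let ?F = "inf sequentially (principal N)"
  assume hyp: "compact E \<and> E \<subseteq> complex_of_real ` {0..} \<and> log_capacity E = 1 \<and>
        (\<forall>n\<in>N. P n = smult (a n) (\<Prod>k=1..n. [:- complex_of_real (\<alpha> k n), 1:]) \<and>
               a n \<noteq> 0 \<and>
               (\<forall>i. coeff (P n) i \<in> \<int>) \<and>
               (\<forall>k\<in>{1..n}. \<alpha> k n \<ge> 0) \<and>
               inj_on (\<lambda>k. \<alpha> k n) {1..n}) \<and>
        ((\<lambda>n. mahler_measure E (P n) powr (1 / real n)) \<longlongrightarrow> 1) ?F"
  then have "bounded E" by (blast dest: compact_imp_bounded)
  then obtain R where R: "0 < R" "\<And>z. z \<in> E \<Longrightarrow> norm z \<le> R" by (auto simp: bounded_pos)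
  show "ereal (2 ^ m) \<le> Liminf ?F (\<lambda>n. ereal (symmetric_mean m n (\<lambda>k. \<alpha> k n)))"
  proof (rule Liminf_symmetric_mean_ge[where R = R])
    show "\<forall>\<^sub>F n in ?F. \<forall>k\<in>{1..n}. 0 \<le> \<alpha> k n"
      using hyp by (simp add: eventually_inf_principal)
    show "\<forall>\<^sub>F n in ?F. c \<le> (\<Sum>k=1..n. min (\<alpha> k n) R) / real n" if "c < 2" for c
      by (rule truncated_mean_eventually_ge[where E = E and P = P and a = a])
        (use hyp assms(2) R that in auto)
  qed (use R in auto)
next
  fix \<alpha> :: "nat \<Rightarrow> nat \<Rightarrow> real" and m :: nat
  let ?F = "inf sequentially (principal N)"
  assume "\<forall>n\<in>N. proots (cheb04 n) = image_mset (\<lambda>k. \<alpha> k n) (mset_set {1..n})"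
  then have roots: "\<forall>\<^sub>F n in ?F. proots (cheb04 n) = image_mset (\<lambda>k. \<alpha> k n) (mset_set {1..n})"
    by (simp add: eventually_inf_principal)
  \<comment> \<open>Infinitude of N enters here: on the trivial filter every \<open>Liminf\<close>
    is infinite, which would refute equality.\<close>
  have "?F \<noteq> bot"
  proof
    assume "?F = bot"
    then have "\<forall>\<^sub>F n in ?F. False" by simp
    then have "\<forall>\<^sub>F n in sequentially. n \<notin> N" by (simp add: eventually_inf_principal)
    then obtain n0 where "\<And>n. n0 \<le> n \<Longrightarrow> n \<notin> N" by (auto simp: eventually_sequentially)
    then have "N \<subseteq> {..<n0}" by (auto simp: not_le[symmetric])
    then show False using \<open>infinite N\<close> finite_subset by blast
  qed
  moreover have "\<forall>n\<in>N. 1 \<le> n" using assms(2) by auto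
  then have "\<forall>\<^sub>F n in ?F. 1 \<le> n" by (simp add: eventually_inf_principal)
  ultimately show "Liminf ?F (\<lambda>n. ereal (symmetric_mean m n (\<lambda>k. \<alpha> k n))) = ereal (2 ^ m)"
    using roots by (intro Liminf_symmetric_mean_cheb04) auto
qed

end
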